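(* For every integer $n\ge 5$, the combinatorial $(n,2)$-hypersimplices with extension complexity $2n$ are dense in the projective realization space $\mathcal{R}_{n,2}$.
   Context: For integers $0<k<n$, $\Delta_{n,k}=\mathrm{conv}\{x\in\{0,1\}^n : x_1+\cdots+x_n=k\}$. For $2\le k\le n-2$ its facets are exactly the $2n$ faces $F_i=\Delta_{n,k}\cap\{x_i=0\}$ and $G_i=\Delta_{n,k}\cap\{x_i=1\}$, $i=1,\dots,n$. A combinatorial $(n,k)$-hypersimplex is a polytope with face lattice isomorphic to that of $\Delta_{n,k}$. For a polytope $P\subset\mathbb{R}^{n-1}$ its homogenization is $\hom(P)=\mathrm{cone}(\{1\}\times P)\subset\mathbb{R}^n$. The projective realization space $\mathcal{R}_{n,k}$ is the set of matrices $(g_1,\dots,g_n,f_1,\dots,f_n)\in\mathbb{R}^{n\times 2n}$ (with columns $g_i,f_i\in\mathbb{R}^n$) for which the cone $\{y\in\mathbb{R}^n : \langle g_i,y\rangle\ge 0,\ \langle f_i,y\rangle\ge0,\ i=1,\dots,n\}$ is combinatorially isomorphic to $\hom(\Delta_{n,k})$, with $g_i,f_i$ defining the facets corresponding to $G_i,F_i$, modulo the action of $\mathrm{GL}_n(\mathbb{R})\times(\mathbb{R}_{>0})^{2n}$ (linear changes of coordinates on $\mathbb{R}^n$ and positive rescaling of each of the $2n$ columns), with the quotient topology. Points of $\mathcal{R}_{n,k}$ are combinatorial $(n,k)$-hypersimplices up to admissible projective transformation. The extension complexity (nonnegative rank) $\mathrm{rk}_+(P)$ of a convex polytope $P$ is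 the minimal number of facets of a polytope $\widehat{P}$ (of any dimension) such that $P$ is the image of $\widehat{P}$ under a linear projection (affine map). It is invariant under admissible projective transformations and hence well defined on $\mathcal{R}_{n,k}$ (evaluate it on any polytope whose homogenization is linearly isomorphic to the cone). *)

theory Defs
  imports "HOL-Analysis.Analysis" "HOL-Analysis.Finite_Function_Topology"
begin

section \<open>Hypersimplices and homogenization\<close>

text \<open>Coordinates are indexed by a finite type \<^typ>\<open>'n\<close> with n elements. The hypersimplex is
  (n-1)-dimensional but lives in n-space, as in its usual 0/1-description.\<close>

definition hypersimplex :: "nat \<Rightarrow> (real ^ 'n::finite) set" where
  "hypersimplex k =
     convex hull {x. (\<forall>i. x $ i = 0 \<or> x $ i = 1) \<and> (\<Sum>i\<in>UNIV. x $ i) = real k}"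

definition hypersimplex_F :: "nat \<Rightarrow> 'n::finite \<Rightarrow> (real ^ 'n) set" where
  "hypersimplex_F k i = hypersimplex k \<inter> {x. x $ i = 0}"

definition hypersimplex_G :: "nat \<Rightarrow> 'n::finite \<Rightarrow> (real ^ 'n) set" where
  "hypersimplex_G k i = hypersimplex k \<inter> {x. x $ i = 1}"

definition homogenization :: "'a::real_vector set \<Rightarrow> (real \<times> 'a) set" where
  "homogenization P = convex_cone hull ({1} \<times> P)"

definition linearly_isomorphic :: "'a::real_vector set \<Rightarrow> 'b::real_vector set \<Rightarrow> bool" where
  "linearly_isomorphic S T \<longleftrightarrow> (\<exists>L. linear L \<and> inj_on L (span S) \<and> L ` S = T)"

text \<open>The relation \<^const>\<open>face_of\<close> also counts the empty set as a face, even of a cone. An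
  isomorphism of face posets preserves this least element, so for two cones this is the same as
  an isomorphism of the lattices of nonempty faces.\<close>

definition face_lattice_iso ::
  "('a::real_vector set \<Rightarrow> 'b::real_vector set) \<Rightarrow> 'a set \<Rightarrow> 'b set \<Rightarrow> bool" where
  "face_lattice_iso \<phi> S T \<longleftrightarrow>
     bij_betw \<phi> {F. F face_of S} {F. F face_of T} \<and>
     (\<forall>F F'. F face_of S \<longrightarrow> F' face_of S \<longrightarrow> (F \<subseteq> F' \<longleftrightarrow> \<phi> F \<subseteq> \<phi> F'))"


section \<open>Extension complexity\<close>

text \<open>\<^const>\<open>aff_dim\<close> and \<^const>\<open>facet_of\<close> are restricted to Euclidean spaces. The next two
  definitions repeat them for arbitrary real vector spaces. This allows an extension of a polytope
  to have any dimension, because the type \<^typ>\<open>nat \<Rightarrow>\<^sub>0 real\<close> of finitely supported sequences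
  contains every finite-dimensional coordinate space.\<close>

definition affine_dim :: "'a::real_vector set \<Rightarrow> int" where
  "affine_dim V =
     (SOME d :: int.
        \<exists>B. affine hull B = affine hull V \<and> \<not> affine_dependent B \<and> of_nat (card B) = d + 1)"

definition facets :: "'a::real_vector set \<Rightarrow> 'a set set" where
  "facets S = {F. F face_of S \<and> F \<noteq> {} \<and> affine_dim F = affine_dim S - 1}"

lemma affine_dim_eq_aff_dim: "affine_dim (V :: 'a::euclidean_space set) = aff_dim V"
  by (simp add: affine_dim_def aff_dim_def)

lemma facets_eq_facet_of: "facets (S :: 'a::euclidean_space set) = {F. F facet_of S}"
  by (simp add: facets_def facet_of_def affine_dim_eq_aff_dim)

definition extension_complexity :: "'a::real_vector set \<Rightarrow> nat" where
  "extension_complexity P =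
     (LEAST m. \<exists>(Q :: (nat \<Rightarrow>\<^sub>0 real) set) L c.
        polytope Q \<and> linear L \<and> P = (\<lambda>x. L x + c) ` Q \<and> card (facets Q) = m)"


section \<open>The projective realization space\<close>

text \<open>Column \<^term>\<open>Inl i\<close> of a matrix is $g_i$ and column \<^term>\<open>Inr i\<close> is $f_i$.\<close>

definition matrix_cone :: "real ^ ('n + 'n) ^ 'n::finite \<Rightarrow> (real ^ 'n) set" where
  "matrix_cone A = {y. \<forall>i. column (Inl i) A \<bullet> y \<ge> 0 \<and> column (Inr i) A \<bullet> y \<ge> 0}"

definition realization_matrices :: "nat \<Rightarrow> (real ^ ('n + 'n) ^ 'n::finite) set" where
  "realization_matrices k =
     {A. \<exists>\<phi>. face_lattice_iso \<phi> (homogenization (hypersimplex k :: (real ^ 'n) set)) (matrix_cone A) \<and>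
        (\<forall>i. \<phi> (homogenization (hypersimplex_G k i)) =
                matrix_cone A \<inter> {y. column (Inl i) A \<bullet> y = 0}) \<and>
        (\<forall>i. \<phi> (homogenization (hypersimplex_F k i)) =
                matrix_cone A \<inter> {y. column (Inr i) A \<bullet> y = 0})}"

definition matrix_orbit :: "real ^ ('n + 'n) ^ 'n::finite \<Rightarrow> (real ^ ('n + 'n) ^ 'n) set" where
  "matrix_orbit A =
     {B. \<exists>(M :: real ^ 'n ^ 'n) d. invertible M \<and> (\<forall>j. d j > 0) \<and>
        (\<forall>j. column j B = d j *\<^sub>R (M *v column j A))}"

definition quotient_topology :: "'a topology \<Rightarrow> ('a \<Rightarrow> 'b) \<Rightarrow> 'b topology" where
  "quotient_topology X q =
     topology (\<lambda>U. U \<subseteq> q ` topspace X \<and> openin X {x \<in> topspace X. q x \<in> U})"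

lemma openin_quotient_topology:
  "openin (quotient_topology X q) U \<longleftrightarrow>
     U \<subseteq> q ` topspace X \<and> openin X {x \<in> topspace X. q x \<in> U}"
proof -
  have "istopology (\<lambda>U. U \<subseteq> q ` topspace X \<and> openin X {x \<in> topspace X. q x \<in> U})"
    unfolding istopology_def
  proof (intro conjI allI impI; (elim conjE)?)
    fix S T
    assume "openin X {x \<in> topspace X. q x \<in> S}" "openin X {x \<in> topspace X. q x \<in> T}"
    then have "openin X ({x \<in> topspace X. q x \<in> S} \<inter> {x \<in> topspace X. q x \<in> T})"
      by blast
    moreover have "{x \<in> topspace X. q x \<in> S} \<inter> {x \<in> topspace X. q x \<in> T}
        = {x \<in> topspace X. q x \<in> S \<inter> T}"
      by blast
    ultimately show "openin X {x \<in> topspace X. q x \<in> S \<inter> T}"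
      by simp
  next
    fix K
    assume "\<forall>S\<in>K. S \<subseteq> q ` topspace X \<and> openin X {x \<in> topspace X. q x \<in> S}"
    then have "openin X (\<Union>S\<in>K. {x \<in> topspace X. q x \<in> S})"
      by blast
    moreover have "(\<Union>S\<in>K. {x \<in> topspace X. q x \<in> S}) = {x \<in> topspace X. q x \<in> \<Union>K}"
      by blast
    ultimately show "openin X {x \<in> topspace X. q x \<in> \<Union>K}"
      by simp
  qed blast+
  then show ?thesis
    by (simp add: quotient_topology_def)
qed

lemma topspace_quotient_topology: "topspace (quotient_topology X q) = q ` topspace X"
proof -
  have "{x \<in> topspace X. q x \<in> q ` topspace X} = topspace X"
    by blast
  then have "openin (quotient_topology X q) (q ` topspace X)"
    by (simp add: openin_quotient_topology)
  then show ?thesis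
    by (metis openin_quotient_topology openin_subset openin_topspace subset_antisym)
qed

lemma quotient_map_quotient_topology: "quotient_map X (quotient_topology X q) q"
  by (auto simp: quotient_map_def topspace_quotient_topology openin_quotient_topology)

definition realization_space :: "nat \<Rightarrow> (real ^ ('n + 'n) ^ 'n::finite) set topology" where
  "realization_space k =
     quotient_topology (subtopology euclidean (realization_matrices k)) matrix_orbit"

text \<open>The extension complexity of a point of the realization space is that of any polytope whose
  homogenization is linearly isomorphic to the associated cone. It does not depend on the choice of
  the polytope. Such a polytope is (n-1)-dimensional; like the hypersimplex itself it is taken in
  n-space, possibly in a hyperplane.\<close>

definition orbit_extension_complexity :: "(real ^ ('n + 'n) ^ 'n::finite) set \<Rightarrow> nat" where
  "orbit_extension_complexity \<rho> =
     (THE r. \<exists>A\<in>\<rho>. \<exists>P :: (real ^ 'n) set.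
        polytope P \<and> linearly_isomorphic (homogenization P) (matrix_cone A) \<and>
        extension_complexity P = r)"

end

theory Submission
  imports Defs "HOL-Complex_Analysis.Complex_Singularities"
begin

text \<open>Every realization is, in the coordinates given by the independent functionals \<open>f\<^sub>k\<close>, a cone
  \<open>0 \<le> y\<^sub>k \<le> (\<Sum>j\<noteq>k. a\<^sub>k\<^sub>j y\<^sub>j)\<close> with positive weights satisfying \<open>a\<^sub>k\<^sub>j a\<^sub>j\<^sub>k = 1\<close>, and all such
  weights occur: the cone over a simplex whose vertices are truncated so that any two truncations meet in
  a point of the edge. Its rays are therefore indexed by the edges of the complete graph. An extension
  with \<open>m\<close> facets yields a nonnegative factorization of the slack matrix with \<open>m\<close> terms. For generic
  weights such a factorization has at least \<open>2n\<close> terms, by induction on \<open>n\<close> starting with a weighted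
  count of covered entries for \<open>n = 5\<close>. Generic weights are reached from any weights by an arbitrarily
  small analytic perturbation.\<close>

section \<open>Nonnegative factorizations of slack matrices\<close>

text \<open>The zero pattern alone does not carry the count for five indices. A term that meets one
  row \<open>Inr i\<close>, one or two rows \<open>Inl k\<close> and all admissible edges through
  \<open>i\<close> could collect 15 or 14 units, and a bound of 15 against a total of 120 gives only
  8 terms. Nonzero 2 x 2 minors lower the bound to 13: entries covered by this term alone form
  blocks of rank one, so at most one of its columns is covered once throughout. Since
  \<open>9 * 13 = 117\<close>, ten terms are needed. The obstacle to genericity is that the natural
  reference point, the hypersimplex with all weights 1, has vanishing minors. The path of weights
  therefore has logarithms \<open>(1 - t) * (x + t * y)\<close>: at \<open>t = 1\<close> it reaches
  the unit weights, which settles the rank conditions by analyticity, while the direction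
  \<open>y\<close> makes the logarithmic defect of each minor \<open>1 - t\<close> times a
  nonconstant affine function of \<open>t\<close>. Extensions live in a space of sequences of
  unbounded dimension, so the duality between facets and nonnegative functionals is developed in
  real vector spaces.\<close>

lemma homogeneous_system_nontrivial_solution:
  fixes M :: "'a \<Rightarrow> 'b \<Rightarrow> 'f::field"
  assumes "finite I" "finite V" "card I < card V"
  shows "\<exists>c. (\<exists>j\<in>V. c j \<noteq> 0) \<and> (\<forall>s\<in>I. (\<Sum>j\<in>V. c j * M j s) = 0)"
  using assms
proof (induction I arbitrary: V M rule: finite_induct)
  case empty
  then obtain j where "j \<in> V" by fastforce
  then show ?case by (intro exI[of _ "\<lambda>_. 1"]) auto
next
  case (insert s I)
  show ?case
  proof (cases "\<forall>j\<in>V. M j s = 0")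
    case True
    have "card I < card V" using insert by auto
    from insert.IH[OF insert.prems(1) this, of M] obtain c
      where "\<exists>j\<in>V. c j \<noteq> 0" "\<forall>t\<in>I. (\<Sum>j\<in>V. c j * M j t) = 0" by auto
    with True show ?thesis by (intro exI[of _ c]) auto
  next
    case False
    then obtain p where p: "p \<in> V" "M p s \<noteq> 0" by auto
    let ?V = "V - {p}"
    let ?M = "\<lambda>j t. M j t - M j s / M p s * M p t"
    have "card I < card ?V" using insert p by auto
    from insert.IH[OF _ this, of ?M] insert.prems obtain c
      where c: "\<exists>j\<in>?V. c j \<noteq> 0" "\<And>t. t \<in> I \<Longrightarrow> (\<Sum>j\<in>?V. c j * ?M j t) = 0" by auto
    define d where "d = c(p := - (\<Sum>j\<in>?V. c j * M j s) / M p s)"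
    have split: "(\<Sum>j\<in>V. d j * M j t) = d p * M p t + (\<Sum>j\<in>?V. c j * M j t)" for t
      using insert.prems p by (simp add: sum.remove[of V p] d_def)
    have "(\<Sum>j\<in>V. d j * M j s) = 0"
      unfolding split using p by (simp add: d_def)
    moreover have "(\<Sum>j\<in>V. d j * M j t) = 0" if "t \<in> I" for t
    proof -
      have "(\<Sum>j\<in>?V. c j * ?M j t) = (\<Sum>j\<in>?V. c j * M j t) - (\<Sum>j\<in>?V. c j * M j s) / M p s * M p t"
        by (simp add: right_diff_distrib sum_subtractf sum_divide_distrib sum_distrib_right mult.assoc)
      then show ?thesis using c(2)[OF that] unfolding split by (simp add: d_def)
    qed
    moreover have "\<exists>j\<in>V. d j \<noteq> 0" using c(1) by (auto simp: d_def)
    ultimately show ?thesis by (intro exI[of _ d]) auto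
  qed
qed

section \<open>Edges of the complete graph and the support of the slack matrix\<close>

definition edges :: "'n set \<Rightarrow> 'n set set" where
  "edges V = {e. e \<subseteq> V \<and> card e = 2}"

lemma edges_mono: "V \<subseteq> W \<Longrightarrow> edges V \<subseteq> edges W"
  by (auto simp: edges_def)

lemma in_edges_UNIV: "e \<in> edges V \<Longrightarrow> e \<in> edges UNIV"
  by (auto simp: edges_def)

lemma finite_edges: "finite V \<Longrightarrow> finite (edges V)"
  by (auto simp: edges_def)

lemma card_edges: "finite V \<Longrightarrow> card (edges V) = card V choose 2"
  by (simp add: edges_def n_subsets)

lemma doubleton_edge: "i \<noteq> j \<Longrightarrow> {i, j} \<in> edges V \<longleftrightarrow> i \<in> V \<and> j \<in> V"
  by (auto simp: edges_def)

lemma edgeE: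
  assumes "e \<in> edges V"
  obtains i j where "e = {i, j}" "i \<noteq> j" "i \<in> V" "j \<in> V"
  using assms by (auto simp: edges_def card_2_iff)

lemma edge_containing_eq: "e \<in> edges V \<Longrightarrow> i \<in> e \<Longrightarrow> j \<in> e \<Longrightarrow> i \<noteq> j \<Longrightarrow> e = {i, j}"
  by (auto elim!: edgeE)

text \<open>The ray of the edge \<open>e\<close> in the hypersimplex is the vertex with ones at the
  two indices of \<open>e\<close>. Row \<open>Inl k\<close> is the facet \<open>x_k = 1\<close> with
  slack \<open>1 - x_k\<close>, row \<open>Inr k\<close> the facet \<open>x_k = 0\<close> with slack
  \<open>x_k\<close>.\<close>

fun positive_on :: "'n + 'n \<Rightarrow> 'n set \<Rightarrow> bool" where
  "positive_on (Inl k) e \<longleftrightarrow> k \<notin> e"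
| "positive_on (Inr k) e \<longleftrightarrow> k \<in> e"

text \<open>Apart from the zero pattern, two numerical properties of the slack matrix enter the
  count: \<open>minor\<close> serves the case of five indices, \<open>rank\<close> the induction
  step, which starts at six. The set \<open>I\<close> stands for the facets of an extension.\<close>

locale slack_factorization =
  fixes S :: "'n::finite + 'n \<Rightarrow> 'n set \<Rightarrow> real"
    and I :: "'s set" and l :: "'n + 'n \<Rightarrow> 's \<Rightarrow> real" and h :: "'s \<Rightarrow> 'n set \<Rightarrow> real"
  assumes finite_I: "finite I"
    and S_eq_0_iff: "\<And>x e. e \<in> edges UNIV \<Longrightarrow> S x e = 0 \<longleftrightarrow> \<not> positive_on x e"
    and l_nonneg: "\<And>x s. s \<in> I \<Longrightarrow> 0 \<le> l x s"
    and h_nonneg: "\<And>s e. s \<in> I \<Longrightarrow> e \<in> edges UNIV \<Longrightarrow> 0 \<le> h s e"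
    and factorization: "\<And>x e. e \<in> edges UNIV \<Longrightarrow> S x e = (\<Sum>s\<in>I. l x s * h s e)"
    and minor: "\<And>i j k m. distinct [i, j, k, m] \<Longrightarrow>
      S (Inr i) {i, j} * S (Inl k) {i, m} \<noteq> S (Inr i) {i, m} * S (Inl k) {i, j}"
    and rank: "\<And>V c k. 6 \<le> card V \<Longrightarrow> (\<And>e. e \<in> edges V \<Longrightarrow> (\<Sum>k\<in>V. c k * S (Inl k) e) = 0) \<Longrightarrow>
      k \<in> V \<Longrightarrow> c k = 0"
begin

definition covers :: "'s \<Rightarrow> 'n + 'n \<Rightarrow> 'n set \<Rightarrow> bool" where
  "covers s x e \<longleftrightarrow> 0 < l x s \<and> 0 < h s e"

text \<open>Restricting the slack matrix to rows and edges from \<open>V\<close> leaves a matrix of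
  the same pattern. Counting the terms that contribute to this restriction allows an induction on
  \<open>V\<close> within one fixed factorization.\<close>

definition alive :: "'n set \<Rightarrow> 's set" where
  "alive V = {s \<in> I. \<exists>x\<in>V <+> V. \<exists>e\<in>edges V. covers s x e}"

definition coverers :: "'n + 'n \<Rightarrow> 'n set \<Rightarrow> 's set" where
  "coverers x e = {s \<in> I. covers s x e}"

lemma finite_alive: "finite (alive V)"
  using finite_I by (simp add: alive_def)

lemma finite_coverers: "finite (coverers x e)"
  using finite_I by (simp add: coverers_def)

lemma alive_mono: "V \<subseteq> W \<Longrightarrow> alive V \<subseteq> alive W"
  unfolding alive_def using edges_mono[of V W] by (auto simp: Plus_def; blast)

lemma term_nonneg: "s \<in> I \<Longrightarrow> e \<in> edges UNIV \<Longrightarrow> 0 \<le> l x s * h s e"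
  by (simp add: l_nonneg h_nonneg)

lemma term_eq_0_iff: "s \<in> I \<Longrightarrow> e \<in> edges UNIV \<Longrightarrow> l x s * h s e = 0 \<longleftrightarrow> \<not> covers s x e"
  using l_nonneg[of s x] h_nonneg[of s e] by (auto simp: covers_def)

lemma coverers_nonempty_iff:
  assumes "e \<in> edges UNIV"
  shows "coverers x e \<noteq> {} \<longleftrightarrow> positive_on x e"
proof -
  have "S x e = 0 \<longleftrightarrow> (\<forall>s\<in>I. l x s * h s e = 0)"
    unfolding factorization[OF assms]
    using finite_I term_nonneg[OF _ assms] by (intro sum_nonneg_eq_0_iff) auto
  then show ?thesis
    using S_eq_0_iff[OF assms, of x] term_eq_0_iff[OF _ assms, of _ x]
    by (auto simp: coverers_def)
qed

lemma covers_imp_positive_on: "s \<in> I \<Longrightarrow> e \<in> edges UNIV \<Longrightarrow> covers s x e \<Longrightarrow> positive_on x e"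
  using coverers_nonempty_iff[of e x] by (auto simp: coverers_def)

lemma S_eq_sum_coverers:
  assumes "e \<in> edges UNIV"
  shows "S x e = (\<Sum>s\<in>coverers x e. l x s * h s e)"
  unfolding factorization[OF assms]
  using finite_I term_eq_0_iff[OF _ assms, of _ x]
  by (intro sum.mono_neutral_right) (auto simp: coverers_def)

text \<open>Entries whose only coverer is the same term are products of a row factor and a column
  factor. This is how nonzero minors restrict a factorization.\<close>

lemma S_eq_single:
  assumes "e \<in> edges UNIV" "s \<in> coverers x e" "card (coverers x e) = 1"
  shows "S x e = l x s * h s e"
proof -
  have "coverers x e = {s}" using assms(2,3) by (auto simp: card_1_singleton_iff)
  then show ?thesis by (simp add: S_eq_sum_coverers[OF assms(1)])
qed

text \<open>Charging for \<open>n = 5\<close>: the 20 entries in the \<open>Inr\<close> rows have weight 3 and the 30 entries in the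
  \<open>Inl\<close> rows weight 2, in total 120. An entry covered by one term pays its full weight to that term,
  an entry covered several times pays one unit less to each of its terms. Every term receives at most 13
  and \<open>9 * 13 < 120\<close>.\<close>

definition weight :: "'n + 'n \<Rightarrow> nat" where
  "weight x = (case x of Inl _ \<Rightarrow> 2 | Inr _ \<Rightarrow> 3)"

definition gain :: "'n set \<Rightarrow> 's \<Rightarrow> nat" where
  "gain V s = (\<Sum>(x, e) \<in> {(x, e) \<in> (V <+> V) \<times> edges V. covers s x e}.
     if card (coverers x e) = 1 then weight x else weight x - 1)"

text \<open>An entry that is covered several times still pays at least its weight, since \<open>2 * (w - 1) \<ge> w\<close>.\<close>

lemma sum_gain_ge:
  assumes "card V = 5"
  shows "120 \<le> (\<Sum>s\<in>alive V. gain V s)"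
proof -
  let ?X = "(V <+> V) \<times> edges V"
  let ?p = "\<lambda>x e. if card (coverers x e) = 1 then weight x else weight x - 1"
  have fV: "finite V" by simp
  then have fX: "finite ?X" by (simp add: finite_edges)
  have "(\<Sum>s\<in>alive V. gain V s) = (\<Sum>s\<in>alive V. \<Sum>z\<in>{z\<in>?X. covers s (fst z) (snd z)}. ?p (fst z) (snd z))"
    unfolding gain_def by (intro sum.cong refl) (auto simp: case_prod_beta)
  also have "\<dots> = (\<Sum>z\<in>?X. \<Sum>s\<in>{s\<in>alive V. covers s (fst z) (snd z)}. ?p (fst z) (snd z))"
    using sum.swap_restrict[OF finite_alive[of V] fX, of "\<lambda>s z. ?p (fst z) (snd z)" "\<lambda>s z. covers s (fst z) (snd z)"] .
  also have "\<dots> = (\<Sum>z\<in>?X. card (coverers (fst z) (snd z)) * ?p (fst z) (snd z))"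
  proof (intro sum.cong refl)
    fix z assume "z \<in> ?X"
    then have "{s\<in>alive V. covers s (fst z) (snd z)} = coverers (fst z) (snd z)"
      by (fastforce simp: alive_def coverers_def)
    then show "(\<Sum>s\<in>{s\<in>alive V. covers s (fst z) (snd z)}. ?p (fst z) (snd z))
        = card (coverers (fst z) (snd z)) * ?p (fst z) (snd z)" by simp
  qed
  also have "\<dots> \<ge> (\<Sum>z\<in>?X. if positive_on (fst z) (snd z) then weight (fst z) else 0)"
  proof (rule sum_mono)
    fix z assume z: "z \<in> ?X"
    obtain x e where [simp]: "z = (x, e)" by force
    have e: "e \<in> edges UNIV" using z by (auto intro: in_edges_UNIV)
    show "(if positive_on (fst z) (snd z) then weight (fst z) else 0)
       \<le> card (coverers (fst z) (snd z)) * ?p (fst z) (snd z)"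
    proof (cases "positive_on x e \<and> card (coverers x e) \<noteq> 1")
      case True
      then have "card (coverers x e) \<ge> 2"
      proof -
        have "0 < card (coverers x e)"
          using True coverers_nonempty_iff[OF e, of x] finite_coverers[of x e] by (simp add: card_gt_0_iff)
        with True show ?thesis by linarith
      qed
      then have "weight x \<le> 2 * (weight x - 1)" "2 * (weight x - 1) \<le> card (coverers x e) * (weight x - 1)"
        by (auto simp: weight_def split: sum.splits)
      then have "weight x \<le> card (coverers x e) * (weight x - 1)" by (rule order_trans)
      with True show ?thesis by simp
    qed auto
  qed
  also have "(\<Sum>z\<in>?X. if positive_on (fst z) (snd z) then weight (fst z) else 0)
     = (\<Sum>e\<in>edges V. \<Sum>x\<in>V <+> V. if positive_on x e then weight x else 0)"
    by (subst sum.swap) (simp add: sum.cartesian_product case_prod_beta)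
  \<comment> \<open>In each of the ten columns the three indices outside \<open>e\<close> contribute
    2 each and the two indices of \<open>e\<close> contribute 3 each.\<close>
  also have "\<dots> = (\<Sum>e\<in>edges V. 12)"
  proof (rule sum.cong[OF refl])
    fix e assume e: "e \<in> edges V"
    have "card (V - e) = 3" "V \<inter> e = e" "card e = 2"
      using e assms by (auto simp: edges_def card_Diff_subset)
    moreover have "(\<Sum>x\<in>V <+> V. if positive_on x e then weight x else 0)
       = (\<Sum>k\<in>V. if k \<notin> e then 2 else 0) + (\<Sum>k\<in>V. if k \<in> e then 3 else 0)"
      by (simp add: sum.Plus weight_def cong: if_cong)
    moreover have "(\<Sum>k\<in>V. if k \<notin> e then 2 else 0) = 2 * card (V - e)"
      by (simp add: sum.If_cases Diff_eq Compl_eq)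
    moreover have "(\<Sum>k\<in>V. if k \<in> e then 3 else 0) = 3 * card (V \<inter> e)"
      by (simp add: sum.If_cases)
    ultimately show "(\<Sum>x\<in>V <+> V. if positive_on x e then weight x else 0) = 12" by simp
  qed
  also have "\<dots> = 120" using assms by (simp add: card_edges choose_two)
  finally show ?thesis .
qed

text \<open>The entries covered by one term form a rectangle with rows \<open>T <+> P\<close> and
  columns \<open>C\<close>, where every edge in \<open>C\<close> contains \<open>P\<close> and
  avoids \<open>T\<close>. With \<open>P\<close> empty, \<open>C\<close> consists of edges on
  \<open>V - T\<close>, which gives at most 12; with two indices in \<open>P\<close> there is one
  column, again at most 12. With \<open>P = {i}\<close> the columns form a star at \<open>i\<close>:
  an empty \<open>T\<close> gives 12, and the values 15 and 14 for one and two indices in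
  \<open>T\<close> drop to 13 by the minors.\<close>

lemma gain_le:
  assumes V: "card V = 5" and s: "s \<in> I"
  shows "gain V s \<le> 13"
proof -
  define P where "P = {k\<in>V. 0 < l (Inr k) s}"
  define T where "T = {k\<in>V. 0 < l (Inl k) s}"
  define C where "C = {e\<in>edges V. 0 < h s e}"
  define bad where "bad = {e\<in>C. \<exists>x\<in>T <+> P. card (coverers x e) \<noteq> 1}"
  have fin: "finite P" "finite T" "finite C" by (auto simp: P_def T_def C_def)
  have rect: "{(x, e) \<in> (V <+> V) \<times> edges V. covers s x e} = (T <+> P) \<times> C"
    by (auto simp: P_def T_def C_def covers_def)
  have cov: "s \<in> coverers x e" if "x \<in> T <+> P" "e \<in> C" for x e
    using that s by (auto simp: coverers_def covers_def P_def T_def C_def)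
  have pos: "positive_on x e" if "x \<in> T <+> P" "e \<in> C" for x e
    using cov[OF that] that in_edges_UNIV[of e V] covers_imp_positive_on[of s e x]
    by (auto simp: coverers_def C_def)
  have PT: "P \<subseteq> e" "T \<inter> e = {}" "card e = 2" "e \<subseteq> V" if "e \<in> C" for e
    using pos[OF _ that] that by (force simp: C_def edges_def)+
  have PTV: "P \<subseteq> V" "T \<subseteq> V" by (auto simp: P_def T_def)
  have "(\<Sum>x\<in>T <+> P. weight x) = 2 * card T + 3 * card P"
    using fin by (simp add: sum.Plus weight_def)
  then have total: "(\<Sum>(x, e)\<in>(T <+> P) \<times> C. weight x) = (2 * card T + 3 * card P) * card C"
    by (simp add: sum.cartesian_product[symmetric] sum_distrib_left[symmetric] mult.commute)
  have "gain V s \<le> (\<Sum>(x, e)\<in>(T <+> P) \<times> C. weight x)"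
    unfolding gain_def rect by (intro sum_mono) auto
  with total have gain1: "gain V s \<le> (2 * card T + 3 * card P) * card C" by simp
  \<comment> \<open>Each column in \<open>bad\<close> contains an entry that pays one unit less than
    its weight, so the weight of the rectangle exceeds the gain by at least
    \<open>card bad\<close>.\<close>
  have "gain V s + card bad \<le> gain V s + card {z\<in>(T <+> P) \<times> C. card (coverers (fst z) (snd z)) \<noteq> 1}"
  proof -
    have "bad \<subseteq> snd ` {z\<in>(T <+> P) \<times> C. card (coverers (fst z) (snd z)) \<noteq> 1}"
      by (force simp: bad_def)
    then show ?thesis using fin by (simp add: surj_card_le finite_subset)
  qed
  also have "\<dots> = (\<Sum>z\<in>(T <+> P) \<times> C. (if card (coverers (fst z) (snd z)) = 1 then weight (fst z) else weight (fst z) - 1)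
      + (if card (coverers (fst z) (snd z)) \<noteq> 1 then 1 else 0))"
    unfolding gain_def rect sum.distrib using fin
    by (simp add: case_prod_beta sum.If_cases Int_def)
  also have "\<dots> = (\<Sum>(x, e)\<in>(T <+> P) \<times> C. weight x)"
    by (intro sum.cong refl) (auto simp: weight_def split: sum.splits)
  finally have gain2: "gain V s + card bad \<le> (2 * card T + 3 * card P) * card C"
    using total by simp
  show ?thesis
  proof (cases "C = {}")
    case True
    with gain1 show ?thesis by simp
  next
    case False
    then obtain e0 where e0: "e0 \<in> C" by auto
    consider "P = {}" | i where "P = {i}" | i j where "i \<in> P" "j \<in> P" "i \<noteq> j"
      by (metis is_singletonE is_singletonI')
    then show ?thesis
    proof cases
      case 1
      have "C \<subseteq> edges (V - T)"
      proof
        fix e assume "e \<in> C"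
        from PT[OF this] show "e \<in> edges (V - T)" by (auto simp: edges_def)
      qed
      then have "card C \<le> (5 - card T) choose 2"
        using card_mono[OF finite_edges[of "V - T"]] V PTV by (auto simp: card_edges card_Diff_subset)
      moreover have "card T \<le> 5" using card_mono[OF _ PTV(2)] V by simp
      then have "card T \<in> {0, 1, 2, 3, 4, 5}" by (auto simp: numeral_eq_Suc le_Suc_eq)
      ultimately show ?thesis using gain1 1 by (auto simp: choose_two)
    next
      case (2 i)
      have iT: "i \<notin> T" "i \<in> V" using PT[OF e0] 2 PTV by auto
      have "C \<subseteq> (\<lambda>j. {i, j}) ` (V - insert i T)"
      proof
        fix e assume e: "e \<in> C"
        then obtain a b where ab: "e = {a, b}" "a \<noteq> b" "a \<in> V" "b \<in> V"
          by (auto simp: C_def elim: edgeE)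
        with PT[OF e] 2 show "e \<in> (\<lambda>j. {i, j}) ` (V - insert i T)" by auto
      qed
      then have "card C \<le> card (V - insert i T)" by (intro surj_card_le) auto
      also have "\<dots> = 5 - (1 + card T)" using iT PTV V by (subst card_Diff_subset) auto
      finally have C4: "card C \<le> 4 - card T" by simp
      show ?thesis
      proof (cases "T = {}")
        case True
        then show ?thesis using gain1 2 C4 by simp
      next
        case False
        then obtain k where k: "k \<in> T" by auto
        \<comment> \<open>Two columns outside \<open>bad\<close> would contain a 2 x 2 block in the
          rows \<open>Inr i\<close> and \<open>Inl k\<close> covered by \<open>s\<close> alone,
          whose minor vanishes.\<close>
        have "e = e'" if e: "e \<in> C - bad" and e': "e' \<in> C - bad" for e e'
        proof (rule ccontr)
          assume ne: "e \<noteq> e'"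
          obtain j where j: "e = {i, j}" "j \<noteq> i"
            using PT[of e] e 2 by (auto simp: card_2_iff)
          obtain m where m: "e' = {i, m}" "m \<noteq> i"
            using PT[of e'] e' 2 by (auto simp: card_2_iff)
          have dist: "distinct [i, j, k, m]" using j m ne k PT[of e] PT[of e'] e e' iT by auto
          have rows: "Inr i \<in> T <+> P" "Inl k \<in> T <+> P" using 2 k by auto
          have "S x e = l x s * h s e \<and> S x e' = l x s * h s e'" if "x \<in> T <+> P" for x
            using e e' that cov in_edges_UNIV by (intro conjI S_eq_single) (auto simp: bad_def C_def)
          with rows minor[OF dist] j m show False by simp
        qed
        then have "card (C - bad) \<le> 1" using fin(3) by (auto simp: card_le_Suc0_iff_eq)
        then have Cb: "card C \<le> card bad + 1"
          using fin(3) by (simp add: bad_def card_Diff_subset)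
        have "0 < card T" using False fin by auto
        moreover have "card T \<le> 4" using card_mono[of V "insert i T"] iT PTV V fin by auto
        ultimately have "card T \<in> {1, 2, 3, 4}" by (auto simp: numeral_eq_Suc le_Suc_eq)
        then show ?thesis using gain2 2 C4 Cb by auto
      qed
    next
      case (3 i j)
      have "C \<subseteq> {{i, j}}"
        using PT(1) 3 by (auto simp: C_def dest: edge_containing_eq[of _ V i j])
      then have "C = {{i, j}}" using e0 by auto
      moreover have "P \<subseteq> {i, j}" "T \<subseteq> V - e0" using PT e0 PTV \<open>C = {{i, j}}\<close> by auto
      then have "card P \<le> 2" "card T \<le> 3"
        using card_mono[of "{i, j}" P] card_mono[of "V - e0" T] PT[OF e0] V 3
        by (auto simp: card_Diff_subset)
      ultimately show ?thesis using gain1 by simp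
    qed
  qed
qed

lemma card_alive_five:
  assumes "card V = 5"
  shows "10 \<le> card (alive V)"
proof -
  have "120 \<le> (\<Sum>s\<in>alive V. gain V s)" by (rule sum_gain_ge[OF assms])
  also have "\<dots> \<le> (\<Sum>s\<in>alive V. 13)" by (intro sum_mono gain_le assms) (auto simp: alive_def)
  finally show ?thesis by simp
qed

text \<open>If two terms are used for the row \<open>Inr k\<close>, they vanish on the edges avoiding \<open>k\<close> and
  induction applies to \<open>V - {k}\<close>. If each row \<open>Inr k\<close> uses a single term, these terms do not
  contribute to the \<open>Inl\<close> rows, which need \<open>card V\<close> further terms by their rank.\<close>

lemma card_alive_ge: "5 \<le> card V \<Longrightarrow> 2 * card V \<le> card (alive V)"
proof (induction "card V" arbitrary: V rule: less_induct)
  case less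
  have fV: "finite V" by simp
  show ?case
  proof (cases "card V = 5")
    case True
    then show ?thesis using card_alive_five by simp
  next
    case False
    with less.prems have V6: "6 \<le> card V" by simp
    define U where "U k = {s \<in> I. \<exists>e\<in>edges V. covers s (Inr k) e}" for k
    have U_alive: "U k \<subseteq> alive V" if "k \<in> V" for k
      using that by (auto simp: U_def alive_def)
    have U_fin: "finite (U k)" for k using finite_I by (simp add: U_def)
    have lU: "0 < l (Inr k) s" if "s \<in> U k" for s k using that by (auto simp: U_def covers_def)
    have U_h: "h s e = 0" if "s \<in> U k" "e \<in> edges V" "k \<notin> e" for s e k
    proof -
      have "s \<in> I" using that by (simp add: U_def)
      then show ?thesis
        using covers_imp_positive_on[of s e "Inr k"] in_edges_UNIV[OF that(2)] that lU[OF that(1)] h_nonneg[of s e]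
        by (auto simp: covers_def order_less_le)
    qed
    show ?thesis
    proof (cases "\<exists>k\<in>V. 2 \<le> card (U k)")
      case True
      then obtain k where k: "k \<in> V" "2 \<le> card (U k)" by auto
      have "s \<notin> alive (V - {k})" if "s \<in> U k" for s
      proof
        assume "s \<in> alive (V - {k})"
        then obtain e where "e \<in> edges (V - {k})" "0 < h s e" by (auto simp: alive_def covers_def)
        moreover from this have "e \<in> edges V" "k \<notin> e" by (auto simp: edges_def)
        ultimately show False using U_h[OF that] by auto
      qed
      then have "U k \<inter> alive (V - {k}) = {}" by auto
      then have "card (U k) + card (alive (V - {k})) = card (U k \<union> alive (V - {k}))"
        by (simp add: card_Un_disjoint finite_alive U_fin)
      also have "\<dots> \<le> card (alive V)"
        using U_alive[OF k(1)] alive_mono[of "V - {k}" V] by (intro card_mono finite_alive) auto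
      finally have "card (U k) + card (alive (V - {k})) \<le> card (alive V)" .
      moreover have "2 * card (V - {k}) \<le> card (alive (V - {k}))"
        using k V6 by (intro less.hyps) auto
      ultimately show ?thesis using k V6 by simp
    next
      case False
      have other: "\<exists>j\<in>V. j \<noteq> k \<and> j \<noteq> i" for k i
      proof (rule ccontr)
        assume "\<not> ?thesis"
        then have "V \<subseteq> {k, i}" by auto
        then have "card V \<le> card {k, i}" by (intro card_mono) auto
        also have "\<dots> \<le> 2" by (simp add: card_insert_if)
        finally show False using V6 by simp
      qed
      have cov_U: "coverers (Inr k) e \<subseteq> U k" if "e \<in> edges V" for k e
        using that by (auto simp: coverers_def U_def)
      have cov_ne: "coverers (Inr k) e \<noteq> {}" if "e \<in> edges V" "k \<in> e" for k e
        using coverers_nonempty_iff[OF in_edges_UNIV, of e V "Inr k"] that by auto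
      have "\<exists>s. U k = {s}" if "k \<in> V" for k
      proof -
        obtain j where "j \<in> V" "j \<noteq> k" using other by blast
        then have "U k \<noteq> {}" using cov_U[of "{k, j}" k] cov_ne[of "{k, j}" k] that
          by (auto simp: doubleton_edge)
        then have "card (U k) = 1" using False that U_fin[of k]
          by (metis One_nat_def Suc_leI card_gt_0_iff le_antisym not_less_eq_eq numeral_2_eq_2)
        then show ?thesis by (simp add: card_1_singleton_iff)
      qed
      then obtain p where p: "\<And>k. k \<in> V \<Longrightarrow> U k = {p k}" by metis
      have p_h: "0 < h (p k) e" if "k \<in> V" "e \<in> edges V" "k \<in> e" for k e
        using cov_U[OF that(2), of k] cov_ne[OF that(2,3)] p[OF that(1)]
        by (auto simp: coverers_def covers_def)
      have p_I: "p k \<in> I" if "k \<in> V" for k using p[OF that] by (auto simp: U_def)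
      \<comment> \<open>Some edge contains both \<open>k\<close> and \<open>j\<close> (any edge at
        \<open>k\<close> if \<open>j = k\<close>). The column factor of \<open>p k\<close> is
        positive on this edge, where row \<open>Inl j\<close> vanishes.\<close>
      have p_l: "l (Inl j) (p k) = 0" if "k \<in> V" "j \<in> V" for k j
      proof -
        have "\<exists>e. e \<in> edges V \<and> k \<in> e \<and> j \<in> e"
        proof (cases "j = k")
          case True
          obtain m where "m \<in> V" "m \<noteq> k" using other by blast
          then show ?thesis using that True by (intro exI[of _ "{k, m}"]) (auto simp: doubleton_edge)
        next
          case False
          then show ?thesis using that by (intro exI[of _ "{k, j}"]) (auto simp: doubleton_edge)
        qed
        then obtain e where e: "e \<in> edges V" "k \<in> e" "j \<in> e" by blast
        then show ?thesis
          using covers_imp_positive_on[of "p k" e "Inl j"] p_h[of k e] p_I[of k] that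
            in_edges_UNIV[of e V] l_nonneg[of "p k" "Inl j"]
          by (auto simp: covers_def order_less_le)
      qed
      have inj: "inj_on p V"
      proof (rule inj_onI, rule ccontr)
        fix j k assume jk: "j \<in> V" "k \<in> V" "p j = p k" "j \<noteq> k"
        obtain m where "m \<in> V" "m \<noteq> j" "m \<noteq> k" using other by blast
        then have "0 < h (p j) {j, m}" "h (p k) {j, m} = 0"
          using jk p_h[of j "{j, m}"] U_h[of "p k" k "{j, m}"] p[of k] by (auto simp: doubleton_edge)
        with jk show False by simp
      qed
      have "p ` V \<subseteq> alive V" using U_alive p by blast
      \<comment> \<open>Otherwise some nonzero \<open>c\<close> is orthogonal to the
        \<open>Inl\<close> factors of all remaining terms. As the terms \<open>p k\<close> have zero
        \<open>Inl\<close> factors on \<open>V\<close>, \<open>c\<close> is a linear dependence of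
        the \<open>Inl\<close> rows on the edges of \<open>V\<close>.\<close>
      have "card V \<le> card (alive V - p ` V)"
      proof (rule ccontr)
        assume "\<not> ?thesis"
        then have "card (alive V - p ` V) < card V" by simp
        from homogeneous_system_nontrivial_solution[OF _ fV this, of "\<lambda>k. l (Inl k)"] finite_alive
        obtain c where c: "\<exists>k\<in>V. c k \<noteq> 0"
          "\<And>s. s \<in> alive V - p ` V \<Longrightarrow> (\<Sum>k\<in>V. c k * l (Inl k) s) = 0" by auto
        have "(\<Sum>k\<in>V. c k * S (Inl k) e) = 0" if e: "e \<in> edges V" for e
        proof -
          have "(\<Sum>k\<in>V. c k * S (Inl k) e) = (\<Sum>k\<in>V. \<Sum>s\<in>I. c k * l (Inl k) s * h s e)"
            using factorization[OF in_edges_UNIV[OF e]] by (simp add: sum_distrib_left mult.assoc)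
          also have "\<dots> = (\<Sum>s\<in>I. (\<Sum>k\<in>V. c k * l (Inl k) s) * h s e)"
            by (subst sum.swap) (simp add: sum_distrib_right)
          also have "\<dots> = 0"
          proof (intro sum.neutral ballI)
            fix s assume s: "s \<in> I"
            consider "s \<in> p ` V" | "s \<in> alive V - p ` V" | "s \<notin> alive V" by blast
            then show "(\<Sum>k\<in>V. c k * l (Inl k) s) * h s e = 0"
            proof cases
              case 3
              then have "l (Inl k) s * h s e = 0" if "k \<in> V" for k
                using s e that term_eq_0_iff[OF s in_edges_UNIV[OF e], of "Inl k"]
                by (auto simp: alive_def Plus_def simp del: mult_eq_0_iff)
              then show ?thesis by (auto simp: sum_distrib_right mult.assoc intro!: sum.neutral)
            qed (use c(2) p_l in auto)
          qed
          finally show ?thesis .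
        qed
        with rank[OF V6] c(1) show False by blast
      qed
      moreover have "card (alive V - p ` V) = card (alive V) - card V"
        using \<open>p ` V \<subseteq> alive V\<close> inj by (simp add: card_Diff_subset card_image)
      ultimately show ?thesis using V6 by simp
    qed
  qed
qed

theorem card_ge:
  assumes "5 \<le> CARD('n)"
  shows "2 * CARD('n) \<le> card I"
proof -
  have "card (alive UNIV) \<le> card I" by (intro card_mono finite_I) (auto simp: alive_def)
  with card_alive_ge[of UNIV] assms show ?thesis by simp
qed

end

section \<open>Facet functionals of polytopes in real vector spaces\<close>

definition affine_functional :: "('a::real_vector \<Rightarrow> real) \<Rightarrow> bool" where
  "affine_functional u \<longleftrightarrow> (\<exists>f c. linear f \<and> u = (\<lambda>x. f x + c))"

lemma affine_functional_diff_scaled: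
  assumes "affine_functional u" "affine_functional v"
  shows "affine_functional (\<lambda>x. u x - t * v x)"
proof -
  obtain f c g d where "linear f" "linear g" "u = (\<lambda>x. f x + c)" "v = (\<lambda>x. g x + d)"
    using assms by (auto simp: affine_functional_def)
  then show ?thesis
    unfolding affine_functional_def
    by (intro exI[of _ "\<lambda>x. f x - t * g x"] exI[of _ "c - t * d"])
      (auto simp: algebra_simps intro!: linear_compose_sub linear_compose_scale_right[of g t, unfolded real_scaleR_def])
qed

lemma affine_functional_zero: "affine_functional (\<lambda>_. 0)"
  by (auto simp: affine_functional_def intro!: exI[of _ "\<lambda>_. 0"] linear_zero)

lemma affine_functional_sum_scaled:
  assumes "finite A" "\<And>i. i \<in> A \<Longrightarrow> affine_functional (v i)"
  shows "affine_functional (\<lambda>x. \<Sum>i\<in>A. c i * v i x)"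
  using assms
proof (induction A rule: finite_induct)
  case empty
  then show ?case by (simp add: affine_functional_zero)
next
  case (insert i A)
  have "affine_functional (\<lambda>x. (\<Sum>i\<in>A. c i * v i x) - (- c i) * v i x)"
    by (intro affine_functional_diff_scaled insert) auto
  then show ?case using insert.hyps by (simp add: add.commute)
qed

lemma affine_functional_sum:
  assumes "affine_functional u" "finite X" "sum c X = 1"
  shows "u (\<Sum>x\<in>X. c x *\<^sub>R x) = (\<Sum>x\<in>X. c x * u x)"
proof -
  obtain f d where f: "linear f" "u = (\<lambda>x. f x + d)"
    using assms by (auto simp: affine_functional_def)
  have "(\<Sum>x\<in>X. c x * u x) = (\<Sum>x\<in>X. c x * f x) + sum c X * d"
    by (simp add: f(2) distrib_left sum.distrib sum_distrib_right)
  then show ?thesis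
    using f assms(3) by (simp add: linear_sum linear_scale)
qed

lemma affine_functional_segment:
  assumes "affine_functional u"
  shows "u ((1 - t) *\<^sub>R a + t *\<^sub>R b) = (1 - t) * u a + t * u b"
proof -
  obtain f d where "linear f" "u = (\<lambda>x. f x + d)"
    using assms by (auto simp: affine_functional_def)
  then show ?thesis by (simp add: linear_add linear_diff linear_scale algebra_simps)
qed

lemma affine_functional_eq_on_affine_hull:
  assumes "affine_functional u" "affine_functional v" "\<And>x. x \<in> X \<Longrightarrow> u x = v x" "q \<in> affine hull X"
  shows "u q = v q"
proof -
  have "affine {x. u x = v x}"
    unfolding affine_alt
    by (simp add: affine_functional_segment[OF assms(1)] affine_functional_segment[OF assms(2)])
  then have "affine hull X \<subseteq> {x. u x = v x}"
    using assms(3) by (intro hull_minimal) auto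
  with assms(4) show ?thesis by auto
qed

lemma affine_functional_eq_on_convex_hull:
  assumes "affine_functional u" "affine_functional v" "\<And>x. x \<in> X \<Longrightarrow> u x = v x" "q \<in> convex hull X"
  shows "u q = v q"
  using affine_functional_eq_on_affine_hull[OF assms(1-3)] assms(4) convex_hull_subset_affine_hull by blast

lemma affine_functional_nonneg_on_convex_hull:
  assumes "affine_functional u" "finite X" "\<And>x. x \<in> X \<Longrightarrow> 0 \<le> u x" "q \<in> convex hull X"
  shows "0 \<le> u q"
proof -
  obtain c where "\<forall>x\<in>X. 0 \<le> c x" "sum c X = 1" "q = (\<Sum>x\<in>X. c x *\<^sub>R x)"
    using assms(2,4) by (auto simp: convex_hull_finite)
  then show ?thesis
    using assms by (auto simp: affine_functional_sum intro!: sum_nonneg)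
qed

lemma zero_set_of_nonneg_affine_functional:
  assumes u: "affine_functional u" and X: "finite X" and nn: "\<And>x. x \<in> X \<Longrightarrow> 0 \<le> u x"
  shows "{q \<in> convex hull X. u q = 0} = convex hull {x \<in> X. u x = 0}" (is "?H = ?K")
    and "{q \<in> convex hull X. u q = 0} face_of convex hull X"
proof -
  show eq: "?H = ?K"
  proof
    show "?H \<subseteq> ?K"
    proof
      fix q assume q: "q \<in> ?H"
      then obtain c where c: "\<forall>x\<in>X. 0 \<le> c x" "sum c X = 1" "q = (\<Sum>x\<in>X. c x *\<^sub>R x)"
        using X by (auto simp: convex_hull_finite)
      have "(\<Sum>x\<in>X. c x * u x) = 0"
        using q c affine_functional_sum[OF u X c(2)] by auto
      then have 0: "c x = 0" if "x \<in> X" "u x \<noteq> 0" for x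
        using that c nn X by (subst (asm) sum_nonneg_eq_0_iff) auto
      have nz: "u x = 0" if "x \<in> X" "c x \<noteq> 0" for x using 0 that by blast
      let ?Z = "{x \<in> X. u x = 0}"
      have "sum c ?Z = sum c X" "(\<Sum>x\<in>?Z. c x *\<^sub>R x) = (\<Sum>x\<in>X. c x *\<^sub>R x)"
        using X nz by (auto intro!: sum.mono_neutral_left)
      with c have "sum c ?Z = 1" "q = (\<Sum>x\<in>?Z. c x *\<^sub>R x)" by auto
      then show "q \<in> ?K" using X c(1) by (auto simp: convex_hull_finite)
    qed
    show "?K \<subseteq> ?H"
    proof
      fix q assume q: "q \<in> ?K"
      have "u q = (\<lambda>_. 0) q"
        by (rule affine_functional_eq_on_convex_hull[OF u _ _ q])
          (auto simp: affine_functional_def intro!: exI[of _ "\<lambda>_. 0"] linear_zero)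
      moreover have "q \<in> convex hull X" using q hull_mono[of "{x \<in> X. u x = 0}" X] by blast
      ultimately show "q \<in> ?H" by simp
    qed
  qed
  show "?H face_of convex hull X"
    unfolding face_of_def
  proof (intro conjI ballI impI)
    show "convex ?H" by (simp add: eq)
    fix a b x assume ab: "a \<in> convex hull X" "b \<in> convex hull X" "x \<in> ?H" "x \<in> open_segment a b"
    then obtain t where t: "0 < t" "t < 1" "x = (1 - t) *\<^sub>R a + t *\<^sub>R b" by (auto simp: in_segment)
    have "(1 - t) * u a + t * u b = 0" using ab(3) t affine_functional_segment[OF u] by auto
    moreover have "0 \<le> u a" "0 \<le> u b"
      using affine_functional_nonneg_on_convex_hull[OF u X nn] ab by auto
    ultimately have "u a = 0" "u b = 0"
      using t by (auto simp: add_nonneg_eq_0_iff)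
    then show "a \<in> ?H" "b \<in> ?H" using ab by auto
  qed auto
qed

text \<open>Separation is algebraic here: after translating \<open>b\<close> to the origin,
  \<open>y - b\<close> lies outside the span of the translated set, so it extends a basis of that
  span, and a linear functional can be prescribed on the enlarged basis.\<close>

lemma affine_functional_separation:
  assumes "y \<notin> affine hull B" "b \<in> B"
  shows "\<exists>w. affine_functional w \<and> (\<forall>x\<in>B. w x = 0) \<and> w y = 1"
proof -
  let ?U = "(\<lambda>x. - b + x) ` B"
  have y: "- b + y \<notin> span ?U"
  proof
    assume "- b + y \<in> span ?U"
    then have "b + (- b + y) \<in> affine hull (insert b B)"
      unfolding affine_hull_insert_span_gen by (rule imageI)
    with assms show False by (simp add: insert_absorb)
  qed
  obtain D where D: "D \<subseteq> ?U" "independent D" "?U \<subseteq> span D"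
    using maximal_independent_subset by blast
  have yD: "- b + y \<notin> span D" using y D(1) span_mono by blast
  then have ind: "independent (insert (- b + y) D)" using D(2) by (simp add: independent_insert)
  obtain g where "linear g" "\<forall>x\<in>insert (- b + y) D. g x = (if x = - b + y then 1 else 0 :: real)"
    using linear_independent_extend[OF ind, of "\<lambda>x. if x = - b + y then 1 else 0"] by (elim exE conjE)
  then have g: "linear g" "\<And>x. x \<in> insert (- b + y) D \<Longrightarrow> g x = (if x = - b + y then 1 else 0 :: real)"
    by auto
  have "g x = 0" if "x \<in> span D" for x
    using that yD g span_base by (intro linear_eq_0_on_span[OF g(1) _ that]) auto
  then have "g (- b + x) = 0" if "x \<in> B" for x using D(3) that by blast
  moreover have "affine_functional (\<lambda>x. g (- b + x))"
    unfolding affine_functional_def using g(1)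
    by (intro exI[of _ g] exI[of _ "g (- b)"]) (auto simp: linear_add linear_diff linear_neg)
  ultimately show ?thesis using g(2) by (intro exI[of _ "\<lambda>x. g (- b + x)"]) auto
qed

section \<open>Affine bases and dimension in real vector spaces\<close>

lemma not_affine_dependent_insert:
  fixes y :: "'a::real_vector"
  assumes "\<not> affine_dependent B" "y \<notin> affine hull B"
  shows "\<not> affine_dependent (insert y B)"
proof (cases "B = {}")
  case True
  then show ?thesis by simp
next
  case False
  then obtain b where b: "b \<in> B" by auto
  have "y \<noteq> b" using assms(2) hull_inc[OF b, of affine] by auto
  then have img: "(\<lambda>x. - b + x) ` (insert y B - {b}) = insert (- b + y) ((\<lambda>x. - b + x) ` (B - {b}))" by auto
  have "- b + y \<notin> span ((\<lambda>x. - b + x) ` (B - {b}))"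
  proof
    assume "- b + y \<in> span ((\<lambda>x. - b + x) ` (B - {b}))"
    then have "b + (- b + y) \<in> affine hull B" unfolding affine_hull_span2[OF b] by (rule imageI)
    with assms(2) show False by simp
  qed
  moreover have "independent ((\<lambda>x. - b + x) ` (B - {b}))"
    using assms(1) affine_dependent_iff_dependent2[OF b] by simp
  ultimately have "independent ((\<lambda>x. - b + x) ` (insert y B - {b}))"
    unfolding img by (simp add: independent_insert)
  then show ?thesis using affine_dependent_iff_dependent2[of b "insert y B"] b by simp
qed

text \<open>Translated to the origin, both sets become bases of the same space of directions. The
  value of \<open>affine_dim\<close> is selected by \<open>SOME\<close>, so this invariance is what
  lets it be computed from any one basis.\<close>

lemma card_affine_basis_unique:
  fixes B C :: "'a::real_vector set"
  assumes "affine hull B = affine hull C" "\<not> affine_dependent B" "\<not> affine_dependent C"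
  shows "card B = card C"
proof (cases "B = {}")
  case True
  then show ?thesis using assms by (metis affine_hull_eq_empty)
next
  case False
  then have "C \<noteq> {}" using assms(1) by (metis affine_hull_eq_empty)
  then obtain a c where ac: "a \<in> B" "c \<in> C" using False by auto
  define D where "D a B = (\<lambda>x. - a + x) ` (B - {a})" for a :: 'a and B
  have hull: "affine hull B = (+) a ` span (D a B)" "affine hull B = (+) c ` span (D c C)"
    using affine_hull_span2[OF ac(1)] affine_hull_span2[OF ac(2)] assms(1) by (auto simp: D_def)
  have "x \<in> span (D a B) \<longleftrightarrow> a + x \<in> affine hull B" "x \<in> span (D c C) \<longleftrightarrow> c + x \<in> affine hull B" for x
    by (subst hull; auto)+
  note mem = this
  have "a \<in> affine hull B" "c \<in> affine hull B" using ac assms(1) hull_inc by fastforce+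
  then have diff: "a - c \<in> span (D c C)" "c - a \<in> span (D a B)" by (simp_all add: mem)
  have "span (D a B) = span (D c C)"
  proof (intro equalityI subsetI)
    fix x assume "x \<in> span (D a B)"
    then have "(a - c) + x \<in> span (D c C)" by (simp add: mem)
    from span_diff[OF this diff(1)] show "x \<in> span (D c C)" by simp
  next
    fix x assume "x \<in> span (D c C)"
    then have "(c - a) + x \<in> span (D a B)" by (simp add: mem)
    from span_diff[OF this diff(2)] show "x \<in> span (D a B)" by simp
  qed
  moreover have "independent (D a B)" "independent (D c C)"
    using assms ac affine_dependent_iff_dependent2 by (auto simp: D_def)
  ultimately obtain f where f: "bij_betw f (D a B) (D c C)"
    using bij_if_span_eq_span_bases by blast
  have inj: "inj_on (\<lambda>x. - a + x) (B - {a})" "inj_on (\<lambda>x. - c + x) (C - {c})" by (auto simp: inj_on_def)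
  \<comment> \<open>Finiteness is transferred along with the cardinality, since an infinite basis
    has \<open>card\<close> 0 before and after the removal of a point.\<close>
  have "card (B - {a}) = card (C - {c})" "finite (B - {a}) \<longleftrightarrow> finite (C - {c})"
    using bij_betw_same_card[OF f] bij_betw_finite[OF f] inj
    by (auto simp: D_def card_image finite_image_iff)
  then show ?thesis
    using card.remove[OF _ ac(1)] card.remove[OF _ ac(2)] by (cases "finite B") auto
qed

lemma affine_dim_eq_card_basis:
  fixes V :: "'a::real_vector set"
  assumes "affine hull B = affine hull V" "\<not> affine_dependent B"
  shows "affine_dim V = int (card B) - 1"
  unfolding affine_dim_def
proof (rule some_equality)
  show "\<exists>C. affine hull C = affine hull V \<and> \<not> affine_dependent C \<and> int (card C) = int (card B) - 1 + 1"
    using assms by auto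
next
  fix d :: int
  assume "\<exists>C. affine hull C = affine hull V \<and> \<not> affine_dependent C \<and> int (card C) = d + 1"
  then show "d = int (card B) - 1"
    using assms card_affine_basis_unique[of B] by (metis add_diff_cancel_right')
qed

section \<open>Faces of polytopes and functionals of minimal support\<close>

text \<open>If a generator \<open>x\<close> occurs in a representation of \<open>q\<close>, then
  \<open>q\<close> lies on the open segment between \<open>x\<close> and the normalized rest of the
  combination, or equals \<open>x\<close>. The face condition puts \<open>x\<close> into
  \<open>F\<close>.\<close>

lemma finite_face_support:
  assumes X: "finite X" and F: "F face_of convex hull X"
  shows "F = convex hull (X \<inter> F)"
proof
  show "convex hull (X \<inter> F) \<subseteq> F"
    using F by (intro hull_minimal) (auto simp: face_of_imp_convex)
  show "F \<subseteq> convex hull (X \<inter> F)"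
  proof
    fix q assume q: "q \<in> F"
    then have "q \<in> convex hull X" using F face_of_imp_subset by blast
    then obtain c where c: "\<forall>x\<in>X. 0 \<le> c x" "sum c X = 1" "q = (\<Sum>x\<in>X. c x *\<^sub>R x)"
      using X by (auto simp: convex_hull_finite)
    have mem: "x \<in> F" if x: "x \<in> X" "c x \<noteq> 0" for x
    proof (cases "c x = 1")
      case True
      then have "sum c (X - {x}) = 0" using c(2) X x by (simp add: sum_diff1)
      then have "\<forall>y\<in>X - {x}. c y = 0" using c(1) X by (subst (asm) sum_nonneg_eq_0_iff) auto
      then have "q = x" using c(3) X x True by (simp add: sum.remove[of X x])
      with q show ?thesis by simp
    next
      case False
      have cx: "0 < c x" "c x < 1" "sum c (X - {x}) = 1 - c x"
      proof -
        show "0 < c x" using c(1) x by (simp add: order_less_le)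
        show "sum c (X - {x}) = 1 - c x" using c(2) X x by (simp add: sum_diff1)
        moreover have "0 \<le> sum c (X - {x})" using c(1) by (auto intro: sum_nonneg)
        ultimately show "c x < 1" using False by simp
      qed
      define p where "p = (\<Sum>y\<in>X - {x}. (c y / (1 - c x)) *\<^sub>R y)"
      have "(\<Sum>y\<in>X - {x}. c y / (1 - c x)) = 1"
        using cx by (simp add: sum_divide_distrib[symmetric])
      then have "p \<in> convex hull (X - {x})"
        unfolding p_def using X c(1) cx by (auto simp: convex_hull_finite intro!: exI[of _ "\<lambda>y. c y / (1 - c x)"])
      then have p: "p \<in> convex hull X" using hull_mono[of "X - {x}" X] by blast
      have "(1 - c x) *\<^sub>R p = (\<Sum>y\<in>X - {x}. c y *\<^sub>R y)"
        using cx by (simp add: p_def scaleR_right.sum)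
      then have qp: "q = (1 - c x) *\<^sub>R p + c x *\<^sub>R x"
        using c(3) X x by (simp add: sum.remove[of X x])
      show ?thesis
      proof (cases "p = x")
        case True
        then show ?thesis using qp q by (simp add: scaleR_left_distrib[symmetric])
      next
        case False
        then have "q \<in> open_segment p x" using qp cx by (auto simp: in_segment)
        then show ?thesis using face_ofD[OF F] q p x hull_inc[of x X] by blast
      qed
    qed
    have "sum c (X \<inter> F) = sum c X" "(\<Sum>x\<in>X \<inter> F. c x *\<^sub>R x) = (\<Sum>x\<in>X. c x *\<^sub>R x)"
      using X mem by (auto intro!: sum.mono_neutral_left)
    with c have "sum c (X \<inter> F) = 1" "q = (\<Sum>x\<in>X \<inter> F. c x *\<^sub>R x)" by auto
    then show "q \<in> convex hull (X \<inter> F)" using X c(1) by (auto simp: convex_hull_finite)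
  qed
qed

lemma finite_facets:
  assumes "finite X"
  shows "finite (facets (convex hull X))"
proof (rule finite_subset)
  show "facets (convex hull X) \<subseteq> (\<lambda>Y. convex hull Y) ` Pow X"
  proof
    fix F assume "F \<in> facets (convex hull X)"
    then have "F = convex hull (X \<inter> F)"
      using finite_face_support[OF assms] by (simp add: facets_def)
    then show "F \<in> (\<lambda>Y. convex hull Y) ` Pow X" by blast
  qed
qed (use assms in auto)

text \<open>Functionals spanning the extreme rays of the cone of affine functionals that are nonnegative on
  \<^term>\<open>X\<close>.\<close>

definition min_support_functional :: "'a::real_vector set \<Rightarrow> ('a \<Rightarrow> real) \<Rightarrow> bool" where
  "min_support_functional X u \<longleftrightarrow> affine_functional u \<and> (\<forall>x\<in>X. 0 \<le> u x) \<and> (\<exists>x\<in>X. u x \<noteq> 0) \<and>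
     (\<forall>v. affine_functional v \<longrightarrow> (\<forall>x\<in>X. 0 \<le> v x) \<longrightarrow> (\<exists>x\<in>X. v x \<noteq> 0) \<longrightarrow>
        (\<forall>x\<in>X. u x = 0 \<longrightarrow> v x = 0) \<longrightarrow> (\<forall>x\<in>X. v x = 0 \<longrightarrow> u x = 0))"

text \<open>This is the ratio test of linear programming: \<open>t\<close> is the least quotient
  \<open>u x / w x\<close> over the points with \<open>w x > 0\<close>. The difference loses a point
  of the support of \<open>u\<close>, which makes the later decompositions terminate.\<close>

lemma exhaust_nonneg_functional:
  assumes X: "finite X" and u: "\<And>x. x \<in> X \<Longrightarrow> 0 \<le> u x" and w: "\<exists>x\<in>X. 0 < w x"
    and supp: "\<And>x. x \<in> X \<Longrightarrow> u x = 0 \<Longrightarrow> w x = (0::real)"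
  obtains t where "0 < t" "\<And>x. x \<in> X \<Longrightarrow> 0 \<le> u x - t * w x"
    "\<exists>x\<in>X. u x \<noteq> 0 \<and> u x - t * w x = 0"
proof -
  let ?P = "{x \<in> X. 0 < w x}"
  define t where "t = Min ((\<lambda>x. u x / w x) ` ?P)"
  have P: "finite ?P" "?P \<noteq> {}" using X w by auto
  then have "t \<in> (\<lambda>x. u x / w x) ` ?P" unfolding t_def by (intro Min_in) auto
  then obtain p where p: "p \<in> X" "0 < w p" "t = u p / w p" by auto
  have up: "u p \<noteq> 0" using supp p by fastforce
  have t: "0 < t" using p up u[OF p(1)] by simp
  moreover have "0 \<le> u x - t * w x" if x: "x \<in> X" for x
  proof (cases "0 < w x")
    case True
    then have "t \<le> u x / w x" unfolding t_def using P x by (intro Min_le) auto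
    with True show ?thesis by (simp add: field_simps)
  next
    case False
    then have "t * w x \<le> 0" using t by (simp add: mult_nonneg_nonpos)
    with u[OF x] show ?thesis by simp
  qed
  moreover have "u p - t * w p = 0" using p by simp
  ultimately show ?thesis using that p up by blast
qed

text \<open>Subtracting the critical multiple of \<open>w\<close> from \<open>u\<close> leaves a
  nonnegative functional with strictly smaller support, which is zero on \<open>X\<close> by
  minimality. A change of sign covers a \<open>w\<close> without positive values.\<close>

lemma min_support_functional_unique:
  assumes X: "finite X" and u: "min_support_functional X u" and w: "affine_functional w"
    and supp: "\<And>x. x \<in> X \<Longrightarrow> u x = 0 \<Longrightarrow> w x = 0"
  shows "\<exists>t. \<forall>x\<in>X. w x = t * u x"
proof -
  have main: "\<exists>t. \<forall>x\<in>X. v x = t * u x"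
    if v: "affine_functional v" "\<exists>x\<in>X. 0 < v x" "\<And>x. x \<in> X \<Longrightarrow> u x = 0 \<Longrightarrow> v x = 0" for v
  proof -
    have uX: "0 \<le> u x" if "x \<in> X" for x using u that by (auto simp: min_support_functional_def)
    obtain t where t: "0 < t" "\<And>x. x \<in> X \<Longrightarrow> 0 \<le> u x - t * v x" "\<exists>x\<in>X. u x \<noteq> 0 \<and> u x - t * v x = 0"
      using exhaust_nonneg_functional[OF X, of u v] uX v(2,3) by blast
    define g where "g = (\<lambda>x. u x - t * v x)"
    have g: "affine_functional g" "\<forall>x\<in>X. 0 \<le> g x" "\<forall>x\<in>X. u x = 0 \<longrightarrow> g x = 0"
      using u v(1,3) t(2) by (auto simp: g_def min_support_functional_def intro: affine_functional_diff_scaled)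
    have "\<forall>x\<in>X. g x = 0"
    proof (rule ccontr)
      assume "\<not> ?thesis"
      then have "\<exists>x\<in>X. g x \<noteq> 0" by blast
      with u g have "\<forall>x\<in>X. g x = 0 \<longrightarrow> u x = 0"
        unfolding min_support_functional_def by blast
      with t(3) show False by (auto simp: g_def)
    qed
    then have "\<forall>x\<in>X. u x - t * v x = 0" by (simp add: g_def)
    then have "\<forall>x\<in>X. v x = (1 / t) * u x" using t(1) by (simp add: field_simps)
    then show ?thesis by blast
  qed
  consider "\<exists>x\<in>X. 0 < w x" | "\<exists>x\<in>X. w x < 0" | "\<forall>x\<in>X. w x = 0" by fastforce
  then show ?thesis
  proof cases
    case 1
    with main w supp show ?thesis by blast
  next
    case 2
    have "affine_functional (\<lambda>x. 0 - 1 * w x)"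
      by (rule affine_functional_diff_scaled[OF affine_functional_zero w])
    then obtain t where "\<forall>x\<in>X. - w x = t * u x" using main[of "\<lambda>x. - w x"] 2 supp by auto
    then have "\<forall>x\<in>X. w x = (- t) * u x" by (metis add.inverse_inverse mult_minus_left)
    then show ?thesis by blast
  next
    case 3
    then show ?thesis by (intro exI[of _ 0]) auto
  qed
qed

text \<open>The zero set spans a hyperplane in the affine hull of \<open>X\<close>: if together with
  \<open>x0\<close> it did not span this hull, some functional would vanish on both but not on
  \<open>X\<close>. It would be a multiple of \<open>u\<close>, and its value 0 at \<open>x0\<close>
  would make it zero on \<open>X\<close>.\<close>

lemma min_support_functional_facet:
  assumes X: "finite X" and u: "min_support_functional X u" and z: "\<exists>x\<in>X. u x = 0"
  shows "{q \<in> convex hull X. u q = 0} \<in> facets (convex hull X)" (is "?H \<in> _")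
proof -
  have au: "affine_functional u" and nn: "\<And>x. x \<in> X \<Longrightarrow> 0 \<le> u x"
    using u by (auto simp: min_support_functional_def)
  obtain x0 where x0: "x0 \<in> X" "u x0 \<noteq> 0" using u by (auto simp: min_support_functional_def)
  let ?Z = "{x \<in> X. u x = 0}"
  note H = zero_set_of_nonneg_affine_functional[OF au X nn]
  obtain B where B: "B \<subseteq> ?Z" "\<not> affine_dependent B" "affine hull ?Z = affine hull B"
    using affine_basis_exists by blast
  note zero = affine_functional_zero
  have "u q = 0" if "q \<in> affine hull B" for q
    using affine_functional_eq_on_affine_hull[OF au zero _ that] B by auto
  then have x0B: "x0 \<notin> affine hull B" using x0 by auto
  then have ind: "\<not> affine_dependent (insert x0 B)"
    using B(2) not_affine_dependent_insert by blast
  have "y \<in> affine hull (insert x0 B)" if y: "y \<in> X" for y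
  proof (rule ccontr)
    assume "\<not> ?thesis"
    then obtain w where w: "affine_functional w" "\<forall>x\<in>insert x0 B. w x = 0" "w y = 1"
      using affine_functional_separation[of y "insert x0 B" x0] by auto
    have "w x = 0" if "x \<in> X" "u x = 0" for x
    proof (rule affine_functional_eq_on_affine_hull[OF w(1) zero])
      show "x \<in> affine hull B" using that B(3) by (metis (mono_tags, lifting) hull_inc mem_Collect_eq)
    qed (use w in auto)
    then obtain t where "\<forall>x\<in>X. w x = t * u x"
      using min_support_functional_unique[OF X u w(1)] by blast
    with x0 y w show False by (metis insertI1 mult_eq_0_iff zero_neq_one)
  qed
  then have "affine hull (insert x0 B) = affine hull X"
    using B(1) x0 by (intro equalityI hull_mono hull_minimal) auto
  then have "affine_dim (convex hull X) = int (card (insert x0 B)) - 1"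
    using ind by (intro affine_dim_eq_card_basis) auto
  moreover have "affine_dim ?H = int (card B) - 1"
    using B by (intro affine_dim_eq_card_basis) (auto simp: H(1))
  moreover have "finite B" using B(1) X finite_subset by fastforce
  moreover have "x0 \<notin> B" using x0B hull_inc by fastforce
  moreover have "?H \<noteq> {}" using z hull_inc[of _ X] by fastforce
  ultimately show ?thesis using H(2) by (auto simp: facets_def)
qed

text \<open>The induction subtracts from \<open>u\<close> the critical multiple of a functional
  whose support is minimal within that of \<open>u\<close>. The zero of \<open>u\<close> is shared
  by this functional, whose zero face is therefore nonempty and a facet; the difference again has a
  zero.\<close>

theorem facet_functionals:
  fixes X :: "'a::real_vector set"
  assumes X: "finite X"
  obtains h where
    "\<And>H q. q \<in> convex hull X \<Longrightarrow> 0 \<le> h H q"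
    "\<And>u. affine_functional u \<Longrightarrow> (\<And>q. q \<in> convex hull X \<Longrightarrow> 0 \<le> u q) \<Longrightarrow>
       \<exists>q\<in>convex hull X. u q = 0 \<Longrightarrow>
       \<exists>c. (\<forall>H. 0 \<le> c H) \<and> (\<forall>q\<in>convex hull X. u q = (\<Sum>H\<in>facets (convex hull X). c H * h H q))"
proof -
  let ?Q = "convex hull X"
  define P where "P H u \<longleftrightarrow> min_support_functional X u \<and> H = {q \<in> ?Q. u q = 0}" for H and u :: "'a \<Rightarrow> real"
  define h where "h H = (if \<exists>u. P H u then SOME u. P H u else (\<lambda>_. 0))" for H
  have h: "P H (h H) \<or> h H = (\<lambda>_. 0)" for H
    by (simp add: h_def some_eq_ex[of "P H"])
  have h_aff: "affine_functional (h H)" and h_nn: "\<And>x. x \<in> X \<Longrightarrow> 0 \<le> h H x" for H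
    using h[of H] affine_functional_zero by (auto simp: P_def min_support_functional_def)
  have dec: "\<exists>c. (\<forall>H. 0 \<le> c H) \<and> (\<forall>x\<in>X. u x = (\<Sum>H\<in>facets ?Q. c H * h H x))"
    if "affine_functional u" "\<forall>x\<in>X. 0 \<le> u x" "\<exists>x\<in>X. u x = 0" for u
    using that
  proof (induction "card {x \<in> X. u x \<noteq> 0}" arbitrary: u rule: less_induct)
    case less
    show ?case
    proof (cases "\<exists>x\<in>X. u x \<noteq> 0")
      case False
      then show ?thesis by (intro exI[of _ "\<lambda>_. 0"]) auto
    next
      case True
      define A where "A v \<longleftrightarrow> affine_functional v \<and> (\<forall>x\<in>X. 0 \<le> v x) \<and> (\<exists>x\<in>X. v x \<noteq> 0) \<and>
        (\<forall>x\<in>X. u x = 0 \<longrightarrow> v x = 0)" for v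
      have "A u" using less.prems True by (simp add: A_def)
      then obtain v where v: "A v" and vmin: "\<And>w. A w \<Longrightarrow> card {x\<in>X. v x \<noteq> 0} \<le> card {x\<in>X. w x \<noteq> 0}"
        using ex_has_least_nat[of A u "\<lambda>w. card {x\<in>X. w x \<noteq> 0}"] by blast
      have ms: "min_support_functional X v"
        unfolding min_support_functional_def
      proof (intro conjI allI impI)
        fix w assume w: "affine_functional w" "\<forall>x\<in>X. 0 \<le> w x" "\<exists>x\<in>X. w x \<noteq> 0" "\<forall>x\<in>X. v x = 0 \<longrightarrow> w x = 0"
        then have "A w" using v by (auto simp: A_def)
        then have "{x\<in>X. w x \<noteq> 0} = {x\<in>X. v x \<noteq> 0}"
          using vmin w(4) X by (intro card_seteq) auto
        then show "\<forall>x\<in>X. w x = 0 \<longrightarrow> v x = 0" by auto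
      qed (use v in \<open>auto simp: A_def\<close>)
      define H where "H = {q \<in> ?Q. v q = 0}"
      have vz: "\<exists>x\<in>X. v x = 0" using v less.prems(3) by (auto simp: A_def)
      have HF: "H \<in> facets ?Q" unfolding H_def by (rule min_support_functional_facet[OF X ms vz])
      \<comment> \<open>The functional chosen for \<open>H\<close> may differ from \<open>v\<close>,
        but it has the same zeros in \<open>X\<close>, and this suffices for the
        subtraction.\<close>
      have "P H v" using ms by (simp add: P_def H_def)
      then have PH: "P H (h H)" using someI[of "P H" v] by (auto simp: h_def)
      then have ms': "min_support_functional X (h H)" by (simp add: P_def)
      have "{q \<in> ?Q. h H q = 0} = {q \<in> ?Q. v q = 0}" using PH by (simp add: P_def H_def)
      then have z: "h H x = 0 \<longleftrightarrow> v x = 0" if "x \<in> X" for x using hull_inc[OF that, of convex] by blast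
      have supp: "h H x = 0" if "x \<in> X" "u x = 0" for x using z v that by (auto simp: A_def)
      have "\<exists>x\<in>X. 0 < h H x"
        using ms' by (auto simp: min_support_functional_def order_less_le)
      then obtain t where t: "0 < t" "\<And>x. x \<in> X \<Longrightarrow> 0 \<le> u x - t * h H x"
          "\<exists>x\<in>X. u x \<noteq> 0 \<and> u x - t * h H x = 0"
        using exhaust_nonneg_functional[OF X, of u "h H"] less.prems(2) supp by blast
      have "{x\<in>X. u x - t * h H x \<noteq> 0} \<subset> {x\<in>X. u x \<noteq> 0}"
        using t(3) supp by auto
      then have "card {x\<in>X. u x - t * h H x \<noteq> 0} < card {x\<in>X. u x \<noteq> 0}"
        using X by (intro psubset_card_mono) auto
      moreover have "affine_functional (\<lambda>x. u x - t * h H x)"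
        by (intro affine_functional_diff_scaled less.prems(1) h_aff)
      moreover have "\<exists>x\<in>X. u x - t * h H x = 0" using t(3) by blast
      ultimately obtain c where c: "\<forall>H. 0 \<le> c H" "\<forall>x\<in>X. u x - t * h H x = (\<Sum>H\<in>facets ?Q. c H * h H x)"
        using less.hyps[of "\<lambda>x. u x - t * h H x"] t(2) by blast
      have "u x = (\<Sum>G\<in>facets ?Q. (c(H := c H + t)) G * h G x)" if x: "x \<in> X" for x
      proof -
        have "(\<Sum>G\<in>facets ?Q. (c(H := c H + t)) G * h G x) = (\<Sum>G\<in>facets ?Q. c G * h G x + (if G = H then t * h H x else 0))"
          by (intro sum.cong) (auto simp: algebra_simps)
        also have "\<dots> = (\<Sum>G\<in>facets ?Q. c G * h G x) + t * h H x"
          using HF finite_facets[OF X] by (simp add: sum.distrib)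
        finally show ?thesis using c(2) x by (metis diff_add_cancel)
      qed
      moreover have "\<forall>G. 0 \<le> (c(H := c H + t)) G" using c(1) t(1) by auto
      ultimately show ?thesis by blast
    qed
  qed
  show ?thesis
  proof (rule that)
    show "0 \<le> h H q" if "q \<in> ?Q" for H q
      by (rule affine_functional_nonneg_on_convex_hull[OF h_aff X h_nn that])
  next
    fix u assume u: "affine_functional u" "\<And>q. q \<in> ?Q \<Longrightarrow> 0 \<le> u q" "\<exists>q\<in>?Q. u q = 0"
    have uX: "\<And>x. x \<in> X \<Longrightarrow> 0 \<le> u x" using u(2) hull_inc by metis
    have "{q \<in> ?Q. u q = 0} = convex hull {x \<in> X. u x = 0}"
      by (rule zero_set_of_nonneg_affine_functional(1)[OF u(1) X uX])
    then have "{x \<in> X. u x = 0} \<noteq> {}" using u(3) by (metis (mono_tags, lifting) convex_hull_empty empty_iff mem_Collect_eq)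
    then obtain c where c: "\<forall>H. 0 \<le> c H" "\<forall>x\<in>X. u x = (\<Sum>H\<in>facets ?Q. c H * h H x)"
      using dec[OF u(1)] uX by blast
    have "affine_functional (\<lambda>x. \<Sum>H\<in>facets ?Q. c H * h H x)"
      by (intro affine_functional_sum_scaled h_aff finite_facets X)
    then have "\<forall>q\<in>?Q. u q = (\<Sum>H\<in>facets ?Q. c H * h H q)"
      using affine_functional_eq_on_convex_hull[OF u(1)] c(2) by blast
    with c(1) show "\<exists>c. (\<forall>H. 0 \<le> c H) \<and> (\<forall>q\<in>?Q. u q = (\<Sum>H\<in>facets ?Q. c H * h H q))" by blast
  qed
qed

section \<open>Extensions of polytopes\<close>

lemma simultaneously_positive_point:
  assumes "finite J" "convex F" "F \<noteq> {}" "\<And>i. i \<in> J \<Longrightarrow> affine_functional (u i)"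
    "\<And>i x. i \<in> J \<Longrightarrow> x \<in> F \<Longrightarrow> 0 \<le> u i x" "\<And>i. i \<in> J \<Longrightarrow> \<exists>x\<in>F. u i x \<noteq> 0"
  shows "\<exists>x\<in>F. \<forall>i\<in>J. 0 < u i x"
  using assms
proof (induction J rule: finite_induct)
  case empty
  then show ?case by auto
next
  case (insert j J)
  then obtain x where x: "x \<in> F" "\<forall>i\<in>J. 0 < u i x" by auto
  obtain y where y: "y \<in> F" "0 < u j y"
    using insert.prems(4)[of j] insert.prems(5)[of j] by (force simp: order_less_le)
  let ?z = "(1 - 1/2) *\<^sub>R x + (1/2) *\<^sub>R y"
  have "?z \<in> F" using x y insert.prems(1) by (intro convexD) auto
  moreover have "0 < u i ?z" if i: "i \<in> insert j J" for i
  proof -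
    have "u i ?z = (1 - 1/2) * u i x + (1/2) * u i y"
      by (rule affine_functional_segment) (use i insert.prems in auto)
    moreover have "0 \<le> u i x" "0 \<le> u i y" "0 < u i x \<or> 0 < u i y"
      using i x y insert.prems(4) by auto
    ultimately show ?thesis by auto
  qed
  ultimately show ?case by blast
qed

text \<open>At a point \<open>p\<close> of \<open>F\<close> where all rows not vanishing on
  \<open>F\<close> are positive, the segment from \<open>q\<close> can be prolonged slightly beyond
  \<open>p\<close> inside \<open>C\<close>. Then \<open>p\<close> lies in the open segment from
  \<open>q\<close> to the new point \<open>r\<close>, and the face property yields
  \<open>q\<close>.\<close>

lemma face_of_inequality_system:
  fixes u :: "'i::finite \<Rightarrow> 'a::real_vector \<Rightarrow> real"
  assumes W: "affine W" and C: "C = {x \<in> W. \<forall>i. 0 \<le> u i x}" and u: "\<And>i. affine_functional (u i)"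
    and F: "F face_of C" "F \<noteq> {}" and q: "q \<in> C" "\<And>i. \<forall>x\<in>F. u i x = 0 \<Longrightarrow> u i q = 0"
  shows "q \<in> F"
proof -
  let ?J = "{i. \<exists>x\<in>F. u i x \<noteq> 0}"
  have FC: "F \<subseteq> C" using F(1) face_of_imp_subset by blast
  obtain p where p: "p \<in> F" "\<forall>i\<in>?J. 0 < u i p"
  proof -
    have "\<exists>x\<in>F. \<forall>i\<in>?J. 0 < u i x"
      by (rule simultaneously_positive_point) (use F face_of_imp_convex u FC C in auto)
    then show ?thesis using that by blast
  qed
  \<comment> \<open>The step length will be \<open>m / M\<close>: \<open>m\<close> bounds the
    positive rows at \<open>p\<close> from below, \<open>M\<close> all rows at \<open>q\<close> from
    above. The ones keep \<open>M\<close> positive and the minimum over a nonempty set.\<close>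
  define M where "M = 1 + (\<Sum>i\<in>UNIV. \<bar>u i q\<bar>)"
  define m where "m = Min (insert 1 ((\<lambda>i. u i p) ` ?J))"
  have m: "0 < m" "\<And>i. i \<in> ?J \<Longrightarrow> m \<le> u i p"
    using p(2) by (auto simp: m_def)
  have M: "0 < M" "u i q \<le> M" for i
  proof -
    have "\<bar>u i q\<bar> \<le> (\<Sum>i\<in>UNIV. \<bar>u i q\<bar>)" by (rule member_le_sum) auto
    then show "u i q \<le> M" by (simp add: M_def)
    have "0 \<le> (\<Sum>i\<in>UNIV. \<bar>u i q\<bar>)" by (rule sum_nonneg) auto
    then show "0 < M" unfolding M_def by linarith
  qed
  define e where "e = m / M"
  have e: "0 < e" "e * M = m" using m M(1) by (simp_all add: e_def)
  define r where "r = (1 - (- e)) *\<^sub>R p + (- e) *\<^sub>R q"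
  have "r \<in> W"
    using W p(1) FC q(1) C unfolding r_def affine_alt by blast
  moreover have "0 \<le> u i r" for i
  proof -
    have ur: "u i r = (1 + e) * u i p - e * u i q"
      unfolding r_def affine_functional_segment[OF u] by simp
    show ?thesis
    proof (cases "i \<in> ?J")
      case True
      have "e * u i q \<le> m" using e M(2)[of i] by (metis mult_le_cancel_left_pos)
      also have "\<dots> \<le> u i p" using m(2) True by simp
      also have "\<dots> \<le> (1 + e) * u i p" using e(1) p True by (auto simp: algebra_simps)
      finally show ?thesis by (simp add: ur)
    next
      case False
      then show ?thesis using q(2)[of i] p(1) ur by auto
    qed
  qed
  ultimately have r: "r \<in> C" by (simp add: C)
  show ?thesis
  proof (cases "q = r")
    case True
    then have "(1 + e) *\<^sub>R q = (1 + e) *\<^sub>R p" by (simp add: r_def algebra_simps)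
    with e p(1) show ?thesis by simp
  next
    case False
    have "p = (1 - 1 / (1 + e)) *\<^sub>R q + (1 / (1 + e)) *\<^sub>R r"
    proof -
      have "(1 / (1 + e)) *\<^sub>R r = p - (e / (1 + e)) *\<^sub>R q"
        using e(1) by (simp add: r_def scaleR_right_diff_distrib)
      moreover have "1 - 1 / (1 + e) = e / (1 + e)" using e(1) by (simp add: field_simps)
      ultimately show ?thesis by simp
    qed
    then have "p \<in> open_segment q r"
      using False e(1) by (auto simp: in_segment intro!: exI[of _ "1 / (1 + e)"])
    then show ?thesis using face_ofD[OF F(1)] q(1) r p(1) by blast
  qed
qed

text \<open>A facet misses some point of \<open>C\<close>, so one inequality is tight on the facet
  but not on all of \<open>C\<close>. The face where it is tight is proper and contains the facet,
  hence equals it by dimension.\<close>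

lemma card_facets_inequality_system:
  fixes u :: "'i::finite \<Rightarrow> 'a::euclidean_space \<Rightarrow> real"
  assumes W: "affine W" and C: "C = {x \<in> W. \<forall>i. 0 \<le> u i x}" and u: "\<And>i. affine_functional (u i)"
  shows "card (facets C) \<le> CARD('i)"
proof -
  have "convex C"
    unfolding convex_alt
  proof (intro ballI allI impI)
    fix x y and t :: real assume *: "x \<in> C" "y \<in> C" "0 \<le> t \<and> t \<le> 1"
    then have "(1 - t) *\<^sub>R x + t *\<^sub>R y \<in> W" using W C unfolding affine_alt by blast
    moreover have "0 \<le> u i ((1 - t) *\<^sub>R x + t *\<^sub>R y)" for i
      using * C by (simp add: affine_functional_segment[OF u])
    ultimately show "(1 - t) *\<^sub>R x + t *\<^sub>R y \<in> C" by (simp add: C)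
  qed
  have "facets C \<subseteq> range (\<lambda>i. {x \<in> C. u i x = 0})"
  proof
    fix F assume "F \<in> facets C"
    then have F: "F face_of C" "F \<noteq> {}" "aff_dim F = aff_dim C - 1"
      by (auto simp: facets_eq_facet_of facet_of_def)
    then have "F \<noteq> C" by auto
    then obtain q where q: "q \<in> C" "q \<notin> F" using F(1) face_of_imp_subset by blast
    then obtain i where i: "\<forall>x\<in>F. u i x = 0" "u i q \<noteq> 0"
      using face_of_inequality_system[OF W C u F(1,2)] by blast
    let ?G = "{x \<in> C. u i x = 0}"
    have G: "?G face_of C"
      unfolding face_of_def
    proof (intro conjI ballI impI)
      show "convex ?G"
        unfolding convex_alt using \<open>convex C\<close>[unfolded convex_alt]
        by (auto simp: affine_functional_segment[OF u])
      fix a b x assume ab: "a \<in> C" "b \<in> C" "x \<in> ?G" "x \<in> open_segment a b"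
      then obtain t where t: "0 < t" "t < 1" "x = (1 - t) *\<^sub>R a + t *\<^sub>R b" by (auto simp: in_segment)
      have "(1 - t) * u i a + t * u i b = 0" using ab(3) t affine_functional_segment[OF u] by auto
      moreover have "0 \<le> u i a" "0 \<le> u i b" using ab C by auto
      ultimately have "u i a = 0" "u i b = 0" using t by (auto simp: add_nonneg_eq_0_iff)
      then show "a \<in> ?G" "b \<in> ?G" using ab by auto
    qed auto
    have FG: "F \<subseteq> ?G" using i(1) F(1) face_of_imp_subset by blast
    then have "F face_of ?G" by (intro face_of_subset[OF F(1)]) auto
    moreover have "?G \<noteq> C" using i(2) q(1) by auto
    then have "aff_dim ?G < aff_dim C" by (rule face_of_aff_dim_lt[OF \<open>convex C\<close> G])
    ultimately have "F = ?G"
      using F(3) face_of_aff_dim_lt[of ?G F] face_of_imp_convex[OF G] by force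
    then show "F \<in> range (\<lambda>i. {x \<in> C. u i x = 0})" by blast
  qed
  then have "card (facets C) \<le> card (range (\<lambda>i. {x \<in> C. u i x = 0}))" by (intro card_mono) auto
  also have "\<dots> \<le> CARD('i)" by (rule card_image_le) simp
  finally show ?thesis .
qed

section \<open>Facets under injective linear maps\<close>

lemma affine_hull_of_linear_image:
  fixes f :: "'a::real_vector \<Rightarrow> 'b::real_vector"
  assumes "linear f"
  shows "affine hull (f ` S) = f ` (affine hull S)"
proof (rule equalityI)
  have "(1 - t) *\<^sub>R x + t *\<^sub>R y \<in> f ` (affine hull S)"
    if xy: "x \<in> f ` (affine hull S)" "y \<in> f ` (affine hull S)" for x y t
  proof -
    obtain a b where *: "x = f a" "y = f b" "a \<in> affine hull S" "b \<in> affine hull S" using xy by auto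
    have "(1 - t) *\<^sub>R a + t *\<^sub>R b \<in> affine hull S"
      using affine_affine_hull[of S] *(3,4) unfolding affine_alt by blast
    then show ?thesis
      using assms * by (auto simp: linear_add linear_scale intro!: image_eqI)
  qed
  then have "affine (f ` (affine hull S))" unfolding affine_alt by blast
  then show "affine hull (f ` S) \<subseteq> f ` (affine hull S)"
    by (intro hull_minimal) (auto intro: hull_inc)
  have "affine {x. f x \<in> affine hull (f ` S)}"
    unfolding affine_alt
    using affine_affine_hull[of "f ` S", unfolded affine_alt] assms
    by (auto simp: linear_add linear_scale)
  then have "affine hull S \<subseteq> {x. f x \<in> affine hull (f ` S)}"
    by (intro hull_minimal) (auto intro: hull_inc)
  then show "f ` (affine hull S) \<subseteq> affine hull (f ` S)" by auto
qed

lemma affine_dependent_inj_linear_image: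
  fixes f :: "'a::real_vector \<Rightarrow> 'b::real_vector"
  assumes "linear f" "inj f"
  shows "affine_dependent (f ` S) \<longleftrightarrow> affine_dependent S"
proof -
  have "f ` S - {f x} = f ` (S - {x})" for x using assms(2) by (auto simp: inj_eq)
  then show ?thesis
    unfolding affine_dependent_def using assms
    by (auto simp: affine_hull_of_linear_image inj_image_mem_iff)
qed

lemma affine_dim_inj_linear_image:
  fixes f :: "'a::real_vector \<Rightarrow> 'b::real_vector"
  assumes "linear f" "inj f"
  shows "affine_dim (f ` S) = affine_dim S"
proof -
  obtain B where B: "B \<subseteq> S" "\<not> affine_dependent B" "affine hull S = affine hull B"
    using affine_basis_exists by blast
  have "affine_dim (f ` S) = int (card (f ` B)) - 1"
    using B assms by (intro affine_dim_eq_card_basis)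
      (auto simp: affine_hull_of_linear_image affine_dependent_inj_linear_image)
  moreover have "card (f ` B) = card B" using assms(2) by (metis card_image inj_on_subset subset_UNIV)
  moreover have "affine_dim S = int (card B) - 1"
    using B by (intro affine_dim_eq_card_basis) auto
  ultimately show ?thesis by simp
qed

lemma facets_inj_linear_image:
  fixes f :: "'a::real_vector \<Rightarrow> 'b::real_vector"
  assumes "linear f" "inj f"
  shows "facets (f ` S) = (\<lambda>F. f ` F) ` facets S"
proof (intro equalityI subsetI)
  fix G assume G: "G \<in> facets (f ` S)"
  then have "G \<subseteq> f ` S" by (auto simp: facets_def dest: face_of_imp_subset)
  then obtain F where "G = f ` F" by (auto simp: subset_image_iff)
  with G assms show "G \<in> (\<lambda>F. f ` F) ` facets S"
    by (auto simp: facets_def face_of_linear_image affine_dim_inj_linear_image)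
next
  fix G assume "G \<in> (\<lambda>F. f ` F) ` facets S"
  with assms show "G \<in> facets (f ` S)"
    by (auto simp: facets_def face_of_linear_image affine_dim_inj_linear_image)
qed

lemma lookup_scaleR: "Poly_Mapping.lookup (c *\<^sub>R z) k = c *\<^sub>R Poly_Mapping.lookup z k"
proof -
  have "finite {i. c *\<^sub>R Poly_Mapping.lookup z i \<noteq> 0}"
    by (rule finite_subset[OF _ finite_lookup[of z]]) auto
  then show ?thesis by (simp add: scaleR_poly_mapping_def Abs_poly_mapping_inverse)
qed

text \<open>Extensions are polytopes of finitely supported sequences. This embedding, with
  \<open>g\<close> as the projection back, turns a polytope in coordinate space into an extension of
  itself.\<close>

lemma linear_embedding_finitely_supported:
  obtains f :: "real ^ 'n::finite \<Rightarrow> (nat \<Rightarrow>\<^sub>0 real)" and g where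
    "linear f" "inj f" "linear g" "\<And>x. g (f x) = x"
proof -
  obtain k :: "'n \<Rightarrow> nat" where k: "inj k"
    using finite_imp_inj_to_nat_seg[of "UNIV :: 'n set"] by auto
  define f where "f x = (\<Sum>i\<in>UNIV. Poly_Mapping.single (k i) (x $ i))" for x :: "real ^ 'n"
  define g where "g z = (\<chi> i. Poly_Mapping.lookup z (k i))" for z :: "nat \<Rightarrow>\<^sub>0 real"
  have lookup_f: "Poly_Mapping.lookup (f x) (k i) = x $ i" for x i
    using k by (simp add: f_def lookup_sum lookup_single when_def inj_eq)
  show ?thesis
  proof (rule that)
    show "linear f"
    proof (rule linearI)
      show "f (x + y) = f x + f y" for x y
        by (simp add: f_def single_add sum.distrib)
      show "f (c *\<^sub>R x) = c *\<^sub>R f x" for c x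
        by (rule poly_mapping_eqI)
          (auto simp: f_def lookup_sum lookup_single lookup_scaleR sum_distrib_left when_def intro!: sum.cong)
    qed
    show gf: "g (f x) = x" for x
      by (simp add: g_def lookup_f vec_eq_iff)
    then show "inj f" by (metis injI)
    show "linear g"
      by (rule linearI) (simp_all add: g_def lookup_add lookup_scaleR vec_eq_iff)
  qed
qed

lemma extension_complexity_le_card_facets:
  fixes P :: "(real ^ 'n::finite) set"
  assumes "polytope P"
  shows "extension_complexity P \<le> card (facets P)"
proof -
  obtain f :: "real ^ 'n \<Rightarrow> (nat \<Rightarrow>\<^sub>0 real)" and g where fg: "linear f" "inj f" "linear g" "\<And>x. g (f x) = x"
    using linear_embedding_finitely_supported by blast
  obtain v where "finite v" "P = convex hull v" using assms by (auto simp: polytope_def)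
  then have "polytope (f ` P)"
    using convex_hull_linear_image[OF fg(1), of v] by (auto simp: polytope_def)
  moreover have "P = (\<lambda>x. g x + 0) ` (f ` P)" using fg(4) by (auto simp: image_image)
  moreover have "card (facets (f ` P)) = card (facets P)"
    unfolding facets_inj_linear_image[OF fg(1,2)]
    by (intro card_image inj_onI) (use fg(2) in \<open>simp add: inj_image_eq_iff\<close>)
  ultimately show ?thesis
    unfolding extension_complexity_def using fg(3) by (intro Least_le) blast
qed

text \<open>Yannakakis's argument: each functional on \<open>P\<close> pulls back along the
  projection to a nonnegative functional on \<open>Q\<close> with a zero, hence to a nonnegative
  combination of facet functionals of \<open>Q\<close>, which are evaluated at chosen preimages of
  the points of \<open>P\<close>.\<close>

lemma extension_complexity_factorization:
  fixes P :: "(real ^ 'n::finite) set" and u :: "'x \<Rightarrow> real ^ 'n \<Rightarrow> real"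
  assumes P: "polytope P" and u: "\<And>x. affine_functional (u x)" "\<And>x p. p \<in> P \<Longrightarrow> 0 \<le> u x p"
    "\<And>x. \<exists>p\<in>P. u x p = 0"
  obtains I :: "(nat \<Rightarrow>\<^sub>0 real) set set" and l h where "finite I" "card I = extension_complexity P"
    "\<And>x H. 0 \<le> l x H" "\<And>H p. p \<in> P \<Longrightarrow> 0 \<le> h H p" "\<And>x p. p \<in> P \<Longrightarrow> u x p = (\<Sum>H\<in>I. l x H * h H p)"
proof -
  let ?E = "\<lambda>m. \<exists>(Q :: (nat \<Rightarrow>\<^sub>0 real) set) L c.
        polytope Q \<and> linear L \<and> P = (\<lambda>x. L x + c) ` Q \<and> card (facets Q) = m"
  obtain f :: "real ^ 'n \<Rightarrow> (nat \<Rightarrow>\<^sub>0 real)" and g where fg: "linear f" "inj f" "linear g" "\<And>x. g (f x) = x"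
    using linear_embedding_finitely_supported by blast
  obtain v where "finite v" "P = convex hull v" using P by (auto simp: polytope_def)
  then have "polytope (f ` P)"
    using convex_hull_linear_image[OF fg(1), of v] by (auto simp: polytope_def)
  moreover have "P = (\<lambda>x. g x + 0) ` (f ` P)" using fg(4) by (auto simp: image_image)
  ultimately have "?E (card (facets (f ` P)))" using fg(3) by blast
  then have "?E (extension_complexity P)" unfolding extension_complexity_def by (rule LeastI)
  then obtain Q :: "(nat \<Rightarrow>\<^sub>0 real) set" and L c where Q: "polytope Q" "linear L" "P = (\<lambda>x. L x + c) ` Q"
      "card (facets Q) = extension_complexity P" by blast
  obtain X where X: "finite X" "Q = convex hull X" using Q(1) by (auto simp: polytope_def)
  obtain h where h: "\<And>H q. q \<in> Q \<Longrightarrow> 0 \<le> h H q"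
    "\<And>v. affine_functional v \<Longrightarrow> (\<And>q. q \<in> Q \<Longrightarrow> 0 \<le> v q) \<Longrightarrow> \<exists>q\<in>Q. v q = 0 \<Longrightarrow>
       \<exists>c. (\<forall>H. 0 \<le> c H) \<and> (\<forall>q\<in>Q. v q = (\<Sum>H\<in>facets Q. c H * h H q))"
    using facet_functionals[OF X(1)] unfolding X(2) by blast
  have "\<exists>d. (\<forall>H. 0 \<le> d H) \<and> (\<forall>q\<in>Q. u x (L q + c) = (\<Sum>H\<in>facets Q. d H * h H q))" for x
  proof (rule h(2))
    obtain f d where f: "linear f" "u x = (\<lambda>p. f p + d)" using u(1)[of x] by (auto simp: affine_functional_def)
    have "linear (\<lambda>q. f (L q))" using linear_compose[OF Q(2) f(1)] by (simp add: o_def)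
    then show "affine_functional (\<lambda>q. u x (L q + c))"
      unfolding affine_functional_def f(2)
      by (intro exI[of _ "\<lambda>q. f (L q)"] exI[of _ "f c + d"]) (auto simp: linear_add[OF f(1)])
    show "0 \<le> u x (L q + c)" if "q \<in> Q" for q using u(2) that by (auto simp: Q(3))
    show "\<exists>q\<in>Q. u x (L q + c) = 0" using u(3)[of x] by (auto simp: Q(3))
  qed
  then obtain l where l: "\<And>x H. 0 \<le> l x H" "\<And>x q. q \<in> Q \<Longrightarrow> u x (L q + c) = (\<Sum>H\<in>facets Q. l x H * h H q)"
    by metis
  define s where "s p = (SOME q. q \<in> Q \<and> p = L q + c)" for p
  have s: "s p \<in> Q" "L (s p) + c = p" if "p \<in> P" for p
  proof -
    have "\<exists>q. q \<in> Q \<and> p = L q + c" using that by (auto simp: Q(3))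
    from someI_ex[OF this] show "s p \<in> Q" "L (s p) + c = p" by (simp_all add: s_def)
  qed
  show ?thesis
  proof (rule that[of "facets Q" l "\<lambda>H p. h H (s p)"])
    show "finite (facets Q)" using finite_facets[OF X(1)] by (simp add: X(2))
    show "u x p = (\<Sum>H\<in>facets Q. l x H * h H (s p))" if "p \<in> P" for x p
      using l(2)[OF s(1)[OF that], of x] s(2)[OF that] by simp
  qed (use Q(4) l(1) h(1) s in auto)
qed

section \<open>Cones with prescribed incidences\<close>

text \<open>With a double description by inequalities and by generators, the face lattice is
  determined by which rows vanish on which generators. The subspace \<open>W\<close> accommodates
  the hypersimplex cone, which lies in a hyperplane.\<close>

locale generated_cone =
  fixes W :: "'a::real_vector set" and u :: "'i::finite \<Rightarrow> 'a \<Rightarrow> real"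
    and C :: "'a set" and E :: "'e set" and w :: "'e \<Rightarrow> 'a"
  assumes W: "subspace W" and C: "C = {x \<in> W. \<forall>i. 0 \<le> u i x}" and linear_u: "\<And>i. linear (u i)"
    and finite_E: "finite E" and w: "\<And>e. e \<in> E \<Longrightarrow> w e \<in> C"
    and generated: "\<And>x. x \<in> C \<Longrightarrow> \<exists>c. (\<forall>e. 0 \<le> c e) \<and> x = (\<Sum>e\<in>E. c e *\<^sub>R w e)"
begin

definition sub :: "'i set \<Rightarrow> 'a set" where
  "sub J = {x \<in> C. \<forall>i\<in>J. u i x = 0}"

lemma affine_functional_u: "affine_functional (u i)"
  unfolding affine_functional_def using linear_u[of i] by (intro exI[of _ "u i"] exI[of _ 0]) auto

lemma convex_cone_sub: "convex_cone (sub J)"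
  unfolding convex_cone_iff sub_def
  using W linear_u subspace_0[OF W] by (auto simp: C linear_add linear_scale linear_0 subspace_add subspace_scale)

lemma zero_in_sub: "0 \<in> sub J"
  by (rule convex_cone_contains_0[OF convex_cone_sub])

lemma sub_face: "sub J face_of C"
  unfolding face_of_def
proof (intro conjI ballI impI)
  show "sub J \<subseteq> C" by (auto simp: sub_def)
  show "convex (sub J)" using convex_cone_sub by (simp add: convex_cone_def)
  fix a b x assume ab: "a \<in> C" "b \<in> C" "x \<in> sub J" "x \<in> open_segment a b"
  then obtain t where t: "0 < t" "t < 1" "x = (1 - t) *\<^sub>R a + t *\<^sub>R b" by (auto simp: in_segment)
  have "u i a = 0 \<and> u i b = 0" if "i \<in> J" for i
  proof -
    have "(1 - t) * u i a + t * u i b = 0"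
      using ab(3) that t affine_functional_segment[OF affine_functional_u] by (auto simp: sub_def)
    moreover have "0 \<le> u i a" "0 \<le> u i b" using ab C by auto
    ultimately show ?thesis using t by (auto simp: add_nonneg_eq_0_iff)
  qed
  with ab show "a \<in> sub J" "b \<in> sub J" by (auto simp: sub_def)
qed

lemma face_eq_sub:
  assumes "F face_of C" "F \<noteq> {}"
  shows "F = sub {i. \<forall>x\<in>F. u i x = 0}"
proof
  show "F \<subseteq> sub {i. \<forall>x\<in>F. u i x = 0}"
    using assms(1) face_of_imp_subset by (fastforce simp: sub_def)
  show "sub {i. \<forall>x\<in>F. u i x = 0} \<subseteq> F"
    using face_of_inequality_system[OF subspace_imp_affine[OF W] C affine_functional_u assms]
    by (auto simp: sub_def)
qed

lemma generated_sub:
  assumes "x \<in> sub J"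
  shows "\<exists>c. (\<forall>e. 0 \<le> c e) \<and> x = (\<Sum>e\<in>E. c e *\<^sub>R w e) \<and> (\<forall>e\<in>E. c e \<noteq> 0 \<longrightarrow> w e \<in> sub J)"
proof -
  obtain c where c: "\<forall>e. 0 \<le> c e" "x = (\<Sum>e\<in>E. c e *\<^sub>R w e)"
    using assms generated[of x] by (auto simp: sub_def)
  have "w e \<in> sub J" if e: "e \<in> E" "c e \<noteq> 0" for e
    unfolding sub_def
  proof (intro CollectI conjI ballI)
    show "w e \<in> C" by (rule w[OF e(1)])
    fix i assume i: "i \<in> J"
    have "(\<Sum>e\<in>E. c e * u i (w e)) = 0"
      using assms i c(2) linear_u[of i] by (auto simp: sub_def linear_sum linear_scale)
    moreover have "0 \<le> c e * u i (w e)" if "e \<in> E" for e using c(1) w[OF that] C by simp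
    ultimately have "c e * u i (w e) = 0" using e(1) finite_E by (subst (asm) sum_nonneg_eq_0_iff) auto
    with e show "u i (w e) = 0" by simp
  qed
  with c show ?thesis by blast
qed

lemma sub_subset_iff:
  "sub J \<subseteq> sub K \<longleftrightarrow> (\<forall>e\<in>E. (\<forall>i\<in>J. u i (w e) = 0) \<longrightarrow> (\<forall>i\<in>K. u i (w e) = 0))"
proof
  assume "sub J \<subseteq> sub K"
  then show "\<forall>e\<in>E. (\<forall>i\<in>J. u i (w e) = 0) \<longrightarrow> (\<forall>i\<in>K. u i (w e) = 0)"
    using w by (auto simp: sub_def)
next
  assume *: "\<forall>e\<in>E. (\<forall>i\<in>J. u i (w e) = 0) \<longrightarrow> (\<forall>i\<in>K. u i (w e) = 0)"
  show "sub J \<subseteq> sub K"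
  proof
    fix x assume x: "x \<in> sub J"
    then obtain c where c: "x = (\<Sum>e\<in>E. c e *\<^sub>R w e)" "\<forall>e\<in>E. c e \<noteq> 0 \<longrightarrow> w e \<in> sub J"
      using generated_sub by blast
    have "u i x = 0" if "i \<in> K" for i
      unfolding c(1) using * c(2) that linear_u[of i]
      by (auto simp: linear_sum linear_scale sub_def intro!: sum.neutral)
    with x show "x \<in> sub K" by (auto simp: sub_def)
  qed
qed

end

text \<open>The nonempty faces of either cone are the sets \<open>sub J\<close>, and their
  inclusions depend only on the incidences. The empty face is treated apart, since every
  \<open>sub J\<close> contains the origin.\<close>

lemma face_lattice_iso_of_incidence:
  assumes "generated_cone W u C E w" "generated_cone W' u' C' E w'"
    and inc: "\<And>e i. e \<in> E \<Longrightarrow> u i (w e) = 0 \<longleftrightarrow> u' i (w' e) = 0"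
  obtains \<phi> where "face_lattice_iso \<phi> C C'"
    "\<And>i. \<phi> (C \<inter> {x. u i x = 0}) = C' \<inter> {x. u' i x = 0}"
proof -
  interpret A: generated_cone W u C E w by fact
  interpret B: generated_cone W' u' C' E w' by fact
  define \<phi> where "\<phi> F = (if F = {} then {} else B.sub {i. \<forall>x\<in>F. u i x = 0})" for F
  have iff: "A.sub J \<subseteq> A.sub K \<longleftrightarrow> B.sub J \<subseteq> B.sub K" for J K
    unfolding A.sub_subset_iff B.sub_subset_iff using inc by auto
  have \<phi>_sub: "\<phi> (A.sub J) = B.sub J" for J
  proof -
    have ne: "A.sub J \<noteq> {}" using A.zero_in_sub by blast
    define K where "K = {i. \<forall>x\<in>A.sub J. u i x = 0}"
    have "A.sub J = A.sub K" unfolding K_def by (rule A.face_eq_sub[OF A.sub_face ne])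
    then have "B.sub J = B.sub K" using iff[of J K] iff[of K J] by auto
    with ne show ?thesis by (simp add: \<phi>_def K_def)
  qed
  have faces: "F face_of C \<longleftrightarrow> F = {} \<or> (\<exists>J. F = A.sub J)" for F
    using A.sub_face A.face_eq_sub by blast
  have faces': "F face_of C' \<longleftrightarrow> F = {} \<or> (\<exists>J. F = B.sub J)" for F
    using B.sub_face B.face_eq_sub by blast
  have mono: "F \<subseteq> F' \<longleftrightarrow> \<phi> F \<subseteq> \<phi> F'" if F: "F face_of C" "F' face_of C" for F F'
  proof -
    consider "F = {}" | J where "F = A.sub J" "F' = {}" | J K where "F = A.sub J" "F' = A.sub K"
      using F(1)[unfolded faces] F(2)[unfolded faces] by auto
    then show ?thesis
    proof cases
      case 1 then show ?thesis by (simp add: \<phi>_def)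
    next
      case (2 J)
      then show ?thesis using A.zero_in_sub[of J] B.zero_in_sub[of J] by (auto simp: \<phi>_sub) (auto simp: \<phi>_def)
    next
      case (3 J K) then show ?thesis by (simp add: \<phi>_sub iff)
    qed
  qed
  have "bij_betw \<phi> {F. F face_of C} {F. F face_of C'}"
    unfolding bij_betw_def
  proof
    show "inj_on \<phi> {F. F face_of C}"
    proof (rule inj_onI)
      fix F F' assume F: "F \<in> {F. F face_of C}" "F' \<in> {F. F face_of C}" "\<phi> F = \<phi> F'"
      have "F \<subseteq> F'" "F' \<subseteq> F" using mono[of F F'] mono[of F' F] F by simp_all
      then show "F = F'" by simp
    qed
    show "\<phi> ` {F. F face_of C} = {F. F face_of C'}"
    proof (intro equalityI subsetI)
      fix G assume "G \<in> \<phi> ` {F. F face_of C}"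
      then obtain F where "F face_of C" "G = \<phi> F" by auto
      then show "G \<in> {F. F face_of C'}" by (auto simp: \<phi>_def B.sub_face)
    next
      fix G assume "G \<in> {F. F face_of C'}"
      then consider "G = {}" | J where "G = B.sub J" using faces' by auto
      then show "G \<in> \<phi> ` {F. F face_of C}"
      proof cases
        case 1
        then have "G = \<phi> {}" by (simp add: \<phi>_def)
        then show ?thesis by simp
      next
        case (2 J)
        then have "G = \<phi> (A.sub J)" by (simp add: \<phi>_sub)
        then show ?thesis using A.sub_face by blast
      qed
    qed
  qed
  then have "face_lattice_iso \<phi> C C'" unfolding face_lattice_iso_def using mono by blast
  moreover have "\<phi> (C \<inter> {x. u i x = 0}) = C' \<inter> {x. u' i x = 0}" for i
  proof -
    have "C \<inter> {x. u i x = 0} = A.sub {i}" "C' \<inter> {x. u' i x = 0} = B.sub {i}"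
      by (auto simp: A.sub_def B.sub_def)
    then show ?thesis by (simp add: \<phi>_sub)
  qed
  ultimately show ?thesis using that by blast
qed

section \<open>Model cones with reciprocal weights\<close>

definition reciprocal :: "('n \<Rightarrow> 'n \<Rightarrow> real) \<Rightarrow> bool" where
  "reciprocal a \<longleftrightarrow> (\<forall>i j. i \<noteq> j \<longrightarrow> 0 < a i j \<and> a i j * a j i = 1)"

text \<open>In the coordinates given by the \<open>f\<close>-columns, \<open>Inr k\<close> is the coordinate \<open>k\<close>
  and \<open>Inl k\<close> is the functional of the facet truncating the vertex \<open>k\<close>.\<close>

fun model_row :: "('n::finite \<Rightarrow> 'n \<Rightarrow> real) \<Rightarrow> 'n + 'n \<Rightarrow> real ^ 'n \<Rightarrow> real" where
  "model_row a (Inl k) y = (\<Sum>j\<in>UNIV - {k}. a k j * y $ j) - y $ k"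
| "model_row a (Inr k) y = y $ k"

text \<open>For reciprocal weights this spans the ray common to the truncations at both ends of the
  edge, scaled so that its two coordinates have product 1. The sum has a single summand, for the
  other end, which makes the formula depend on the unordered edge.\<close>

definition edge_vector :: "('n::finite \<Rightarrow> 'n \<Rightarrow> real) \<Rightarrow> 'n set \<Rightarrow> real ^ 'n" where
  "edge_vector a e = (\<chi> k. if k \<in> e then \<Sum>j\<in>e - {k}. sqrt (a k j) else 0)"

lemma linear_model_row: "linear (model_row a x)"
proof (cases x)
  case (Inl k)
  have "linear (\<lambda>y. (\<Sum>j\<in>UNIV - {k}. a k j * y $ j) - y $ k)"
    by (rule linearI) (simp_all add: distrib_left sum.distrib sum_distrib_left algebra_simps)
  moreover have "model_row a x = (\<lambda>y. (\<Sum>j\<in>UNIV - {k}. a k j * y $ j) - y $ k)"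
    using Inl by (simp add: fun_eq_iff)
  ultimately show ?thesis by simp
next
  case (Inr k)
  have "linear (\<lambda>y. y $ k :: real)" by (rule linearI) auto
  moreover have "model_row a x = (\<lambda>y. y $ k)" using Inr by (simp add: fun_eq_iff)
  ultimately show ?thesis by simp
qed

lemma edge_vector_doubleton:
  "i \<noteq> j \<Longrightarrow> edge_vector a {i, j} $ k = (if k = i then sqrt (a i j) else if k = j then sqrt (a j i) else 0)"
  by (auto simp: edge_vector_def insert_Diff_if)

lemma model_row_edge_vector_doubleton:
  assumes "i \<noteq> j"
  shows "model_row a (Inl k) (edge_vector a {i, j}) =
    (if k = i then a i j * sqrt (a j i) - sqrt (a i j)
     else if k = j then a j i * sqrt (a i j) - sqrt (a j i)
     else a k i * sqrt (a i j) + a k j * sqrt (a j i))"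
proof -
  let ?v = "edge_vector a {i, j}"
  have "(\<Sum>m\<in>UNIV - {k}. a k m * ?v $ m) = (\<Sum>m\<in>{i, j} - {k}. a k m * ?v $ m)"
    by (rule sum.mono_neutral_right) (auto simp: edge_vector_def)
  then show ?thesis using assms by (auto simp: edge_vector_doubleton insert_Diff_if)
qed

lemma reciprocal_sqrt:
  assumes "reciprocal a" "i \<noteq> j"
  shows "a i j * sqrt (a j i) = sqrt (a i j)"
proof -
  have "0 < a i j" "sqrt (a i j) * sqrt (a j i) = 1"
    using assms by (auto simp: reciprocal_def real_sqrt_mult[symmetric])
  then show ?thesis
    by (metis mult.assoc mult.right_neutral order_less_imp_le real_sqrt_mult_self abs_of_pos)
qed

lemma model_row_edge_vector:
  assumes a: "reciprocal a" and e: "e \<in> edges UNIV"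
  shows "0 \<le> model_row a x (edge_vector a e)"
    and "model_row a x (edge_vector a e) = 0 \<longleftrightarrow> \<not> positive_on x e"
proof -
  obtain i j where ij: "e = {i, j}" "i \<noteq> j" using e by (auto elim: edgeE)
  have pos: "0 < a k m" if "k \<noteq> m" for k m using a that by (auto simp: reciprocal_def)
  have "0 \<le> model_row a x (edge_vector a e) \<and> (model_row a x (edge_vector a e) = 0 \<longleftrightarrow> \<not> positive_on x e)"
  proof (cases x)
    case (Inl k)
    have "0 < a k i * sqrt (a i j) + a k j * sqrt (a j i)" if "k \<noteq> i" "k \<noteq> j"
      using that ij pos by (intro add_pos_pos mult_pos_pos) auto
    then show ?thesis
      using Inl ij reciprocal_sqrt[OF a, of i j] reciprocal_sqrt[OF a, of j i]
      by (auto simp: model_row_edge_vector_doubleton simp del: model_row.simps)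
  next
    case (Inr k)
    then show ?thesis using ij pos[of i j] pos[of j i] by (auto simp: edge_vector_doubleton)
  qed
  then show "0 \<le> model_row a x (edge_vector a e)"
    and "model_row a x (edge_vector a e) = 0 \<longleftrightarrow> \<not> positive_on x e" by auto
qed

text \<open>A tight truncation \<open>k\<close> has \<open>y $ k\<close> nonzero. If
  \<open>i\<close> and \<open>k\<close> are both tight, inserting one equation into the other with
  \<open>a i k * a k i = 1\<close> leaves no room for a third coordinate. So the tight truncations
  are contained in an edge within the support of \<open>y\<close>, and the ray of this edge lies on
  every facet through \<open>y\<close>.\<close>

lemma tight_edge_exists:
  assumes a: "reciprocal a" and y: "\<And>x. 0 \<le> model_row a x y" "y \<noteq> 0"
  obtains e where "e \<in> edges UNIV" "\<And>x. model_row a x y = 0 \<Longrightarrow> \<not> positive_on x e"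
proof -
  have pos: "0 < a k m" if "k \<noteq> m" for k m using a that by (auto simp: reciprocal_def)
  have nn: "0 \<le> y $ k" for k using y(1)[of "Inr k"] by simp
  have term_nn: "0 \<le> a k m * y $ m" if "k \<noteq> m" for k m using pos[OF that] nn by simp
  obtain p where p: "y $ p \<noteq> 0" using y(2) by (auto simp: vec_eq_iff)
  define T where "T = {k. model_row a (Inl k) y = 0}"
  have other: "\<exists>j. j \<noteq> i \<and> y $ j \<noteq> 0" if "y $ i \<noteq> 0" for i
  proof (rule ccontr)
    assume "\<not> ?thesis"
    then have "(\<Sum>j\<in>UNIV - {i}. a i j * y $ j) = 0" by (intro sum.neutral) auto
    then show False using y(1)[of "Inl i"] nn[of i] that by simp
  qed
  have T_supp: "y $ k \<noteq> 0" if "k \<in> T" for k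
  proof
    assume k: "y $ k = 0"
    then have "(\<Sum>j\<in>UNIV - {k}. a k j * y $ j) = 0" using that by (simp add: T_def)
    moreover have "p \<in> UNIV - {k}" using p k by auto
    ultimately have "a k p * y $ p = 0"
      by (subst (asm) sum_nonneg_eq_0_iff) (auto intro: term_nn)
    then show False using p k pos[of k p] by auto
  qed
  have two: "y $ m = 0" if T: "i \<in> T" "k \<in> T" "i \<noteq> k" and m: "m \<noteq> i" "m \<noteq> k" for i k m
  proof -
    have le: "a i k * y $ k + a i m * y $ m \<le> y $ i" if "i \<in> T" "k \<noteq> i" "m \<noteq> i" "m \<noteq> k" for i k
    proof -
      have "(\<Sum>j\<in>{k, m}. a i j * y $ j) \<le> (\<Sum>j\<in>UNIV - {i}. a i j * y $ j)"
        using that by (intro sum_mono2) (auto intro: term_nn)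
      then show ?thesis using that by (auto simp: T_def)
    qed
    have "a i k * (a k i * y $ i) \<le> a i k * y $ k"
      using le[OF T(2), of i] T(3) m term_nn[of k m] pos[of i k] by (intro mult_left_mono) auto
    moreover have "a i k * (a k i * y $ i) = y $ i"
      using a T(3) by (auto simp: reciprocal_def mult.assoc[symmetric])
    ultimately have "a i m * y $ m \<le> 0" using le[OF T(1), of k] T(3) m by auto
    then have "a i m * y $ m = 0" using term_nn[of i m] m by auto
    then show ?thesis using pos[of i m] m by auto
  qed
  have "\<exists>i j. i \<noteq> j \<and> y $ i \<noteq> 0 \<and> y $ j \<noteq> 0 \<and> T \<subseteq> {i, j}"
  proof (cases "T = {}")
    case True
    then show ?thesis using p other[OF p] by blast
  next
    case False
    then obtain i where i: "i \<in> T" by auto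
    show ?thesis
    proof (cases "T = {i}")
      case True
      then show ?thesis using i T_supp[OF i] other[OF T_supp[OF i]] by blast
    next
      case False
      then obtain k where k: "k \<in> T" "k \<noteq> i" using i by auto
      have "T \<subseteq> {i, k}" using two[OF i k(1)] k(2) T_supp by blast
      then show ?thesis using i k T_supp by blast
    qed
  qed
  then obtain i j where ij: "i \<noteq> j" "y $ i \<noteq> 0" "y $ j \<noteq> 0" "T \<subseteq> {i, j}" by blast
  show ?thesis
  proof (rule that[of "{i, j}"])
    show "{i, j} \<in> edges UNIV" using ij by (simp add: doubleton_edge)
    show "\<not> positive_on x {i, j}" if "model_row a x y = 0" for x
      using that ij by (cases x) (auto simp: T_def)
  qed
qed

text \<open>Subtracting the critical multiple of the ray of a tight edge keeps all rows nonnegative,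
  preserves the zero rows and creates a new one.\<close>

lemma model_cone_generated:
  assumes a: "reciprocal a" and "\<And>x. 0 \<le> model_row a x y"
  shows "\<exists>c. (\<forall>e. 0 \<le> c e) \<and> y = (\<Sum>e\<in>edges UNIV. c e *\<^sub>R edge_vector a e)"
  using assms(2)
proof (induction "card {x. model_row a x y \<noteq> 0}" arbitrary: y rule: less_induct)
  case less
  show ?case
  proof (cases "y = 0")
    case True
    then show ?thesis by (intro exI[of _ "\<lambda>_. 0"]) auto
  next
    case False
    obtain e where e: "e \<in> edges UNIV" "\<And>x. model_row a x y = 0 \<Longrightarrow> \<not> positive_on x e"
      using tight_edge_exists[OF a less.prems False] by blast
    let ?v = "edge_vector a e"
    have supp: "model_row a x ?v = 0" if "model_row a x y = 0" for x
      using e(2)[OF that] model_row_edge_vector(2)[OF a e(1)] by simp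
    obtain i j where "e = {i, j}" using e(1) by (auto elim: edgeE)
    then have "\<exists>x. model_row a x ?v \<noteq> 0"
      using model_row_edge_vector(2)[OF a e(1), of "Inr i"] by (intro exI[of _ "Inr i"]) simp
    then have "\<exists>x\<in>UNIV. 0 < model_row a x ?v"
      using model_row_edge_vector(1)[OF a e(1)] by (force simp: order_less_le)
    then obtain t where t: "0 < t" "\<And>x. 0 \<le> model_row a x y - t * model_row a x ?v"
        "\<exists>x. model_row a x y \<noteq> 0 \<and> model_row a x y - t * model_row a x ?v = 0"
      using exhaust_nonneg_functional[of UNIV "\<lambda>x. model_row a x y" "\<lambda>x. model_row a x ?v"] less.prems supp
      by auto
    have row: "model_row a x (y - t *\<^sub>R ?v) = model_row a x y - t * model_row a x ?v" for x
      using linear_model_row[of a x] by (simp add: linear_diff linear_scale del: model_row.simps)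
    have "{x. model_row a x (y - t *\<^sub>R ?v) \<noteq> 0} \<subset> {x. model_row a x y \<noteq> 0}"
      using t(3) supp by (auto simp: row simp del: model_row.simps)
    then have "card {x. model_row a x (y - t *\<^sub>R ?v) \<noteq> 0} < card {x. model_row a x y \<noteq> 0}"
      by (intro psubset_card_mono) auto
    from less.hyps[OF this] t(2) obtain c where c: "\<forall>e. 0 \<le> c e"
      "y - t *\<^sub>R ?v = (\<Sum>e\<in>edges UNIV. c e *\<^sub>R edge_vector a e)"
      unfolding row by blast
    have "(\<Sum>e'\<in>edges UNIV. (c(e := c e + t)) e' *\<^sub>R edge_vector a e')
       = (\<Sum>e'\<in>edges UNIV. c e' *\<^sub>R edge_vector a e' + (if e' = e then t *\<^sub>R ?v else 0))"
      by (intro sum.cong) (auto simp: algebra_simps)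
    also have "\<dots> = (y - t *\<^sub>R ?v) + t *\<^sub>R ?v"
      using e(1) finite_edges[of "UNIV :: 'a set"] by (simp add: sum.distrib c(2))
    finally have "y = (\<Sum>e'\<in>edges UNIV. (c(e := c e + t)) e' *\<^sub>R edge_vector a e')" by simp
    moreover have "\<forall>e'. 0 \<le> (c(e := c e + t)) e'" using c(1) t(1) by auto
    ultimately show ?thesis by blast
  qed
qed

section \<open>Normal form of realizations\<close>

lemma (in generated_cone) convex_cone_hull_eq_sub:
  assumes "S \<subseteq> sub J" "\<And>e. e \<in> E \<Longrightarrow> w e \<in> sub J \<Longrightarrow> w e \<in> S"
  shows "convex_cone hull S = sub J"
proof (rule equalityI)
  show "convex_cone hull S \<subseteq> sub J"
    using assms(1) convex_cone_sub by (intro hull_minimal) auto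
  show "sub J \<subseteq> convex_cone hull S"
  proof
    fix x assume "x \<in> sub J"
    then obtain c where c: "\<forall>e. 0 \<le> c e" "x = (\<Sum>e\<in>E. c e *\<^sub>R w e)" "\<forall>e\<in>E. c e \<noteq> 0 \<longrightarrow> w e \<in> sub J"
      using generated_sub by blast
    have mem: "c e *\<^sub>R w e \<in> convex_cone hull S" if "e \<in> E" for e
    proof (cases "c e = 0")
      case True
      then show ?thesis by (simp add: convex_cone_hull_contains_0)
    next
      case False
      then have "w e \<in> S" using assms(2) c(3) that by blast
      then show ?thesis using c(1) by (intro convex_cone_hull_mul hull_inc) auto
    qed
    have "(\<Sum>e\<in>D. f e) \<in> convex_cone hull S"
      if "finite D" "\<And>e. e \<in> D \<Longrightarrow> f e \<in> convex_cone hull S" for D and f :: "'e \<Rightarrow> 'a"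
      using that by (induction D rule: finite_induct) (auto intro: convex_cone_hull_add convex_cone_hull_contains_0)
    from this[OF finite_E mem] show "x \<in> convex_cone hull S" unfolding c(2) .
  qed
qed

section \<open>The hypersimplex as the model with unit weights\<close>

definition unit_weights :: "'n \<Rightarrow> 'n \<Rightarrow> real" where
  "unit_weights = (\<lambda>_ _. 1)"

lemma reciprocal_unit_weights: "reciprocal unit_weights"
  by (simp add: reciprocal_def unit_weights_def)

lemma model_row_unit_weights:
  "model_row unit_weights (Inl k) y = (\<Sum>j\<in>UNIV. y $ j) - 2 * y $ k"
  by (simp add: unit_weights_def sum_diff1)

lemma edge_vector_unit_weights:
  assumes "e \<in> edges UNIV"
  shows "edge_vector unit_weights e $ k = (if k \<in> e then 1 else 0)"
proof -
  obtain i j where "e = {i, j}" "i \<noteq> j" using assms by (auto elim: edgeE)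
  then show ?thesis by (auto simp: edge_vector_doubleton unit_weights_def)
qed

lemma sum_edge_vector_unit_weights:
  assumes "e \<in> edges UNIV"
  shows "(\<Sum>k\<in>UNIV. edge_vector unit_weights e $ k) = 2"
  using assms by (simp add: edge_vector_unit_weights sum.If_cases) (simp add: edges_def)

text \<open>On the hyperplane where the coordinates sum to \<open>2 * fst z\<close>, the row
  \<open>Inl k\<close> equals \<open>2 * (fst z - snd z $ k)\<close>. The inequalities are thus the
  homogenized bounds 0 and 1 on the coordinates.\<close>

definition hypersimplex_cone :: "(real \<times> (real ^ 'n::finite)) set" where
  "hypersimplex_cone = {z. (\<Sum>k\<in>UNIV. snd z $ k) = 2 * fst z \<and> (\<forall>x. 0 \<le> model_row unit_weights x (snd z))}"

interpretation hypersimplex: generated_cone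
  "{z. (\<Sum>k\<in>UNIV. snd z $ k) = 2 * fst z}" "\<lambda>x z. model_row unit_weights x (snd z)"
  "hypersimplex_cone :: (real \<times> (real ^ 'n::finite)) set" "edges UNIV" "\<lambda>e. (1, edge_vector unit_weights e)"
proof (rule generated_cone.intro)
  show "subspace {z. (\<Sum>k\<in>UNIV. snd z $ k) = 2 * fst (z :: real \<times> (real ^ 'n))}"
    by (rule subspaceI) (auto simp: sum.distrib sum_distrib_left[symmetric] algebra_simps)
  show "hypersimplex_cone = {z \<in> {z. (\<Sum>k\<in>UNIV. snd z $ k) = 2 * fst (z :: real \<times> (real ^ 'n))}.
      \<forall>x. 0 \<le> model_row unit_weights x (snd z)}"
    by (auto simp: hypersimplex_cone_def)
  show "linear (\<lambda>z :: real \<times> (real ^ 'n). model_row unit_weights x (snd z))" for x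
    using linear_compose[OF linear_snd linear_model_row] by (simp add: o_def)
  show "finite (edges (UNIV :: 'n set))" by (simp add: finite_edges)
  show "(1, edge_vector unit_weights e) \<in> hypersimplex_cone" if "e \<in> edges UNIV" for e :: "'n set"
    using that model_row_edge_vector(1)[OF reciprocal_unit_weights]
    by (auto simp: hypersimplex_cone_def sum_edge_vector_unit_weights)
next
  fix z :: "real \<times> (real ^ 'n)" assume z: "z \<in> hypersimplex_cone"
  then obtain c where c: "\<forall>e. 0 \<le> c e" "snd z = (\<Sum>e\<in>edges UNIV. c e *\<^sub>R edge_vector unit_weights e)"
    using model_cone_generated[OF reciprocal_unit_weights, of "snd z"] by (auto simp: hypersimplex_cone_def)
  \<comment> \<open>Coefficients representing the second component also represent the first: it is
    half the coordinate sum, and every edge vector has coordinate sum 2.\<close>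
  have "2 * fst z = (\<Sum>k\<in>UNIV. snd z $ k)" using z by (simp add: hypersimplex_cone_def)
  also have "\<dots> = (\<Sum>e\<in>edges UNIV. c e * (\<Sum>k\<in>UNIV. edge_vector unit_weights e $ k))"
    unfolding c(2) by (simp add: sum_distrib_left) (rule sum.swap)
  also have "\<dots> = 2 * (\<Sum>e\<in>edges UNIV. c e)"
    by (simp add: sum_edge_vector_unit_weights sum_distrib_left mult.commute)
  finally have "fst z = (\<Sum>e\<in>edges UNIV. c e)" by simp
  then have "z = (\<Sum>e\<in>edges UNIV. c e *\<^sub>R (1, edge_vector unit_weights e))"
    using c(2) by (simp add: prod_eq_iff fst_sum snd_sum)
  with c(1) show "\<exists>c. (\<forall>e. 0 \<le> c e) \<and> z = (\<Sum>e\<in>edges UNIV. c e *\<^sub>R (1, edge_vector unit_weights e))" by blast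
qed

lemma hypersimplex_two_subset:
  assumes "x \<in> hypersimplex 2"
  shows "(\<Sum>k\<in>UNIV. x $ k) = 2" "0 \<le> x $ k" "x $ k \<le> 1"
proof -
  let ?B = "{x :: real ^ 'a. (\<Sum>k\<in>UNIV. x $ k) = 2 \<and> (\<forall>k. 0 \<le> x $ k \<and> x $ k \<le> 1)}"
  have "convex ?B"
    unfolding convex_alt
    by (auto simp: sum.distrib sum_distrib_left[symmetric] intro!: convex_bound_le add_nonneg_nonneg)
  moreover have "{x :: real ^ 'a. (\<forall>i. x $ i = 0 \<or> x $ i = 1) \<and> (\<Sum>i\<in>UNIV. x $ i) = real 2} \<subseteq> ?B"
    by auto (metis order_refl zero_le_one)+
  ultimately have "hypersimplex 2 \<subseteq> ?B" unfolding hypersimplex_def by (rule hull_minimal[rotated])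
  with assms show "(\<Sum>k\<in>UNIV. x $ k) = 2" "0 \<le> x $ k" "x $ k \<le> 1" by auto
qed

lemma edge_vector_in_hypersimplex:
  "e \<in> edges UNIV \<Longrightarrow> edge_vector unit_weights e \<in> hypersimplex 2"
  unfolding hypersimplex_def
  using sum_edge_vector_unit_weights[of e] by (intro hull_inc) (auto simp: edge_vector_unit_weights)

lemma Pair_hypersimplex_in_cone:
  "x \<in> hypersimplex 2 \<Longrightarrow> (1, x) \<in> hypersimplex_cone"
proof -
  assume x: "x \<in> hypersimplex 2"
  have "0 \<le> model_row unit_weights r x" for r
    using hypersimplex_two_subset[OF x] by (cases r) (simp_all add: model_row_unit_weights del: model_row.simps(1))
  then show ?thesis using hypersimplex_two_subset(1)[OF x] by (simp add: hypersimplex_cone_def)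
qed

lemma homogenization_hypersimplex: "homogenization (hypersimplex 2) = hypersimplex_cone"
proof -
  have "convex_cone hull ({1} \<times> hypersimplex 2) = hypersimplex.sub {}"
    by (rule hypersimplex.convex_cone_hull_eq_sub)
      (auto simp: hypersimplex.sub_def Pair_hypersimplex_in_cone edge_vector_in_hypersimplex)
  then show ?thesis by (simp add: homogenization_def hypersimplex.sub_def)
qed

lemma homogenization_hypersimplex_F: "homogenization (hypersimplex_F 2 k) = hypersimplex.sub {Inr k}"
  unfolding homogenization_def
  by (rule hypersimplex.convex_cone_hull_eq_sub)
    (auto simp: hypersimplex_F_def hypersimplex.sub_def Pair_hypersimplex_in_cone edge_vector_in_hypersimplex)

lemma homogenization_hypersimplex_G: "homogenization (hypersimplex_G 2 k) = hypersimplex.sub {Inl k}"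
  unfolding homogenization_def
  by (rule hypersimplex.convex_cone_hull_eq_sub)
    (auto simp: hypersimplex_G_def hypersimplex.sub_def Pair_hypersimplex_in_cone edge_vector_in_hypersimplex
      model_row_unit_weights hypersimplex_two_subset sum_edge_vector_unit_weights simp del: model_row.simps(1))

definition f_coordinates :: "real ^ ('n + 'n) ^ 'n::finite \<Rightarrow> real ^ 'n \<Rightarrow> real ^ 'n" where
  "f_coordinates A y = (\<chi> k. column (Inr k) A \<bullet> y)"

text \<open>The factors \<gamma> record the scale of the \<open>Inl\<close> columns, while the scale
  of the \<open>Inr\<close> columns is absorbed into the weights. No representative of the orbit is
  singled out, so a given matrix can be perturbed directly.\<close>

definition normal_form :: "real ^ ('n + 'n) ^ 'n::finite \<Rightarrow> ('n \<Rightarrow> 'n \<Rightarrow> real) \<Rightarrow> ('n \<Rightarrow> real) \<Rightarrow> bool" where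
  "normal_form A a \<gamma> \<longleftrightarrow> inj (f_coordinates A) \<and> reciprocal a \<and> (\<forall>k. 0 < \<gamma> k) \<and>
     (\<forall>k. column (Inl k) A =
       \<gamma> k *\<^sub>R ((\<Sum>j\<in>UNIV - {k}. a k j *\<^sub>R column (Inr j) A) - column (Inr k) A))"

lemma linear_f_coordinates: "linear (f_coordinates A)"
  by (rule linearI) (simp_all add: f_coordinates_def vec_eq_iff inner_add_right)

lemma bij_f_coordinates: "inj (f_coordinates A) \<Longrightarrow> bij (f_coordinates A)"
  using linear_injective_imp_surjective[OF linear_f_coordinates] by (simp add: bij_def)

lemma column_inner_normal_form:
  assumes "normal_form A a \<gamma>"
  shows "column x A \<bullet> y = (case x of Inl k \<Rightarrow> \<gamma> k | Inr _ \<Rightarrow> 1) * model_row a x (f_coordinates A y)"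
proof (cases x)
  case (Inl k)
  have "column (Inl k) A = \<gamma> k *\<^sub>R ((\<Sum>j\<in>UNIV - {k}. a k j *\<^sub>R column (Inr j) A) - column (Inr k) A)"
    using assms by (auto simp: normal_form_def)
  then show ?thesis using Inl by (simp add: inner_diff_left inner_sum_left f_coordinates_def)
next
  case (Inr k)
  then show ?thesis by (simp add: f_coordinates_def)
qed

lemma column_inner_sgn_normal_form:
  assumes "normal_form A a \<gamma>"
  shows "0 \<le> column x A \<bullet> y \<longleftrightarrow> 0 \<le> model_row a x (f_coordinates A y)"
    and "column x A \<bullet> y = 0 \<longleftrightarrow> model_row a x (f_coordinates A y) = 0"
proof -
  have "0 < (case x of Inl k \<Rightarrow> \<gamma> k | Inr _ \<Rightarrow> 1)"
    using assms by (auto simp: normal_form_def split: sum.splits)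
  then show "0 \<le> column x A \<bullet> y \<longleftrightarrow> 0 \<le> model_row a x (f_coordinates A y)"
    and "column x A \<bullet> y = 0 \<longleftrightarrow> model_row a x (f_coordinates A y) = 0"
    unfolding column_inner_normal_form[OF assms] by (auto simp: zero_le_mult_iff)
qed

lemma matrix_cone_eq: "matrix_cone A = {y. \<forall>x. 0 \<le> column x A \<bullet> y}"
  unfolding matrix_cone_def by (metis (no_types, lifting) sum.exhaust)

lemma generated_cone_normal_form:
  assumes "normal_form A a \<gamma>"
  shows "generated_cone UNIV (\<lambda>x y. model_row a x (f_coordinates A y)) (matrix_cone A) (edges UNIV)
    (\<lambda>e. inv (f_coordinates A) (edge_vector a e))"
proof (rule generated_cone.intro)
  have bij: "bij (f_coordinates A)" and a: "reciprocal a"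
    using assms bij_f_coordinates by (auto simp: normal_form_def)
  have f_inv: "f_coordinates A (inv (f_coordinates A) y) = y" for y
    using bij by (simp add: bij_is_surj surj_f_inv_f)
  show "matrix_cone A = {x \<in> UNIV. \<forall>i. 0 \<le> model_row a i (f_coordinates A x)}"
    by (simp add: matrix_cone_eq column_inner_sgn_normal_form[OF assms])
  note cone = this
  show "linear (\<lambda>y. model_row a x (f_coordinates A y))" for x
    using linear_compose[OF linear_f_coordinates linear_model_row] by (simp add: o_def)
  show "inv (f_coordinates A) (edge_vector a e) \<in> matrix_cone A" if "e \<in> edges UNIV" for e
    using model_row_edge_vector(1)[OF a that] by (simp add: cone f_inv del: model_row.simps)
  fix y assume "y \<in> matrix_cone A"
  then obtain c where c: "\<forall>e. 0 \<le> c e" "f_coordinates A y = (\<Sum>e\<in>edges UNIV. c e *\<^sub>R edge_vector a e)"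
    using model_cone_generated[OF a, of "f_coordinates A y"] by (auto simp: cone)
  have "f_coordinates A (\<Sum>e\<in>edges UNIV. c e *\<^sub>R inv (f_coordinates A) (edge_vector a e)) = f_coordinates A y"
    unfolding c(2) by (simp add: linear_sum[OF linear_f_coordinates] linear_scale[OF linear_f_coordinates] f_inv)
  then have "y = (\<Sum>e\<in>edges UNIV. c e *\<^sub>R inv (f_coordinates A) (edge_vector a e))"
    using bij bij_is_inj inj_eq by metis
  with c(1) show "\<exists>c. (\<forall>e. 0 \<le> c e) \<and> y = (\<Sum>e\<in>edges UNIV. c e *\<^sub>R inv (f_coordinates A) (edge_vector a e))"
    by blast
qed (auto simp: finite_edges)

text \<open>For all reciprocal weights \<open>positive_on\<close> describes the zeros of the rows on
  the edge rays, so the given weights and the unit weights have the same incidences.\<close>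

lemma normal_form_imp_realization:
  assumes "normal_form A a \<gamma>"
  shows "A \<in> realization_matrices 2"
proof -
  have a: "reciprocal a" and surj: "surj (f_coordinates A)"
    using assms bij_f_coordinates bij_is_surj by (auto simp: normal_form_def)
  obtain \<phi> where \<phi>: "face_lattice_iso \<phi> hypersimplex_cone (matrix_cone A)"
    "\<And>x. \<phi> (hypersimplex_cone \<inter> {z. model_row unit_weights x (snd z) = 0}) =
       matrix_cone A \<inter> {y. model_row a x (f_coordinates A y) = 0}"
  proof (rule face_lattice_iso_of_incidence[OF hypersimplex.generated_cone_axioms generated_cone_normal_form[OF assms]])
    show "model_row unit_weights x (snd (1 :: real, edge_vector unit_weights e)) = 0 \<longleftrightarrow>
      model_row a x (f_coordinates A (inv (f_coordinates A) (edge_vector a e))) = 0"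
      if "e \<in> edges UNIV" for e x
      using that model_row_edge_vector(2)[OF a] model_row_edge_vector(2)[OF reciprocal_unit_weights]
      by (simp add: surj_f_inv_f[OF surj] del: model_row.simps)
  qed auto
  have sub: "hypersimplex.sub {x} = hypersimplex_cone \<inter> {z. model_row unit_weights x (snd z) = 0}" for x :: "'a + 'a"
    by (auto simp: hypersimplex.sub_def)
  show ?thesis
    unfolding realization_matrices_def
    using \<phi> by (auto simp: homogenization_hypersimplex homogenization_hypersimplex_F homogenization_hypersimplex_G
        sub column_inner_sgn_normal_form(2)[OF assms] simp del: model_row.simps intro!: exI[of _ \<phi>])
qed

text \<open>Only an isomorphism of face posets is given, so the rays have to be recovered from it: a
  point in the image of a ray but outside the image of the apex has the zeros prescribed by the
  edge.\<close>

lemma realization_edge_vectors: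
  fixes A :: "real ^ ('n + 'n) ^ 'n::finite"
  assumes A: "A \<in> realization_matrices 2"
  obtains v :: "'n set \<Rightarrow> real ^ 'n" where "\<And>x e. e \<in> edges UNIV \<Longrightarrow> 0 \<le> column x A \<bullet> v e"
    "\<And>x e. e \<in> edges UNIV \<Longrightarrow> column x A \<bullet> v e = 0 \<longleftrightarrow> \<not> positive_on x e"
proof -
  let ?C = "hypersimplex_cone :: (real \<times> (real ^ 'n)) set"
  let ?K = "matrix_cone A"
  obtain \<phi> where iso: "face_lattice_iso \<phi> ?C ?K"
    and \<phi>_row: "\<And>x. \<phi> (hypersimplex.sub {x}) = ?K \<inter> {y. column x A \<bullet> y = 0}"
  proof -
    obtain \<phi> where "face_lattice_iso \<phi> ?C ?K"
      "\<And>i. \<phi> (hypersimplex.sub {Inl i}) = ?K \<inter> {y. column (Inl i) A \<bullet> y = 0}"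
      "\<And>i. \<phi> (hypersimplex.sub {Inr i}) = ?K \<inter> {y. column (Inr i) A \<bullet> y = 0}"
      using A by (auto simp: realization_matrices_def homogenization_hypersimplex
          homogenization_hypersimplex_F homogenization_hypersimplex_G)
    then show ?thesis by (metis that sum.exhaust)
  qed
  have face: "hypersimplex.sub J face_of ?C" for J by (rule hypersimplex.sub_face)
  have mono: "F \<subseteq> F' \<longleftrightarrow> \<phi> F \<subseteq> \<phi> F'" if "F face_of ?C" "F' face_of ?C" for F F'
    using iso that by (auto simp: face_lattice_iso_def)
  have bij: "bij_betw \<phi> {F. F face_of ?C} {F. F face_of ?K}" using iso by (simp add: face_lattice_iso_def)
  have sub_iff: "hypersimplex.sub J \<subseteq> (hypersimplex.sub K :: (real \<times> (real ^ 'n)) set) \<longleftrightarrow>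
      (\<forall>e\<in>edges UNIV. (\<forall>x\<in>J. \<not> positive_on x e) \<longrightarrow> (\<forall>x\<in>K. \<not> positive_on x e))" for J K
    unfolding hypersimplex.sub_subset_iff snd_conv
    by (rule ball_cong[OF refl])
      (simp add: model_row_edge_vector(2)[OF reciprocal_unit_weights] del: model_row.simps)
  have "\<exists>v. \<forall>x. 0 \<le> column x A \<bullet> v \<and> (column x A \<bullet> v = 0 \<longleftrightarrow> \<not> positive_on x e)"
    if e: "e \<in> edges UNIV" for e
  proof -
    let ?R = "hypersimplex.sub (Inr ` (- e)) :: (real \<times> (real ^ 'n)) set"
    let ?Z = "hypersimplex.sub UNIV :: (real \<times> (real ^ 'n)) set"
    have only_e: "e' = e" if "e' \<in> edges UNIV" "\<forall>x\<in>Inr ` (- e). \<not> positive_on x e'" for e'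
    proof -
      have "e' \<subseteq> e" using that(2) by auto
      then show ?thesis using that(1) e card_subset_eq[of e e'] by (simp add: edges_def)
    qed
    have R_sub: "?R \<subseteq> hypersimplex.sub K \<longleftrightarrow> (\<forall>x\<in>K. \<not> positive_on x e)" for K
      unfolding sub_iff using only_e e by auto
    obtain i where "i \<in> e" using e by (auto elim: edgeE)
    then have "\<not> ?R \<subseteq> ?Z" unfolding R_sub by (metis UNIV_I positive_on.simps(2))
    then have "\<not> \<phi> ?R \<subseteq> \<phi> ?Z" using mono[OF face face] by blast
    then obtain v where v: "v \<in> \<phi> ?R" "v \<notin> \<phi> ?Z" by blast
    have \<phi>_face: "\<phi> F face_of ?K" if "F face_of ?C" for F using bij that by (auto dest: bij_betwE)
    have vK: "v \<in> ?K" using v(1) \<phi>_face[OF face] face_of_imp_subset by blast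
    have "column x A \<bullet> v = 0 \<longleftrightarrow> \<not> positive_on x e" for x
    proof
      assume "\<not> positive_on x e"
      then have "?R \<subseteq> hypersimplex.sub {x}" unfolding R_sub by simp
      then have "\<phi> ?R \<subseteq> \<phi> (hypersimplex.sub {x})" using mono[OF face face] by blast
      then show "column x A \<bullet> v = 0" using v(1) by (auto simp: \<phi>_row)
    next
      assume 0: "column x A \<bullet> v = 0"
      show "\<not> positive_on x e"
      proof
        assume pos: "positive_on x e"
        \<comment> \<open>A facet not containing the ray meets it only in the apex. Pulling the
          intersection of the images back through \<phi> transfers this to the cone of
          \<open>A\<close>.\<close>
        have "\<phi> ?R \<inter> \<phi> (hypersimplex.sub {x}) face_of ?K"
          by (intro face_of_Int \<phi>_face face)
        then obtain F where F: "F face_of ?C" "\<phi> F = \<phi> ?R \<inter> \<phi> (hypersimplex.sub {x})"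
          using bij by (metis (mono_tags, lifting) bij_betw_imp_surj_on imageE mem_Collect_eq)
        then have "F \<subseteq> ?R" "F \<subseteq> hypersimplex.sub {x}" using mono[OF F(1) face] by auto
        then have "F \<subseteq> hypersimplex.sub (insert x (Inr ` (- e)))" by (auto simp: hypersimplex.sub_def)
        also have "\<dots> \<subseteq> ?Z"
          unfolding sub_iff using only_e pos by (metis insert_iff)
        finally have "\<phi> F \<subseteq> \<phi> ?Z" using mono[OF F(1) face] by blast
        moreover have "v \<in> \<phi> F" using v(1) vK 0 by (simp add: F(2) \<phi>_row)
        ultimately show False using v(2) by blast
      qed
    qed
    then show ?thesis using vK by (auto simp: matrix_cone_eq)
  qed
  then obtain v where "\<And>e x. e \<in> edges UNIV \<Longrightarrow> 0 \<le> column x A \<bullet> v e \<and> (column x A \<bullet> v e = 0 \<longleftrightarrow> \<not> positive_on x e)"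
    by metis
  then show ?thesis using that by blast
qed

text \<open>Along each edge the two values of \<open>c\<close> are both zero or of opposite signs,
  and three numbers cannot have pairwise opposite signs. This gives the independence of the columns
  \<open>f_k\<close> and later reduces the rank condition to the weights.\<close>

lemma edge_functional_vanishes:
  fixes c :: "'n \<Rightarrow> real"
  assumes V: "3 \<le> card V" and p: "\<And>i e. e \<in> edges V \<Longrightarrow> i \<in> e \<Longrightarrow> 0 < p i e"
    and c: "\<And>e. e \<in> edges V \<Longrightarrow> (\<Sum>i\<in>e. c i * p i e) = 0" and k: "k \<in> V"
  shows "c k = 0"
proof -
  have opp: "c i = 0 \<and> c j = 0 \<or> c i < 0 \<and> 0 < c j \<or> 0 < c i \<and> c j < 0" if "i \<in> V" "j \<in> V" "i \<noteq> j" for i j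
  proof -
    have e: "{i, j} \<in> edges V" using that by (simp add: doubleton_edge)
    have eq: "c i * p i {i, j} + c j * p j {i, j} = 0" using c[OF e] that by simp
    have pos: "0 < p i {i, j}" "0 < p j {i, j}" using p[OF e] by auto
    consider "c i = 0" | "0 < c i" | "c i < 0" by linarith
    then show ?thesis
    proof cases
      case 1 then show ?thesis using eq pos by simp
    next
      case 2
      then have "0 < c i * p i {i, j}" using pos by simp
      then have "c j * p j {i, j} < 0" using eq by linarith
      then show ?thesis using 2 pos by (auto simp: mult_less_0_iff)
    next
      case 3
      then have "c i * p i {i, j} < 0" using pos by (simp add: mult_less_0_iff)
      then have "0 < c j * p j {i, j}" using eq by linarith
      then show ?thesis using 3 pos by (auto simp: zero_less_mult_iff)
    qed
  qed
  have "\<exists>i\<in>V. i \<noteq> k \<and> i \<noteq> j" for j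
  proof (rule ccontr)
    assume "\<not> ?thesis"
    then have "V \<subseteq> {k, j}" by auto
    then have "card V \<le> card {k, j}" by (intro card_mono) auto
    also have "\<dots> \<le> 2" by (simp add: card_insert_if)
    finally show False using V by simp
  qed
  then obtain i j where "i \<in> V" "i \<noteq> k" "j \<in> V" "j \<noteq> k" "j \<noteq> i" by metis
  then show ?thesis using opp[of k i] opp[of k j] opp[of i j] k by auto
qed

text \<open>Each \<open>g_i\<close> is expanded in the basis of the \<open>f_j\<close>. Its
  vanishing on the rays of the edges \<open>{i, j}\<close> fixes the ratios of the coefficients, and
  its positivity on an edge avoiding \<open>i\<close> fixes their signs.\<close>

lemma realization_imp_normal_form:
  fixes A :: "real ^ ('n + 'n) ^ 'n::finite"
  assumes A: "A \<in> realization_matrices 2" and n: "3 \<le> CARD('n)"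
  obtains a :: "'n \<Rightarrow> 'n \<Rightarrow> real" and \<gamma> where "normal_form A a \<gamma>"
proof -
  obtain v where v: "\<And>x e. e \<in> edges UNIV \<Longrightarrow> 0 \<le> column x A \<bullet> v e"
    "\<And>x e. e \<in> edges UNIV \<Longrightarrow> column x A \<bullet> v e = 0 \<longleftrightarrow> \<not> positive_on x e"
    using realization_edge_vectors[OF A] by blast
  let ?f = "\<lambda>k. column (Inr k) A" and ?g = "\<lambda>k. column (Inl k) A"
  define p where "p k e = ?f k \<bullet> v e" for k e
  have p_pos: "0 < p k e" if "e \<in> edges UNIV" "k \<in> e" for k e
    using v(1)[OF that(1), of "Inr k"] v(2)[OF that(1), of "Inr k"] that by (simp add: p_def order_less_le)
  have p_zero: "p k e = 0" if "e \<in> edges UNIV" "k \<notin> e" for k e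
    using v(2)[OF that(1), of "Inr k"] that by (simp add: p_def)
  define M :: "real ^ 'n ^ 'n" where "M = (\<chi> i k. ?f k $ i)"
  have M: "M *v c = (\<Sum>k\<in>UNIV. c $ k *\<^sub>R ?f k)" for c
    by (simp add: M_def matrix_vector_mult_def vec_eq_iff mult.commute)
  have comb: "(M *v c) \<bullet> v e = (\<Sum>k\<in>e. c $ k * p k e)" if e: "e \<in> edges UNIV" for c e
  proof -
    have "(M *v c) \<bullet> v e = (\<Sum>k\<in>UNIV. c $ k * p k e)" by (simp add: M inner_sum_left p_def)
    also have "\<dots> = (\<Sum>k\<in>e. c $ k * p k e)"
      by (rule sum.mono_neutral_right) (use p_zero[OF e] in auto)
    finally show ?thesis .
  qed
  have "inj ((*v) M)"
  proof (subst linear_injective_0)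
    show "linear ((*v) M)" by simp
    show "\<forall>c. M *v c = 0 \<longrightarrow> c = 0"
    proof (intro allI impI)
      fix c assume 0: "M *v c = 0"
      have "c $ k = 0" for k
        by (rule edge_functional_vanishes[of UNIV p "\<lambda>k. c $ k"])
          (use n p_pos comb[of _ c] 0 in auto)
      then show "c = 0" by (simp add: vec_eq_iff)
    qed
  qed
  then have inv: "invertible M" by (simp add: invertible_left_inverse matrix_left_invertible_injective)
  have "f_coordinates A = (*v) (transpose M)"
    by (rule ext) (simp add: f_coordinates_def M_def vec_eq_iff matrix_vector_mult_def transpose_def inner_vec_def)
  then have inj_f: "inj (f_coordinates A)"
    using transpose_invertible[OF inv] by (simp add: invertible_left_inverse matrix_left_invertible_injective)
  have "\<exists>c. ?g i = M *v c" for i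
    using inv by (metis invertible_def matrix_vector_mul_assoc matrix_vector_mul_lid)
  then obtain G where G: "\<And>i. ?g i = M *v G i" by metis
  have edge_UNIV: "{i, j} \<in> edges UNIV" if "i \<noteq> j" for i j :: 'n using that by (simp add: doubleton_edge)
  have Gij: "G i $ i * p i {i, j} + G i $ j * p j {i, j} = 0" if "i \<noteq> j" for i j
    using v(2)[OF edge_UNIV[OF that], of "Inl i"] comb[OF edge_UNIV[OF that], of "G i"] G[of i] that by simp
  \<comment> \<open>If this coefficient were nonnegative, the relations on the edges at
    \<open>i\<close> would make all others nonpositive, and \<open>g_i\<close> could not be positive
    on the ray of an edge away from \<open>i\<close>.\<close>
  have Gii: "G i $ i < 0" for i
  proof (rule ccontr)
    assume "\<not> ?thesis"
    then have "G i $ i \<ge> 0" by simp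
    have neg: "G i $ j \<le> 0" if "i \<noteq> j" for j
    proof -
      have "0 \<le> G i $ i * p i {i, j}" using \<open>G i $ i \<ge> 0\<close> p_pos[OF edge_UNIV[OF that], of i] by simp
      then have "G i $ j * p j {i, j} \<le> 0" using Gij[OF that] by linarith
      then show ?thesis using p_pos[OF edge_UNIV[OF that], of j] by (auto simp: mult_le_0_iff)
    qed
    have "\<exists>j k. j \<noteq> i \<and> k \<noteq> i \<and> j \<noteq> k"
    proof (rule ccontr)
      assume no: "\<not> ?thesis"
      have "card (UNIV - {i}) \<le> Suc 0" using no by (subst card_le_Suc0_iff_eq) auto
      then show False using n by simp
    qed
    then obtain j k where jk: "j \<noteq> i" "k \<noteq> i" "j \<noteq> k" by blast
    have "0 < ?g i \<bullet> v {j, k}"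
      using v(1)[OF edge_UNIV[OF jk(3)], of "Inl i"] v(2)[OF edge_UNIV[OF jk(3)], of "Inl i"] jk
      by (simp add: order_less_le)
    also have "?g i \<bullet> v {j, k} = G i $ j * p j {j, k} + G i $ k * p k {j, k}"
      using comb[OF edge_UNIV[OF jk(3)], of "G i"] G[of i] jk by simp
    also have "\<dots> \<le> 0"
      using neg jk p_pos[OF edge_UNIV[OF jk(3)]] by (intro add_nonpos_nonpos mult_nonpos_nonneg) (auto intro: less_imp_le)
    finally show False by simp
  qed
  \<comment> \<open>The weights are quotients of the two coordinates of one ray, so exchanging
    \<open>i\<close> and \<open>j\<close> inverts them.\<close>
  define a where "a i j = p i {i, j} / p j {i, j}" for i j
  have "reciprocal a"
    unfolding reciprocal_def a_def
  proof (intro allI impI)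
    fix i j :: 'n assume "i \<noteq> j"
    then show "0 < p i {i, j} / p j {i, j} \<and> p i {i, j} / p j {i, j} * (p j {j, i} / p i {j, i}) = 1"
      using p_pos[OF edge_UNIV, of i j i] p_pos[OF edge_UNIV, of i j j] by (simp add: insert_commute)
  qed
  moreover have "?g i = (- G i $ i) *\<^sub>R ((\<Sum>j\<in>UNIV - {i}. a i j *\<^sub>R ?f j) - ?f i)" for i
  proof -
    have "G i $ j = (- G i $ i) * a i j" if "j \<noteq> i" for j
      using Gij[of i j] p_pos[OF edge_UNIV, of i j j] that by (simp add: a_def field_simps)
    then have "(\<Sum>j\<in>UNIV - {i}. G i $ j *\<^sub>R ?f j) = (- G i $ i) *\<^sub>R (\<Sum>j\<in>UNIV - {i}. a i j *\<^sub>R ?f j)"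
      by (simp add: scaleR_sum_right)
    moreover have "?g i = G i $ i *\<^sub>R ?f i + (\<Sum>j\<in>UNIV - {i}. G i $ j *\<^sub>R ?f j)"
      unfolding G[of i] M by (rule sum.remove) auto
    ultimately show ?thesis by (simp add: scaleR_right_diff_distrib)
  qed
  ultimately have "normal_form A a (\<lambda>i. - G i $ i)"
    using inj_f Gii by (auto simp: normal_form_def)
  then show ?thesis using that by blast
qed

section \<open>Extension complexity for generic weights\<close>

text \<open>The first condition makes the \<open>2 * 2\<close> minors of the slack matrix with rows \<open>Inr i\<close>, \<open>Inl k\<close>
  and columns \<open>{i, j}\<close>, \<open>{i, m}\<close> nonzero; the second makes the \<open>Inl\<close> rows independent on the
  face with index set \<open>V\<close>.\<close>

definition generic_weights :: "('n::finite \<Rightarrow> 'n \<Rightarrow> real) \<Rightarrow> bool" where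
  "generic_weights a \<longleftrightarrow>
     (\<forall>i j k m. distinct [i, j, k, m] \<longrightarrow> a k j * a j i \<noteq> a k m * a m i) \<and>
     (\<forall>V c k. 6 \<le> card V \<longrightarrow> (\<forall>j\<in>V. (\<Sum>k\<in>V. c k * (if k = j then -1 else a k j)) = 0) \<longrightarrow>
        k \<in> V \<longrightarrow> c k = 0)"

text \<open>After removal of the common factors \<open>sqrt (a i j)\<close> and
  \<open>sqrt (a i m)\<close>, the summand \<open>a k i\<close> cancels and the minor becomes
  \<open>a k m * a m i - a k j * a j i\<close>.\<close>

lemma model_row_minor:
  assumes a: "reciprocal a" "generic_weights a" and d: "distinct [i, j, k, m]"
  shows "model_row a (Inr i) (edge_vector a {i, j}) * model_row a (Inl k) (edge_vector a {i, m}) \<noteq>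
    model_row a (Inr i) (edge_vector a {i, m}) * model_row a (Inl k) (edge_vector a {i, j})"
proof
  assume eq: "model_row a (Inr i) (edge_vector a {i, j}) * model_row a (Inl k) (edge_vector a {i, m}) =
    model_row a (Inr i) (edge_vector a {i, m}) * model_row a (Inl k) (edge_vector a {i, j})"
  have row: "model_row a (Inl k) (edge_vector a {i, q}) = sqrt (a i q) * (a k i + a k q * a q i)"
    if "distinct [i, q, k]" for q
    using that reciprocal_sqrt[OF a(1), of q i]
    by (auto simp: model_row_edge_vector_doubleton algebra_simps simp del: model_row.simps)
  have "sqrt (a i j) * (sqrt (a i m) * (a k i + a k m * a m i)) = sqrt (a i m) * (sqrt (a i j) * (a k i + a k j * a j i))"
    using eq d row[of j] row[of m] by (auto simp: edge_vector_doubleton simp del: model_row.simps(1))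
  moreover have "0 < a i j" "0 < a i m" using a(1) d by (auto simp: reciprocal_def)
  ultimately have "a k m * a m i = a k j * a j i" by simp
  then show False using a(2) d unfolding generic_weights_def by metis
qed

text \<open>A combination of \<open>Inl\<close> rows is a linear functional with coefficients
  \<open>d\<close>. On the edges of \<open>V\<close> only the coefficients in \<open>V\<close>
  enter, and the sign argument on triangles makes these vanish; for generic weights this linear
  system has only the zero solution.\<close>

lemma model_row_rank:
  fixes c :: "'n::finite \<Rightarrow> real"
  assumes a: "reciprocal a" "generic_weights a" and V: "6 \<le> card V"
    and c: "\<And>e. e \<in> edges V \<Longrightarrow> (\<Sum>k\<in>V. c k * model_row a (Inl k) (edge_vector a e)) = 0"
    and k: "k \<in> V"
  shows "c k = 0"
proof -
  define d where "d i = (\<Sum>k\<in>V. c k * (if k = i then -1 else a k i))" for i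
  have "d i = 0" if "i \<in> V" for i
  proof (rule edge_functional_vanishes[of V "\<lambda>i e. edge_vector a e $ i" d])
    show "0 < edge_vector a e $ i" if "e \<in> edges V" "i \<in> e" for i e
      using model_row_edge_vector[OF a(1) in_edges_UNIV[OF that(1)], of "Inr i"] that(2)
      by (simp add: order_less_le)
    fix e assume e: "e \<in> edges V"
    have row: "model_row a (Inl k) (edge_vector a e) = (\<Sum>i\<in>e. (if k = i then -1 else a k i) * edge_vector a e $ i)" for k
    proof -
      let ?y = "edge_vector a e"
      have "(\<Sum>i\<in>e. (if k = i then -1 else a k i) * ?y $ i) = (\<Sum>i\<in>UNIV. (if k = i then -1 else a k i) * ?y $ i)"
        by (rule sum.mono_neutral_left) (auto simp: edge_vector_def)
      also have "\<dots> = - ?y $ k + (\<Sum>i\<in>UNIV - {k}. (if k = i then -1 else a k i) * ?y $ i)"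
        by (subst sum.remove[of UNIV k]) auto
      also have "(\<Sum>i\<in>UNIV - {k}. (if k = i then -1 else a k i) * ?y $ i) = (\<Sum>i\<in>UNIV - {k}. a k i * ?y $ i)"
        by (intro sum.cong) auto
      finally show ?thesis by simp
    qed
    have "(\<Sum>i\<in>e. d i * edge_vector a e $ i)
        = (\<Sum>i\<in>e. \<Sum>k\<in>V. c k * ((if k = i then -1 else a k i) * edge_vector a e $ i))"
      by (simp add: d_def sum_distrib_right mult.assoc)
    also have "\<dots> = (\<Sum>k\<in>V. c k * model_row a (Inl k) (edge_vector a e))"
      unfolding row sum_distrib_left by (rule sum.swap)
    finally show "(\<Sum>i\<in>e. d i * edge_vector a e $ i) = 0" using c[OF e] by simp
  qed (use V that in auto)
  with a(2) V k show ?thesis unfolding generic_weights_def d_def by blast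
qed

section \<open>Extension complexity of a normal form and of its orbit\<close>

lemma homogenization_eq:
  assumes "convex P" "P \<noteq> {}"
  shows "homogenization P = {z. \<exists>p\<in>P. \<exists>c\<ge>0. z = c *\<^sub>R (1, p)}"
proof -
  have "convex ({1 :: real} \<times> P)" using assms(1) by (intro convex_Times) auto
  then have "convex hull ({1 :: real} \<times> P) = {1} \<times> P" by (rule hull_same)
  moreover have "{1 :: real} \<times> P \<noteq> {}" using assms(2) by simp
  ultimately have "homogenization P = (\<Union>x\<in>{1} \<times> P. \<Union>c\<in>{0..}. {c *\<^sub>R x})"
    unfolding homogenization_def using convex_cone_hull_convex_hull_nonempty by metis
  then show ?thesis by auto
qed

lemma affine_hull_homogenization:
  assumes "x \<in> affine hull P"
  shows "(1, x) \<in> span (homogenization P)"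
proof -
  have "affine {x. (1, x) \<in> span (homogenization P)}"
    unfolding affine_alt
  proof (intro ballI allI)
    fix x y and t :: real
    assume "x \<in> {x. (1, x) \<in> span (homogenization P)}" "y \<in> {x. (1, x) \<in> span (homogenization P)}"
    then have "(1 - t) *\<^sub>R (1, x) + t *\<^sub>R (1, y) \<in> span (homogenization P)"
      by (intro span_add span_scale) auto
    then show "(1 - t) *\<^sub>R x + t *\<^sub>R y \<in> {x. (1, x) \<in> span (homogenization P)}" by simp
  qed
  moreover have "P \<subseteq> {x. (1, x) \<in> span (homogenization P)}"
    unfolding homogenization_def by (auto intro!: span_base hull_inc)
  ultimately have "affine hull P \<subseteq> {x. (1, x) \<in> span (homogenization P)}" by (intro hull_minimal)
  with assms show ?thesis by blast
qed

text \<open>The rows of the cone pull back to affine functionals on \<open>P\<close>, whose values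
  at the points \<open>p e\<close> form the slack matrix up to positive column factors
  \<open>t e\<close>. For the upper bound \<open>P\<close> is its own extension: within its affine
  hull it is cut out by these \<open>2n\<close> functionals.\<close>

theorem extension_complexity_normal_form:
  fixes A :: "real ^ ('n + 'n) ^ 'n::finite" and P :: "(real ^ 'n) set"
  assumes A: "normal_form A a \<gamma>" and gen: "generic_weights a" and n: "5 \<le> CARD('n)"
    and P: "polytope P" "linearly_isomorphic (homogenization P) (matrix_cone A)"
  shows "extension_complexity P = 2 * CARD('n)"
proof -
  interpret K: generated_cone UNIV "\<lambda>x y. model_row a x (f_coordinates A y)" "matrix_cone A" "edges UNIV"
    "\<lambda>e. inv (f_coordinates A) (edge_vector a e)"
    by (rule generated_cone_normal_form[OF A])
  have a: "reciprocal a" using A by (simp add: normal_form_def)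
  have inj_A: "inj (f_coordinates A)" using A by (simp add: normal_form_def)
  note f_inv = surj_f_inv_f[OF bij_is_surj[OF bij_f_coordinates[OF inj_A]]]
  let ?w = "\<lambda>e. inv (f_coordinates A) (edge_vector a e)"
  have cP: "convex P" using P(1) by (rule polytope_imp_convex)
  obtain L where L: "linear L" "inj_on L (span (homogenization P))" "L ` homogenization P = matrix_cone A"
    using P(2) by (auto simp: linearly_isomorphic_def)
  define u where "u x p = model_row a x (f_coordinates A (L (1, p)))" for x p
  have row_L: "linear (\<lambda>z. model_row a x (f_coordinates A (L z)))" for x
    using linear_compose[OF L(1) K.linear_u] by (simp add: o_def)
  have affine_u: "affine_functional (u x)" for x
  proof -
    have "linear (\<lambda>p :: real ^ 'n. (0 :: real, p))" by (rule linearI) auto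
    from linear_compose[OF this row_L[of x]]
    have "linear (\<lambda>p. model_row a x (f_coordinates A (L (0, p))))" by (simp add: o_def)
    moreover have "u x p = model_row a x (f_coordinates A (L (0, p))) + model_row a x (f_coordinates A (L (1, 0)))" for p
      using linear_add[OF row_L[of x], of "(0, p)" "(1, 0)"] by (simp add: u_def del: model_row.simps)
    ultimately show ?thesis unfolding affine_functional_def fun_eq_iff by blast
  qed
  have P_hom: "(1, p) \<in> homogenization P" if "p \<in> P" for p
    unfolding homogenization_def using that by (intro hull_inc) auto
  have u_nonneg: "0 \<le> u x p" if "p \<in> P" for x p
    using L(3) P_hom[OF that] K.C by (auto simp: u_def)
  have w_ne: "?w e \<noteq> 0" if e: "e \<in> edges UNIV" for e
  proof
    assume "?w e = 0"
    then have "edge_vector a e = 0" using f_inv[of "edge_vector a e"] linear_0[OF linear_f_coordinates, of A] by metis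
    moreover obtain i where "i \<in> e" using e by (auto elim: edgeE)
    ultimately show False using model_row_edge_vector(2)[OF a e, of "Inr i"] by simp
  qed
  have "2 \<le> CARD('n)" using n by simp
  then obtain e0 :: "'n set" where "card e0 = 2" by (rule obtain_subset_with_card_n)
  then have e0: "e0 \<in> edges UNIV" by (simp add: edges_def)
  have P_ne: "P \<noteq> {}"
  proof
    assume "P = {}"
    then have "homogenization P = {0}" by (simp add: homogenization_def)
    then have "matrix_cone A = {0}" using L(3) linear_0[OF L(1)] by auto
    then show False using K.w[OF e0] w_ne[OF e0] by simp
  qed
  have "\<exists>p t. p \<in> P \<and> 0 < t \<and> ?w e = t *\<^sub>R L (1, p)" if e: "e \<in> edges UNIV" for e
  proof -
    obtain z where z: "z \<in> homogenization P" "?w e = L z" using K.w[OF e] L(3) by (metis imageE)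
    then obtain p t where "p \<in> P" "0 \<le> t" "z = t *\<^sub>R (1, p)" using homogenization_eq[OF cP P_ne] by auto
    then have "?w e = t *\<^sub>R L (1, p)" using z linear_scale[OF L(1)] by metis
    then have "t \<noteq> 0" using w_ne[OF e] by auto
    with \<open>p \<in> P\<close> \<open>0 \<le> t\<close> \<open>?w e = t *\<^sub>R L (1, p)\<close> show ?thesis by (auto simp: order_less_le)
  qed
  then obtain p t where pt: "\<And>e. e \<in> edges UNIV \<Longrightarrow> p e \<in> P" "\<And>e. e \<in> edges UNIV \<Longrightarrow> 0 < t e"
    "\<And>e. e \<in> edges UNIV \<Longrightarrow> ?w e = t e *\<^sub>R L (1, p e)" by metis
  have row_w: "model_row a x (edge_vector a e) = t e * u x (p e)" if e: "e \<in> edges UNIV" for x e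
  proof -
    have "model_row a x (edge_vector a e) = model_row a x (f_coordinates A (t e *\<^sub>R L (1, p e)))"
      using pt(3)[OF e] f_inv by metis
    then show ?thesis using linear_scale[OF K.linear_u] by (simp add: u_def del: model_row.simps)
  qed
  have u_zero: "\<exists>p\<in>P. u x p = 0" for x
  proof -
    have "\<exists>e\<in>edges UNIV. \<not> positive_on x e"
    proof (cases x)
      case (Inl k)
      have "card (UNIV - {k}) \<noteq> 0" using n by simp
      then have "UNIV - {k} \<noteq> {}" by (metis card.empty)
      then obtain j where "j \<noteq> k" by blast
      then show ?thesis using Inl by (intro bexI[of _ "{k, j}"]) (auto simp: doubleton_edge)
    next
      case (Inr k)
      have "card (UNIV - {k}) \<ge> 2" using n by simp
      then obtain e where "e \<subseteq> UNIV - {k}" "card e = 2" by (metis obtain_subset_with_card_n)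
      then show ?thesis using Inr by (intro bexI[of _ e]) (auto simp: edges_def)
    qed
    then obtain e where e: "e \<in> edges UNIV" "\<not> positive_on x e" by blast
    then have "t e * u x (p e) = 0" using model_row_edge_vector(2)[OF a e(1), of x] row_w[OF e(1), of x] by simp
    then show ?thesis using pt(1,2)[OF e(1)] by auto
  qed
  obtain I :: "(nat \<Rightarrow>\<^sub>0 real) set set" and l h where fac: "finite I" "card I = extension_complexity P"
    "\<And>x H. 0 \<le> l x H" "\<And>H p. p \<in> P \<Longrightarrow> 0 \<le> h H p" "\<And>x p. p \<in> P \<Longrightarrow> u x p = (\<Sum>H\<in>I. l x H * h H p)"
  proof (rule extension_complexity_factorization[of P u])
    show "polytope P" by (rule P(1))
    show "affine_functional (u x)" for x by (rule affine_u)
    show "0 \<le> u x q" if "q \<in> P" for x q using that by (rule u_nonneg)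
    show "\<exists>q\<in>P. u x q = 0" for x by (rule u_zero)
  qed (rule that)
  have "slack_factorization (\<lambda>x e. model_row a x (edge_vector a e)) I l (\<lambda>H e. t e * h H (p e))"
  proof (rule slack_factorization.intro)
    show "model_row a x (edge_vector a e) = (\<Sum>H\<in>I. l x H * (t e * h H (p e)))" if e: "e \<in> edges UNIV" for x e
      unfolding row_w[OF e] fac(5)[OF pt(1)[OF e]] by (simp add: sum_distrib_left mult.left_commute)
    show "0 \<le> t e * h H (p e)" if "H \<in> I" "e \<in> edges UNIV" for H e
      using fac(4)[OF pt(1)[OF that(2)]] pt(2)[OF that(2)] by simp
  qed (use fac(1,3) model_row_edge_vector(2)[OF a] model_row_minor[OF a gen] model_row_rank[OF a gen] in blast)+
  from slack_factorization.card_ge[OF this n] have "2 * CARD('n) \<le> extension_complexity P"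
    by (simp only: fac(2))
  moreover have "extension_complexity P \<le> 2 * CARD('n)"
  proof -
    have "P = {x \<in> affine hull P. \<forall>i. 0 \<le> u i x}"
    proof (intro equalityI subsetI)
      fix x assume "x \<in> P"
      then show "x \<in> {x \<in> affine hull P. \<forall>i. 0 \<le> u i x}" using u_nonneg by (auto intro: hull_inc)
    next
      fix x assume x: "x \<in> {x \<in> affine hull P. \<forall>i. 0 \<le> u i x}"
      then have "L (1, x) \<in> matrix_cone A" by (simp add: K.C u_def)
      then obtain z where z: "z \<in> homogenization P" "L (1, x) = L z" using L(3) by (metis imageE)
      have "(1, x) \<in> span (homogenization P)" using x affine_hull_homogenization by blast
      then have "(1, x) = z" using inj_onD[OF L(2) z(2)] z(1) span_base by blast
      then show "x \<in> P" using z(1) homogenization_eq[OF cP P_ne] by auto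
    qed
    then have "card (facets P) \<le> CARD('n + 'n)"
      by (intro card_facets_inequality_system[OF affine_affine_hull _ affine_u])
    then show ?thesis using extension_complexity_le_card_facets[OF P(1)] by simp
  qed
  ultimately show ?thesis by simp
qed

text \<open>The sum \<sigma> of the \<open>f\<close>-coordinates is positive on all rays, so the
  slice at height 1 is a polytope meeting every ray. This provides existence for the definite
  description in \<open>orbit_extension_complexity\<close>.\<close>

lemma polytope_with_homogenization:
  fixes A :: "real ^ ('n + 'n) ^ 'n::finite"
  assumes A: "normal_form A a \<gamma>"
  obtains P :: "(real ^ 'n) set" where "polytope P" "linearly_isomorphic (homogenization P) (matrix_cone A)"
proof -
  interpret K: generated_cone UNIV "\<lambda>x y. model_row a x (f_coordinates A y)" "matrix_cone A" "edges UNIV"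
    "\<lambda>e. inv (f_coordinates A) (edge_vector a e)"
    by (rule generated_cone_normal_form[OF A])
  have a: "reciprocal a" using A by (simp add: normal_form_def)
  have inj_A: "inj (f_coordinates A)" using A by (simp add: normal_form_def)
  note f_inv = surj_f_inv_f[OF bij_is_surj[OF bij_f_coordinates[OF inj_A]]]
  let ?w = "\<lambda>e. inv (f_coordinates A) (edge_vector a e)"
  define \<sigma> where "\<sigma> y = (\<Sum>k\<in>UNIV. f_coordinates A y $ k)" for y
  have lin: "linear \<sigma>"
    unfolding \<sigma>_def by (rule linearI)
      (simp_all add: linear_add[OF linear_f_coordinates] linear_scale[OF linear_f_coordinates] sum.distrib sum_distrib_left)
  have \<sigma>_pos: "0 < \<sigma> (?w e)" if e: "e \<in> edges UNIV" for e
  proof -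
    obtain i where i: "i \<in> e" using e by (auto elim: edgeE)
    have "0 < edge_vector a e $ i"
      using model_row_edge_vector[OF a e, of "Inr i"] i by (simp add: order_less_le)
    moreover have "0 \<le> edge_vector a e $ k" for k
      using model_row_edge_vector(1)[OF a e, of "Inr k"] by simp
    ultimately show ?thesis unfolding \<sigma>_def f_inv by (intro sum_pos2[of _ i]) auto
  qed
  define X where "X = (\<lambda>e. (1 / \<sigma> (?w e)) *\<^sub>R ?w e) ` edges UNIV"
  define P where "P = convex hull X"
  have "finite X" by (simp add: X_def finite_edges)
  then have "polytope P" by (auto simp: P_def polytope_def)
  have cone_K: "convex_cone (matrix_cone A)" using K.convex_cone_sub[of "{}"] by (simp add: K.sub_def)
  have P_K: "P \<subseteq> matrix_cone A"
    unfolding P_def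
  proof (rule hull_minimal)
    show "X \<subseteq> matrix_cone A"
      using K.w \<sigma>_pos by (auto simp: X_def less_imp_le intro!: convex_cone_scaleR[OF cone_K])
    show "convex (matrix_cone A)" using cone_K by (simp add: convex_cone_def)
  qed
  have P_\<sigma>: "P \<subseteq> {y. \<sigma> y = 1}"
    unfolding P_def
  proof (rule hull_minimal)
    show "X \<subseteq> {y. \<sigma> y = 1}" using \<sigma>_pos by (auto simp: X_def linear_scale[OF lin] less_imp_neq[symmetric])
    show "convex {y. \<sigma> y = 1}"
      unfolding convex_def by (auto simp: linear_add[OF lin] linear_scale[OF lin])
  qed
  let ?T = "{z. fst z = \<sigma> (snd z)}"
  have T: "subspace ?T"
    by (rule subspaceI) (auto simp: linear_0[OF lin] linear_add[OF lin] linear_scale[OF lin])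
  have "homogenization P \<subseteq> ?T"
    unfolding homogenization_def
  proof (rule hull_minimal)
    show "{1} \<times> P \<subseteq> ?T" using P_\<sigma> by auto
    show "convex_cone ?T" using T by (auto simp: convex_cone_iff subspace_def)
  qed
  then have "span (homogenization P) \<subseteq> ?T" using T by (rule span_minimal)
  then have fst_eq: "fst z = \<sigma> (snd z)" if "z \<in> span (homogenization P)" for z using that by blast
  then have inj: "inj_on snd (span (homogenization P))"
    by (intro inj_onI prod_eqI) simp_all
  have "snd ` homogenization P = matrix_cone A"
  proof (rule equalityI)
    have "homogenization P \<subseteq> {z. snd z \<in> matrix_cone A}"
      unfolding homogenization_def
    proof (rule hull_minimal)
      show "{1} \<times> P \<subseteq> {z. snd z \<in> matrix_cone A}" using P_K by auto
      show "convex_cone {z :: real \<times> (real ^ 'n). snd z \<in> matrix_cone A}"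
        using cone_K by (auto simp: convex_cone_iff)
    qed
    then show sub: "snd ` homogenization P \<subseteq> matrix_cone A" by auto
    have "convex_cone (homogenization P)" unfolding homogenization_def by (rule convex_cone_convex_cone_hull)
    then have cone: "convex_cone (snd ` homogenization P)" using convex_cone_linear_image linear_snd by blast
    have "?w e \<in> snd ` homogenization P" if e: "e \<in> edges UNIV" for e
    proof -
      have "(1, (1 / \<sigma> (?w e)) *\<^sub>R ?w e) \<in> homogenization P"
        unfolding homogenization_def P_def X_def using e by (intro hull_inc) (auto intro!: hull_inc)
      then have "\<sigma> (?w e) *\<^sub>R snd (1 :: real, (1 / \<sigma> (?w e)) *\<^sub>R ?w e) \<in> snd ` homogenization P"
        using \<sigma>_pos[OF e] by (intro convex_cone_scaleR[OF cone]) force+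
      then show ?thesis using \<sigma>_pos[OF e] by simp
    qed
    then have "convex_cone hull (snd ` homogenization P) = K.sub {}"
      using sub by (intro K.convex_cone_hull_eq_sub) (auto simp: K.sub_def)
    then show "matrix_cone A \<subseteq> snd ` homogenization P"
      using hull_same[of convex_cone, OF cone] by (auto simp: K.sub_def)
  qed
  with inj have "linearly_isomorphic (homogenization P) (matrix_cone A)"
    unfolding linearly_isomorphic_def using linear_snd by blast
  with \<open>polytope P\<close> show ?thesis using that by blast
qed

text \<open>Multiplying the columns by \<open>M\<close> transforms the cone by the transpose, and
  positive factors do not affect the inequalities. This provides uniqueness for the definite
  description.\<close>

lemma orbit_linearly_isomorphic:
  assumes B: "B \<in> matrix_orbit A" and S: "linearly_isomorphic S (matrix_cone B)"
  shows "linearly_isomorphic S (matrix_cone A)"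
proof -
  obtain M :: "real ^ 'a ^ 'a" and d where M: "invertible M" and d: "\<And>j. d j > (0::real)"
    and col: "\<And>j. column j B = d j *\<^sub>R (M *v column j A)"
    using B by (auto simp: matrix_orbit_def)
  let ?N = "(*v) (transpose M)"
  have dot: "(M *v c) \<bullet> y = c \<bullet> (transpose M *v y)" for c y :: "real ^ 'a"
    by (metis dot_lmul_matrix inner_commute transpose_matrix_vector transpose_transpose vector_transpose_matrix)
  have cone: "y \<in> matrix_cone B \<longleftrightarrow> transpose M *v y \<in> matrix_cone A" for y
  proof -
    have "0 \<le> d j * r \<longleftrightarrow> 0 \<le> r" for j r using d[of j] by (auto simp: zero_le_mult_iff)
    then show ?thesis by (simp add: matrix_cone_eq col dot del: transpose_matrix_vector)
  qed
  have bij: "bij ?N" using transpose_invertible[OF M] by (simp add: invertible_eq_bij)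
  have "?N ` matrix_cone B = matrix_cone A"
    using cone bij_is_surj[OF bij] by (auto simp: set_eq_iff image_iff surj_def) metis
  moreover obtain L where L: "linear L" "inj_on L (span S)" "L ` S = matrix_cone B"
    using S by (auto simp: linearly_isomorphic_def)
  ultimately have "(?N \<circ> L) ` S = matrix_cone A" by (metis image_comp)
  moreover have "linear (?N \<circ> L)" using L(1) by (intro linear_compose) auto
  moreover have "inj_on (?N \<circ> L) (span S)"
    using L(2) bij by (intro comp_inj_on) (auto intro: inj_on_subset[OF bij_is_inj])
  ultimately show ?thesis unfolding linearly_isomorphic_def by blast
qed

lemma orbit_extension_complexity_normal_form:
  fixes A :: "real ^ ('n + 'n) ^ 'n::finite"
  assumes A: "normal_form A a \<gamma>" and gen: "generic_weights a" and n: "5 \<le> CARD('n)"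
  shows "orbit_extension_complexity (matrix_orbit A) = 2 * CARD('n)"
  unfolding orbit_extension_complexity_def
proof (rule the_equality)
  have "A \<in> matrix_orbit A"
    unfolding matrix_orbit_def by (auto intro!: exI[of _ "mat 1"] exI[of _ "\<lambda>_. 1"] simp: invertible_def)
  then show "\<exists>B\<in>matrix_orbit A. \<exists>P :: (real ^ 'n) set. polytope P \<and>
      linearly_isomorphic (homogenization P) (matrix_cone B) \<and> extension_complexity P = 2 * CARD('n)"
    using polytope_with_homogenization[OF A] extension_complexity_normal_form[OF A gen n] by metis
next
  fix r assume "\<exists>B\<in>matrix_orbit A. \<exists>P :: (real ^ 'n) set. polytope P \<and>
      linearly_isomorphic (homogenization P) (matrix_cone B) \<and> extension_complexity P = r"
  then show "r = 2 * CARD('n)"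
    using orbit_linearly_isomorphic extension_complexity_normal_form[OF A gen n] by blast
qed

section \<open>Density of generic weights\<close>

text \<open>Zeros of an entire function that is not identically zero are isolated. One point of
  nonvanishing, possibly far from 0, thus yields nonvanishing for all small positive real
  parameters.\<close>

lemma eventually_entire_nonzero:
  assumes "f holomorphic_on UNIV" "f z \<noteq> 0"
  shows "eventually (\<lambda>t. f (of_real t) \<noteq> 0) (at_right (0::real))"
proof -
  have "eventually (\<lambda>w. f w \<noteq> 0 \<and> w \<in> UNIV) (at 0)"
    by (rule non_zero_neighbour_alt[OF assms(1) _ _ _ _ assms(2)]) auto
  moreover have "filterlim (\<lambda>t. complex_of_real t) (at 0) (at_right 0)"
    by (intro filterlim_atI) (auto intro!: tendsto_eq_intros simp: eventually_at_filter)
  ultimately have "eventually (\<lambda>t. f (of_real t) \<noteq> 0 \<and> complex_of_real t \<in> UNIV) (at_right (0::real))"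
    by (rule eventually_compose_filterlim)
  then show ?thesis by simp
qed

text \<open>At time 1 the weights are all 1, where the matrices in question are visibly nonsingular.\<close>

definition weight_path :: "('n \<Rightarrow> 'n \<Rightarrow> real) \<Rightarrow> ('n \<Rightarrow> 'n \<Rightarrow> real) \<Rightarrow> 'a \<Rightarrow> 'n \<Rightarrow> 'n \<Rightarrow> 'a::{real_normed_field,banach}" where
  "weight_path x y t i j = exp ((1 - t) * (of_real (x i j) + t * of_real (y i j)))"

lemma of_real_weight_path: "of_real (weight_path x y t i j) = weight_path x y (complex_of_real t) i j"
  by (simp add: weight_path_def exp_of_real[symmetric] del: exp_of_real)

lemma tendsto_weight_path: "((\<lambda>t. weight_path x y t i j) \<longlongrightarrow> weight_path x y 0 i j) (at_right (0::real))"
  unfolding weight_path_def by (auto intro!: tendsto_eq_intros)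

lemma holomorphic_weight_path: "(\<lambda>z. weight_path x y z i j) holomorphic_on UNIV"
  unfolding weight_path_def by (intro holomorphic_intros)

text \<open>A square matrix indexed by the subset \<open>V\<close>, whose size is not a type, is padded by the identity.\<close>

definition padded_matrix :: "'n set \<Rightarrow> ('n \<Rightarrow> 'n \<Rightarrow> 'a::field) \<Rightarrow> 'a ^ 'n ^ 'n::finite" where
  "padded_matrix V a = (\<chi> k j. if k \<in> V \<and> j \<in> V then if k = j then -1 else a k j else if k = j then 1 else 0)"

text \<open>On \<open>V\<close> the matrix is all ones minus twice the identity, so the entries of a
  kernel vector equal half their sum \<open>s\<close>. Summation gives
  \<open>s = card V * s / 2\<close>, which forces \<open>s = 0\<close> as \<open>card V\<close> is
  not 2.\<close>

lemma det_padded_matrix_ones: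
  assumes V: "3 \<le> card V" and a: "\<And>k j. a k j = (1 :: complex)"
  shows "det (padded_matrix V a) \<noteq> 0"
proof -
  have "\<exists>B. B ** padded_matrix V a = mat 1"
    unfolding matrix_left_invertible_ker
  proof (intro allI impI)
    fix v assume 0: "padded_matrix V a *v v = 0"
    define s where "s = (\<Sum>j\<in>V. v $ j)"
    have out: "v $ k = 0" if "k \<notin> V" for k
    proof -
      have "0 = (padded_matrix V a *v v) $ k" by (simp add: 0)
      also have "\<dots> = (\<Sum>j\<in>UNIV. (if k = j then 1 else 0) * v $ j)"
        unfolding matrix_vector_mult_def padded_matrix_def using that by simp
      also have "\<dots> = v $ k" by (simp add: if_distrib[of "\<lambda>x. x * _"] cong: if_cong)
      finally show ?thesis by simp
    qed
    have inside: "v $ k = s / 2" if k: "k \<in> V" for k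
    proof -
      have "0 = (padded_matrix V a *v v) $ k" by (simp add: 0)
      also have "\<dots> = (\<Sum>j\<in>UNIV. (padded_matrix V a $ k $ j) * v $ j)"
        by (simp add: matrix_vector_mult_def)
      also have "\<dots> = (\<Sum>j\<in>V. (padded_matrix V a $ k $ j) * v $ j)"
        using out by (intro sum.mono_neutral_right) auto
      also have "\<dots> = (\<Sum>j\<in>V. v $ j - (if j = k then 2 * v $ k else 0))"
        using k by (intro sum.cong) (auto simp: padded_matrix_def a)
      also have "\<dots> = s - 2 * v $ k" using k by (simp add: sum_subtractf s_def)
      finally show ?thesis by simp
    qed
    have "(\<Sum>j\<in>V. v $ j) = (\<Sum>j\<in>V. s / 2)" by (rule sum.cong) (simp_all add: inside)
    then have "s = of_nat (card V) * (s / 2)" by (simp add: s_def[symmetric])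
    then have "s * (of_nat (card V) - 2) = 0" by (simp add: algebra_simps)
    moreover have "of_nat (card V) \<noteq> (of_nat 2 :: complex)" using V by (simp only: of_nat_eq_iff)
    ultimately have "s = 0" by simp
    then show "v = 0" using out inside by (auto simp: vec_eq_iff)
  qed
  then show ?thesis
    by (simp add: invertible_det_nz[symmetric] invertible_left_inverse)
qed

lemma padded_matrix_kernel:
  fixes a :: "'n::finite \<Rightarrow> 'n \<Rightarrow> real" and c :: "'n \<Rightarrow> real"
  assumes det: "det (padded_matrix V (\<lambda>k j. complex_of_real (a k j))) \<noteq> 0"
    and c: "\<And>j. j \<in> V \<Longrightarrow> (\<Sum>k\<in>V. c k * (if k = j then -1 else a k j)) = 0" and k: "k \<in> V"
  shows "c k = 0"
proof -
  let ?N = "padded_matrix V (\<lambda>k j. complex_of_real (a k j))"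
  define v where "v = (\<chi> k. if k \<in> V then complex_of_real (c k) else 0)"
  have "transpose ?N *v v = 0"
  proof (subst vec_eq_iff, intro allI)
    fix j
    have "(transpose ?N *v v) $ j = (\<Sum>k\<in>UNIV. ?N $ k $ j * v $ k)"
      by (simp add: matrix_vector_mult_def transpose_def)
    also have "\<dots> = (\<Sum>k\<in>V. ?N $ k $ j * v $ k)"
      by (rule sum.mono_neutral_right) (auto simp: v_def)
    also have "\<dots> = 0"
    proof (cases "j \<in> V")
      case True
      have "(\<Sum>k\<in>V. ?N $ k $ j * v $ k) = (\<Sum>k\<in>V. complex_of_real (c k * (if k = j then -1 else a k j)))"
        by (rule sum.cong) (auto simp: padded_matrix_def v_def True)
      also have "\<dots> = complex_of_real (\<Sum>k\<in>V. c k * (if k = j then -1 else a k j))"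
        by (simp only: of_real_sum)
      finally show ?thesis using c[OF True] by simp
    next
      case False
      then show ?thesis by (intro sum.neutral) (auto simp: padded_matrix_def)
    qed
    finally show "(transpose ?N *v v) $ j = 0 $ j" by simp
  qed
  moreover have "invertible (transpose ?N)"
    using det by (simp add: invertible_det_nz det_transpose)
  ultimately have "v = 0" by (simp add: invertible_left_inverse matrix_left_invertible_ker)
  then have "v $ k = 0" by simp
  with k show ?thesis by (simp add: v_def)
qed

text \<open>The largest of the four exponents decides: its power alone exceeds the sum of the two
  distinct smaller powers on the other side.\<close>

lemma powers_of_two_sums_ne:
  assumes "distinct [i, j, k, m :: nat]"
  shows "(2::nat) ^ i + 2 ^ k \<noteq> 2 ^ j + 2 ^ m"
proof -
  have less: "(2::nat) ^ q + 2 ^ r < 2 ^ s" if "q < s" "r < s" "q \<noteq> r" for q r s :: nat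
  proof -
    have "(2::nat) ^ max q r * 2 \<le> 2 ^ s"
      using that power_increasing[of "Suc (max q r)" s "2::nat"] by (simp add: Suc_le_eq)
    moreover have "(2::nat) ^ min q r < 2 ^ max q r" using that by (intro power_strict_increasing) auto
    moreover have "(2::nat) ^ q + 2 ^ r = 2 ^ max q r + 2 ^ min q r" by (simp add: max_def min_def)
    ultimately show ?thesis by linarith
  qed
  let ?s = "max (max i k) (max j m)"
  consider "?s = i" | "?s = k" | "?s = j" | "?s = m" by linarith
  then show ?thesis
  proof cases
    case 1 then show ?thesis using less[of j i m] assms by (auto simp: max_def split: if_splits)
  next
    case 2 then show ?thesis using less[of j k m] assms by (auto simp: max_def split: if_splits)
  next
    case 3 then show ?thesis using less[of i j k] assms by (auto simp: max_def split: if_splits)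
  next
    case 4 then show ?thesis using less[of i m k] assms by (auto simp: max_def split: if_splits)
  qed
qed

text \<open>With \<open>p i = 2 ^ g i\<close>, the relevant differences of \<open>p i ^ 2 * p j - p i * p j ^ 2\<close> factor as
  \<open>(p k - p i) * (p j - p m) * (p k + p i - p j - p m)\<close>.\<close>

lemma separating_direction:
  obtains y :: "'n::finite \<Rightarrow> 'n \<Rightarrow> real" where "\<And>i j. y j i = - y i j"
    "\<And>i j k m. distinct [i, j, k, m] \<Longrightarrow> y k j + y j i \<noteq> y k m + y m i"
proof -
  obtain g :: "'n \<Rightarrow> nat" where g: "inj g"
    using finite_imp_inj_to_nat_seg[of "UNIV :: 'n set"] by auto
  define p :: "'n \<Rightarrow> real" where "p i = 2 ^ g i" for i
  have p_ne: "p i \<noteq> p j" if "i \<noteq> j" for i j using g that by (auto simp: p_def inj_eq)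
  show ?thesis
  \<comment> \<open>Antisymmetry will keep the weights reciprocal. The simplest antisymmetric choice
    \<open>p i - p j\<close> telescopes along paths and separates nothing; this cubic does.\<close>
  proof (rule that[of "\<lambda>i j. p i ^ 2 * p j - p i * p j ^ 2"])
    fix i j k m :: 'n assume d: "distinct [i, j, k, m]"
    then have "distinct [g i, g j, g k, g m]" using g by (auto simp: inj_eq)
    then have "real (2 ^ g i + 2 ^ g k) \<noteq> real (2 ^ g j + 2 ^ g m)"
      using powers_of_two_sums_ne by (simp only: of_nat_eq_iff) blast
    then have "p k + p i - p j - p m \<noteq> 0" by (simp add: p_def)
    then have "(p k - p i) * (p j - p m) * (p k + p i - p j - p m) \<noteq> 0"
      using p_ne[of k i] p_ne[of j m] d by auto
    then show "(p k)\<^sup>2 * p j - p k * (p j)\<^sup>2 + ((p j)\<^sup>2 * p i - p j * (p i)\<^sup>2) \<noteq>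
        (p k)\<^sup>2 * p m - p k * (p m)\<^sup>2 + ((p m)\<^sup>2 * p i - p m * (p i)\<^sup>2)"
      by (simp add: algebra_simps power2_eq_square)
  qed simp
qed

text \<open>There are finitely many conditions, and each fails only at isolated parameters: a minor
  condition where an affine function with slope \<open>Y\<close> vanishes, a rank condition where an
  entire determinant vanishes.\<close>

lemma eventually_generic_weight_path:
  fixes x y :: "'n::finite \<Rightarrow> 'n \<Rightarrow> real"
  assumes y: "\<And>i j k m. distinct [i, j, k, m] \<Longrightarrow> y k j + y j i \<noteq> y k m + y m i"
  shows "eventually (\<lambda>t. generic_weights (weight_path x y t)) (at_right 0)"
proof -
  let ?a = "\<lambda>t :: real. weight_path x y t"
  have minors: "eventually (\<lambda>t. distinct [i, j, k, m] \<longrightarrow> ?a t k j * ?a t j i \<noteq> ?a t k m * ?a t m i) (at_right 0)"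
    for i j k m
  proof (cases "distinct [i, j, k, m]")
    case True
    define X Y where "X = x k j + x j i - x k m - x m i" and "Y = y k j + y j i - y k m - y m i"
    have "Y \<noteq> 0" using y[OF True] by (simp add: Y_def)
    \<comment> \<open>At this parameter the affine function takes the value 1, so it is not
      identically zero.\<close>
    then have "complex_of_real X + ((1 - complex_of_real X) / of_real Y) * of_real Y \<noteq> 0" by simp
    then have "eventually (\<lambda>t. complex_of_real X + of_real t * of_real Y \<noteq> 0) (at_right 0)"
      by (rule eventually_entire_nonzero[of "\<lambda>z. of_real X + z * of_real Y", rotated]) (intro holomorphic_intros)
    moreover have "eventually (\<lambda>t::real. t < 1) (at_right 0)"
      using eventually_at_right_real[of 0 1] by (rule eventually_mono) auto
    ultimately show ?thesis
    proof eventually_elim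
      case (elim t)
      have "complex_of_real X + of_real t * of_real Y = of_real (X + t * Y)" by simp
      with elim have "X + t * Y \<noteq> 0" by (metis of_real_0)
      with elim have "(1 - t) * (X + t * Y) \<noteq> 0" by simp
      then have "(1 - t) * (x k j + t * y k j) + (1 - t) * (x j i + t * y j i) \<noteq>
          (1 - t) * (x k m + t * y k m) + (1 - t) * (x m i + t * y m i)"
        by (simp add: X_def Y_def algebra_simps)
      then show ?case by (simp add: weight_path_def exp_add[symmetric] del: exp_add)
    qed
  qed auto
  have ranks: "eventually (\<lambda>t. 6 \<le> card V \<longrightarrow> det (padded_matrix V (\<lambda>k j. complex_of_real (?a t k j))) \<noteq> 0) (at_right 0)"
    for V :: "'n set"
  proof (cases "6 \<le> card V")
    case True
    define D where "D z = det (padded_matrix V (weight_path x y (z :: complex)))" for z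
    have "(\<lambda>z. padded_matrix V (weight_path x y z) $ i $ j) holomorphic_on UNIV" for i j
      using holomorphic_weight_path[of x y i j]
      by (cases "i \<in> V"; cases "j \<in> V"; cases "i = j") (simp_all add: padded_matrix_def holomorphic_on_const)
    then have "D holomorphic_on UNIV"
      unfolding D_def det_def by (intro holomorphic_intros)
    moreover have "D 1 \<noteq> 0"
      unfolding D_def using True by (intro det_padded_matrix_ones) (auto simp: weight_path_def)
    ultimately have "eventually (\<lambda>t. D (of_real t) \<noteq> 0) (at_right (0::real))"
      by (rule eventually_entire_nonzero)
    then show ?thesis by eventually_elim (simp add: D_def of_real_weight_path)
  qed auto
  have "eventually (\<lambda>t. (\<forall>i j k m. distinct [i, j, k, m] \<longrightarrow> ?a t k j * ?a t j i \<noteq> ?a t k m * ?a t m i) \<and>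
    (\<forall>V. 6 \<le> card V \<longrightarrow> det (padded_matrix V (\<lambda>k j. complex_of_real (?a t k j))) \<noteq> 0)) (at_right 0)"
    using minors ranks by (intro eventually_conj eventually_all_finite) blast+
  then show ?thesis
    unfolding generic_weights_def
    by eventually_elim (use padded_matrix_kernel in blast)
qed

text \<open>The columns \<open>f_k\<close> and the factors \<gamma> stay fixed and only the weights
  move. Their logarithms remain antisymmetric off the diagonal, so every matrix on the path has a
  normal form, and the path tends to \<open>A\<close> at 0.\<close>

lemma generic_normal_form_dense:
  fixes A :: "real ^ ('n + 'n) ^ 'n::finite"
  assumes A: "normal_form A a \<gamma>" and U: "open U" "A \<in> U"
  obtains B b where "B \<in> U" "normal_form B b \<gamma>" "generic_weights b"
proof -
  obtain y :: "'n \<Rightarrow> 'n \<Rightarrow> real" where y: "\<And>i j. y j i = - y i j"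
    "\<And>i j k m. distinct [i, j, k, m] \<Longrightarrow> y k j + y j i \<noteq> y k m + y m i"
    using separating_direction by blast
  have a: "reciprocal a" using A by (simp add: normal_form_def)
  define x where "x i j = ln (a i j)" for i j
  define b :: "real \<Rightarrow> 'n \<Rightarrow> 'n \<Rightarrow> real" where "b t = weight_path x y t" for t
  let ?f = "\<lambda>k. column (Inr k) A"
  define B :: "real \<Rightarrow> real ^ ('n + 'n) ^ 'n" where
    "B t = (\<chi> i r. case r of Inl k \<Rightarrow> \<gamma> k * ((\<Sum>j\<in>UNIV - {k}. b t k j * ?f j $ i) - ?f k $ i) | Inr k \<Rightarrow> ?f k $ i)" for t
  have recip: "reciprocal (b t)" for t
    unfolding reciprocal_def
  proof (intro allI impI)
    fix i j :: 'n assume "i \<noteq> j"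
    then have "x j i = - x i j"
      using a by (simp add: reciprocal_def x_def ln_mult_pos[symmetric] eq_neg_iff_add_eq_0 mult.commute)
    then show "0 < b t i j \<and> b t i j * b t j i = 1"
      using y(1)[of i j] by (simp add: b_def weight_path_def exp_add[symmetric] algebra_simps)
  qed
  have col_f: "column (Inr k) (B t) = ?f k" for t k by (simp add: B_def column_def vec_eq_iff)
  have normal: "normal_form (B t) (b t) \<gamma>" for t
  proof -
    have "f_coordinates (B t) = f_coordinates A" by (simp add: f_coordinates_def fun_eq_iff col_f)
    moreover have "column (Inl k) (B t) =
        \<gamma> k *\<^sub>R ((\<Sum>j\<in>UNIV - {k}. b t k j *\<^sub>R column (Inr j) (B t)) - column (Inr k) (B t))" for k
      unfolding col_f by (simp add: B_def column_def vec_eq_iff)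
    ultimately show ?thesis using A recip by (simp add: normal_form_def)
  qed
  have b0: "b 0 i j = a i j" if "i \<noteq> j" for i j
    using a that by (simp add: b_def weight_path_def x_def reciprocal_def)
  have B0: "B 0 = A"
  proof -
    have "column r (B 0) = column r A" for r
    proof (cases r)
      case (Inl k)
      have "(\<Sum>j\<in>UNIV - {k}. b 0 k j *\<^sub>R ?f j) = (\<Sum>j\<in>UNIV - {k}. a k j *\<^sub>R ?f j)"
        by (rule sum.cong) (auto simp: b0)
      then show ?thesis using Inl normal[of 0] A by (simp add: normal_form_def col_f)
    qed (simp add: col_f)
    then show ?thesis by (simp add: column_def vec_eq_iff)
  qed
  have "(B \<longlongrightarrow> B 0) (at_right 0)"
  proof (intro vec_tendstoI)
    fix i and r :: "'n + 'n"
    show "((\<lambda>t. B t $ i $ r) \<longlongrightarrow> B 0 $ i $ r) (at_right 0)"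
      unfolding B_def b_def
      by (cases r) (auto intro!: tendsto_intros tendsto_weight_path)
  qed
  then have "eventually (\<lambda>t. B t \<in> U) (at_right 0)" using U B0 by (simp add: tendsto_def)
  moreover have "eventually (\<lambda>t. generic_weights (b t)) (at_right 0)"
    unfolding b_def by (rule eventually_generic_weight_path[OF y(2)])
  ultimately have "eventually (\<lambda>t. B t \<in> U \<and> generic_weights (b t)) (at_right 0)" by (rule eventually_conj)
  then obtain t where "B t \<in> U" "generic_weights (b t)"
    using eventually_happens'[of "at_right (0::real)"] by auto
  with normal that show ?thesis by blast
qed

theorem corollary1p5:
  assumes "CARD('n::finite) \<ge> 5"
  shows "(realization_space 2 :: (real ^ ('n + 'n) ^ 'n) set topology) closure_of
           {\<rho> \<in> topspace (realization_space 2). orbit_extension_complexity \<rho> = 2 * CARD('n)}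
         = topspace (realization_space 2)"
proof (rule equalityI[OF closure_of_subset_topspace], rule subsetI)
  let ?X = "realization_space 2 :: (real ^ ('n + 'n) ^ 'n) set topology"
  let ?R = "realization_matrices 2 :: (real ^ ('n + 'n) ^ 'n) set"
  have top: "topspace ?X = matrix_orbit ` ?R"
    by (simp add: realization_space_def topspace_quotient_topology)
  fix \<rho> assume \<rho>: "\<rho> \<in> topspace ?X"
  then obtain A where A: "A \<in> ?R" "\<rho> = matrix_orbit A" by (auto simp: top)
  have "\<exists>\<sigma>\<in>{\<rho> \<in> topspace ?X. orbit_extension_complexity \<rho> = 2 * CARD('n)}. \<sigma> \<in> T"
    if T: "\<rho> \<in> T" "openin ?X T" for T
  proof -
    have "openin (subtopology euclidean ?R) {B \<in> ?R. matrix_orbit B \<in> T}"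
      using T(2) by (simp add: realization_space_def openin_quotient_topology)
    then obtain U where U: "open U" "{B \<in> ?R. matrix_orbit B \<in> T} = U \<inter> ?R"
      by (auto simp: openin_subtopology)
    then have "A \<in> U" using A T(1) by blast
    obtain a \<gamma> where "normal_form A a \<gamma>"
      using realization_imp_normal_form[OF A(1)] assms by auto
    then obtain B b where B: "B \<in> U" "normal_form B b \<gamma>" "generic_weights b"
      using generic_normal_form_dense[OF _ U(1) \<open>A \<in> U\<close>] by blast
    then have "B \<in> ?R" using normal_form_imp_realization by blast
    then have "matrix_orbit B \<in> T" "matrix_orbit B \<in> topspace ?X" using B(1) U(2) top by blast+
    then show ?thesis using orbit_extension_complexity_normal_form[OF B(2,3) assms] by blast
  qed
  with \<rho> show "\<rho> \<in> ?X closure_of {\<rho> \<in> topspace ?X. orbit_extension_complexity \<rho> = 2 * CARD('n)}"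
    by (auto simp: in_closure_of)
qed

end
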